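(* Consider the balanced DHV network, with $m_1+m_4=m_2+m_5=m_3+m_6=1$. There exists $\bar\alpha\in(0,1)$ (depending on the mean service times $m_1,\dots,m_6$) such that if $\alpha_1>\bar\alpha$ and (i) the nominal-load conditions are satisfied: $\rho_1=\rho_2=\rho_3<1$ (equivalently, $\alpha_1<1$), (ii) $m_2+m_4+m_6<2$, then the network is robustly queue-ratio stable.
   Context: DHV network: $J=3$ stations, $K=6$ classes. Jobs arrive exogenously only to class $1$, at rate $\alpha_1$, and follow the deterministic route $1\to2\to3\to4\to5\to6\to$ exit (so $P_{k,k+1}=1$ for $k=1,\dots,5$, all other $P_{kl}=0$, $\alpha=(\alpha_1,0,\dots,0)'$). Station 1 serves classes $1,4$; station 2 serves $2,5$; station 3 serves $3,6$; $s(k)$ is the station serving class $k$. $m_k>0$ is the mean service time of class $k$, $M=\mathrm{diag}(m_1,\dots,m_6)$, $C$ is the $3\times6$ matrix with $C_{jk}=1$ if $s(k)=j$ and $0$ otherwise, $Q=(I-P')^{-1}$, $\rho=CMQ\alpha$, $e$ is the all-ones vector. The network is balanced if all $\rho_j$ are equal; time is normalized so that the common value of $m_1+m_4$, $m_2+m_5$, $m_3+m_6$ is $1$. A ratio matrix (encoding a queue-ratio policy) is a nonnegative $K\times J$ matrix $\Delta$ with $\Delta_{kj}=0$ if $s(k)\ne j$, and $CM\Delta=I$. When $CMQ\Delta$ is invertible, $R_\Delta=(CMQ\Delta)^{-1}$ and $\theta_\Delta=R_\Delta(\rho-e)$. Fluid model under $\Delta$. A solution consists of Lipschitz functions on $[0,\infty)$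 satisfying: $\bar Z(t)=\bar Z(0)+\alpha t-(I-P')M^{-1}\bar T(t)\ge 0$; $\bar W(t)=CM\bar Z(t)$; $\bar\epsilon(t)=\bar Z(t)-\Delta\bar W(t)$; $\bar T(0)=0$ and $\bar T$ is nondecreasing; $\bar Y(t)=et-C\bar T(t)$ is nondecreasing; $\int_0^\infty \bar W_j(s)\,d\bar Y_j(s)=0$ for each $j$; and for each class $k$ and each time $t$ of differentiability, $\bar\epsilon_k^+(t)\bigl(1-\dot{\bar T}{}_k^+(t)\bigr)=0$, where $\bar\epsilon_k^+(t)=\sum_{i\le k:\,s(i)=s(k),\,\bar\epsilon_i(t)>0}\bar\epsilon_i(t)$ and $\dot{\bar T}{}_k^+(t)=\sum_{i\le k:\,s(i)=s(k),\,\bar\epsilon_i(t)>0}\dot{\bar T}_i(t)$. State-space collapse (SSC) under $\Delta$: for every fluid solution there is $t_0\ge0$ (possibly depending on $\bar Z(0)$) with $\bar Z(t)=\Delta\bar W(t)$ for all $t\ge t_0$. Skorohod problem (SP) with data $(R,\theta)$: given $\bar W(0)\ge0$, a pair of continuous functions $(\bar Y,\bar W)$ is a solution if $\bar W(t)=\bar W(0)+\theta t+R\bar Y(t)\ge0$, $\bar Y(0)=0$, $\bar Y$ is nondecreasing, and $\int_0^\infty\bar W_j(t)\,d\bar Y_j(t)=0$ for all $j$. It is stable if for every solution there is $T<\infty$ with $\bar W(t)=0$ for all $t\ge T$. After state-space collapse the fluid workload $\bar W$ solves the SP with data $(R_\Delta,\theta_\Delta)$. Robust queue-ratio stability of the network: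 for every ratio matrix $\Delta$, the fluid model satisfies SSC, $CMQ\Delta$ is invertible, and the SP with data $(R_\Delta,\theta_\Delta)$ is stable (so that the collapsed fluid workload empties in finite time). *)

theory Defs
  imports "HOL-Analysis.Analysis"
begin

section \<open>Multiclass queueing networks\<close>

text \<open>
  A network is given by an exogenous arrival-rate vector \<open>\<alpha>\<close>, a routing matrix \<open>P\<close>
  (\<open>P $ k $ l\<close> is the fraction of class \<open>k\<close> departures that become class \<open>l\<close>), a vector \<open>m\<close> of
  mean service times, and the map \<open>s\<close> sending a class to the station that serves it.
\<close>

text \<open>
  \<open>('r, 'c) rmat\<close> has rows indexed by \<open>'r\<close> and columns by \<open>'c\<close>.  The abbreviations allow sort
  constraints beyond \<open>finite\<close>, which the syntax \<open>real^'n\<close> would clash with.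
\<close>

type_synonym 'n rvec = "(real, 'n) vec"

type_synonym ('r, 'c) rmat = "((real, 'c) vec, 'r) vec"

definition constituency :: "('k::finite \<Rightarrow> 'j::finite) \<Rightarrow> ('j, 'k) rmat" where
  "constituency s = (\<chi> j k. if s k = j then 1 else 0)"

definition diag_mat :: "('k::finite) rvec \<Rightarrow> ('k, 'k) rmat" where
  "diag_mat v = (\<chi> k l. if k = l then v $ k else 0)"

definition visit_matrix :: "('k::finite, 'k) rmat \<Rightarrow> ('k, 'k) rmat" where
  "visit_matrix P = matrix_inv (mat 1 - transpose P)"

definition traffic_intensity ::
  "'k rvec \<Rightarrow> ('k, 'k) rmat \<Rightarrow> 'k rvec \<Rightarrow> ('k::finite \<Rightarrow> 'j::finite) \<Rightarrow> 'j rvec" where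
  "traffic_intensity \<alpha> P m s = (constituency s ** diag_mat m ** visit_matrix P) *v \<alpha>"

definition ratio_matrix :: "'k rvec \<Rightarrow> ('k::finite \<Rightarrow> 'j::finite) \<Rightarrow> ('k, 'j) rmat \<Rightarrow> bool" where
  "ratio_matrix m s \<Delta> \<longleftrightarrow>
     (\<forall>k j. 0 \<le> \<Delta> $ k $ j) \<and>
     (\<forall>k j. s k \<noteq> j \<longrightarrow> \<Delta> $ k $ j = 0) \<and>
     constituency s ** diag_mat m ** \<Delta> = mat 1"

definition total_workload_matrix ::
  "('k, 'k) rmat \<Rightarrow> 'k rvec \<Rightarrow> ('k::finite \<Rightarrow> 'j::finite) \<Rightarrow> ('k, 'j) rmat \<Rightarrow> ('j, 'j) rmat" where
  "total_workload_matrix P m s \<Delta> = constituency s ** diag_mat m ** visit_matrix P ** \<Delta>"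

definition reflection_matrix ::
  "('k, 'k) rmat \<Rightarrow> 'k rvec \<Rightarrow> ('k::finite \<Rightarrow> 'j::finite) \<Rightarrow> ('k, 'j) rmat \<Rightarrow> ('j, 'j) rmat" where
  "reflection_matrix P m s \<Delta> = matrix_inv (total_workload_matrix P m s \<Delta>)"

definition drift_vector ::
  "'k rvec \<Rightarrow> ('k, 'k) rmat \<Rightarrow> 'k rvec \<Rightarrow> ('k::finite \<Rightarrow> 'j::finite) \<Rightarrow> ('k, 'j) rmat \<Rightarrow> 'j rvec" where
  "drift_vector \<alpha> P m s \<Delta> = reflection_matrix P m s \<Delta> *v (traffic_intensity \<alpha> P m s - 1)"

section \<open>Fluid model and state-space collapse\<close>

text \<open>
  All processes have time domain \<open>[0, \<infinity>)\<close> and are represented by functions on \<open>real\<close> whose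
  values at negative times are irrelevant.  Below, \<open>complementary w y\<close> says
  \<open>\<integral>\<^sub>0\<^sup>\<infinity> w dy = 0\<close> as a Lebesgue--Stieltjes integral; it is only used for \<open>w\<close> continuous and
  nonnegative and \<open>y\<close> continuous and nondecreasing on \<open>[0, \<infinity>)\<close>.  The extension of \<open>y\<close> by the
  constant \<open>y 0\<close> to negative times makes it a distribution function on the whole line, as
  required by \<open>interval_measure\<close>, without adding mass.
\<close>

definition complementary :: "(real \<Rightarrow> real) \<Rightarrow> (real \<Rightarrow> real) \<Rightarrow> bool" where
  "complementary w y \<longleftrightarrow>
     (\<integral>\<^sup>+ t \<in> {0..}. ennreal (w t) \<partial>interval_measure (\<lambda>t. y (max 0 t))) = 0"

text \<open>
  \<open>priority_sum s \<epsilon> x k\<close> adds up \<open>x\<close> over the classes \<open>i \<le> k\<close> at the station of \<open>k\<close> with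
  \<open>\<epsilon> $ i > 0\<close>; with \<open>x = \<epsilon>\<close> and \<open>x = dT/dt\<close> it gives the two sums in the policy condition.
\<close>

definition priority_sum ::
  "('k::{finite,linorder} \<Rightarrow> 'j::finite) \<Rightarrow> 'k rvec \<Rightarrow> 'k rvec \<Rightarrow> 'k \<Rightarrow> real" where
  "priority_sum s \<epsilon> x k = (\<Sum>i | i \<le> k \<and> s i = s k \<and> \<epsilon> $ i > 0. x $ i)"

definition fluid_solution ::
  "('k::{finite,linorder}) rvec \<Rightarrow> ('k, 'k) rmat \<Rightarrow> 'k rvec \<Rightarrow> ('k \<Rightarrow> 'j::finite) \<Rightarrow> ('k, 'j) rmat \<Rightarrow>
   (real \<Rightarrow> 'k rvec) \<Rightarrow> (real \<Rightarrow> 'j rvec) \<Rightarrow> (real \<Rightarrow> 'k rvec) \<Rightarrow> (real \<Rightarrow> 'k rvec) \<Rightarrow>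
   (real \<Rightarrow> 'j rvec) \<Rightarrow> bool"
where
  "fluid_solution \<alpha> P m s \<Delta> Z W \<epsilon> T Y \<longleftrightarrow>
     (\<exists>L. L-lipschitz_on {0..} Z) \<and> (\<exists>L. L-lipschitz_on {0..} W) \<and>
     (\<exists>L. L-lipschitz_on {0..} \<epsilon>) \<and> (\<exists>L. L-lipschitz_on {0..} T) \<and>
     (\<exists>L. L-lipschitz_on {0..} Y) \<and>
     (\<forall>t\<ge>0. Z t = Z 0 + t *\<^sub>R \<alpha> -
                  ((mat 1 - transpose P) ** matrix_inv (diag_mat m)) *v T t) \<and>
     (\<forall>t\<ge>0. \<forall>k. 0 \<le> Z t $ k) \<and>
     (\<forall>t\<ge>0. W t = (constituency s ** diag_mat m) *v Z t) \<and>
     (\<forall>t\<ge>0. \<epsilon> t = Z t - \<Delta> *v W t) \<and>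
     T 0 = 0 \<and> (\<forall>k. mono_on {0..} (\<lambda>t. T t $ k)) \<and>
     (\<forall>t\<ge>0. Y t = t *\<^sub>R 1 - constituency s *v T t) \<and>
     (\<forall>j. mono_on {0..} (\<lambda>t. Y t $ j)) \<and>
     (\<forall>j. complementary (\<lambda>t. W t $ j) (\<lambda>t. Y t $ j)) \<and>
     (\<forall>t>0. \<forall>T'. (T has_vector_derivative T') (at t) \<longrightarrow>
        (\<forall>k. priority_sum s (\<epsilon> t) (\<epsilon> t) k * (1 - priority_sum s (\<epsilon> t) T' k) = 0))"

definition state_space_collapse ::
  "('k::{finite,linorder}) rvec \<Rightarrow> ('k, 'k) rmat \<Rightarrow> 'k rvec \<Rightarrow> ('k \<Rightarrow> 'j::finite) \<Rightarrow> ('k, 'j) rmat \<Rightarrow> bool"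
where
  "state_space_collapse \<alpha> P m s \<Delta> \<longleftrightarrow>
     (\<forall>Z W \<epsilon> T Y. fluid_solution \<alpha> P m s \<Delta> Z W \<epsilon> T Y \<longrightarrow>
        (\<exists>t0\<ge>0. \<forall>t\<ge>t0. Z t = \<Delta> *v W t))"

section \<open>Skorohod problem and robust stability\<close>

definition skorohod_solution ::
  "('j::finite, 'j) rmat \<Rightarrow> 'j rvec \<Rightarrow> (real \<Rightarrow> 'j rvec) \<Rightarrow> (real \<Rightarrow> 'j rvec) \<Rightarrow> bool" where
  "skorohod_solution R \<theta> Y W \<longleftrightarrow>
     continuous_on {0..} Y \<and> continuous_on {0..} W \<and>
     (\<forall>t\<ge>0. W t = W 0 + t *\<^sub>R \<theta> + R *v Y t) \<and>
     (\<forall>t\<ge>0. \<forall>j. 0 \<le> W t $ j) \<and>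
     Y 0 = 0 \<and> (\<forall>j. mono_on {0..} (\<lambda>t. Y t $ j)) \<and>
     (\<forall>j. complementary (\<lambda>t. W t $ j) (\<lambda>t. Y t $ j))"

definition skorohod_stable :: "('j::finite, 'j) rmat \<Rightarrow> 'j rvec \<Rightarrow> bool" where
  "skorohod_stable R \<theta> \<longleftrightarrow>
     (\<forall>Y W. skorohod_solution R \<theta> Y W \<longrightarrow> (\<exists>T\<ge>0. \<forall>t\<ge>T. W t = 0))"

definition robustly_queue_ratio_stable ::
  "('k::{finite,linorder}) rvec \<Rightarrow> ('k, 'k) rmat \<Rightarrow> 'k rvec \<Rightarrow> ('k \<Rightarrow> 'j::finite) \<Rightarrow> bool" where
  "robustly_queue_ratio_stable \<alpha> P m s \<longleftrightarrow>
     (\<forall>\<Delta>. ratio_matrix m s \<Delta> \<longrightarrow>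
        state_space_collapse \<alpha> P m s \<Delta> \<and>
        invertible (total_workload_matrix P m s \<Delta>) \<and>
        skorohod_stable (reflection_matrix P m s \<Delta>) (drift_vector \<alpha> P m s \<Delta>))"

section \<open>The DHV network\<close>

text \<open>
  Enumerated index types are used because in the numeral type \<open>6\<close> the index 6 equals 0 and
  would be the least class rather than the greatest one.
\<close>

datatype dhv_class = Class1 | Class2 | Class3 | Class4 | Class5 | Class6

datatype dhv_station = Station1 | Station2 | Station3

primrec class_number :: "dhv_class \<Rightarrow> nat" where
  "class_number Class1 = 1"
| "class_number Class2 = 2"
| "class_number Class3 = 3"
| "class_number Class4 = 4"
| "class_number Class5 = 5"
| "class_number Class6 = 6"

lemma UNIV_dhv_class: "UNIV = {Class1, Class2, Class3, Class4, Class5, Class6}"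
  using dhv_class.exhaust by blast

lemma UNIV_dhv_station: "UNIV = {Station1, Station2, Station3}"
  using dhv_station.exhaust by blast

instance dhv_class :: finite
  by standard (simp add: UNIV_dhv_class)

instance dhv_station :: finite
  by standard (simp add: UNIV_dhv_station)

lemma inj_class_number: "class_number k = class_number l \<Longrightarrow> k = l"
  by (cases k; cases l) simp_all

instantiation dhv_class :: linorder
begin

definition less_eq_dhv_class :: "dhv_class \<Rightarrow> dhv_class \<Rightarrow> bool" where
  "k \<le> l \<longleftrightarrow> class_number k \<le> class_number l"

definition less_dhv_class :: "dhv_class \<Rightarrow> dhv_class \<Rightarrow> bool" where
  "k < l \<longleftrightarrow> class_number k < class_number l"

instance
  by standard (auto simp: less_eq_dhv_class_def less_dhv_class_def intro: inj_class_number)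

end

primrec dhv_server :: "dhv_class \<Rightarrow> dhv_station" where
  "dhv_server Class1 = Station1"
| "dhv_server Class2 = Station2"
| "dhv_server Class3 = Station3"
| "dhv_server Class4 = Station1"
| "dhv_server Class5 = Station2"
| "dhv_server Class6 = Station3"

definition dhv_arrivals :: "real \<Rightarrow> real^dhv_class" where
  "dhv_arrivals a = (\<chi> k. if k = Class1 then a else 0)"

definition dhv_routing :: "real^dhv_class^dhv_class" where
  "dhv_routing = (\<chi> k l. if class_number l = class_number k + 1 then 1 else 0)"

end

(* Deviations. At each station let the deviation be the scaled excess of the high class (4, 5 or 6)
   over its share of the workload. Write x, y, z for the three deviations. Off a null set a fluid
   solution satisfies linear flow balances at each station, a station in deviation serves only the
   class in excess, and a zero deviation stays zero to first order. The sign of x becomes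
   nonnegative. If m2 < m1 or m6 < m5, the signs then settle one after another and all deviations
   vanish, each at a rate bounded away from 0. Otherwise x >= 0, y <= 0 and z >= 0 eventually, and
   the deviations can only feed each other in the cycle y, x, z, y, with gains m4/m3 - 1,
   m6/m5 - 1 and m2/m1 - 1; their product is below 1 because m2 + m4 + m6 < 2, so a weighted sum
   of the deviations is a Lyapunov function.

   Collapsed workload. Every principal minor of C M Q Delta is positive, and in every face of the
   orthant the workload of station 1 decreases; once it is 0 the workload of station 2
   decreases, and then that of station 3. Skorohod solutions are only continuous, but they become
   Lipschitz in the time scale t + Y1 + Y2 + Y3. *)

theory Submission
  imports Defs
begin

text \<open>The policy condition constrains a solution only at times where \<open>T\<close> is
  differentiable. Everything therefore rests on two facts about the line: a monotone Lipschitz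
  function has a derivative off a null set, and a Lipschitz function whose derivative is nonpositive
  off a null set does not increase.

  The level of comparison for all flows is the rate 1. As the two service times of a station add up
  to 1, a fully used station without deviation that is fed at rate 1 in both classes also serves
  both at rate 1, and one-sided departures from this level are passed along the route. Only the
  external arrivals disturb the picture: at rate \<alpha> < 1 they leave station 1 the capacity 1 -
  m1 * \<alpha>, a little more than m4, for class 4. Three strict inequalities express that this
  surplus does not upset stations 2 and 3. They hold at \<alpha> = 1 and hence slightly below it,
  which is the origin of the threshold.

  Condition (ii) amounts to m1 + m3 + m5 > 1; in this form it bounds the gains of the cycle.\<close>

section \<open>Almost everywhere differentiability\<close>

text \<open>By Vitali's theorem, countably many disjoint intervals of \<open>K\<close>, all inside
  \<open>G\<close>, cover almost all of \<open>S\<close>, and the comparison is summed over them.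
  \<open>U\<close> takes the open interiors, losing countably many endpoints, so that it can replace
  \<open>G\<close> when the lemma is applied a second time.\<close>

lemma vitali_measure_comparison:
  fixes \<mu> \<nu> :: "real measure"
  assumes [simp]: "sets \<mu> = sets borel" "sets \<nu> = sets borel"
    and G: "open G" "S \<subseteq> G"
    and small: "\<And>x e. x \<in> S \<Longrightarrow> 0 < e \<Longrightarrow>
      \<exists>u v. u < v \<and> v - u < e \<and> x \<in> {u..v} \<and> emeasure \<mu> {u..v} \<le> emeasure \<nu> {u..v}"
  obtains U where "open U" "U \<subseteq> G" "negligible (S - U)" "emeasure \<mu> U \<le> emeasure \<nu> G"
proof -
  define K where "K = {(u, v). u < v \<and> {u..v} \<subseteq> G \<and> emeasure \<mu> {u..v} \<le> emeasure \<nu> {u..v}}"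
  define c r :: "real \<times> real \<Rightarrow> real" where "c = (\<lambda>(u, v). (u + v) / 2)" and "r = (\<lambda>(u, v). (v - u) / 2)"
  have ball: "cball (c i) (r i) = {fst i..snd i}" if "i \<in> K" for i
    using that by (auto simp: K_def c_def r_def cball_eq_atLeastAtMost field_simps split: prod.splits)
  obtain C where C: "countable C" "C \<subseteq> K"
     and disj: "pairwise (\<lambda>i j. disjnt (cball (c i) (r i)) (cball (c j) (r j))) C"
     and neg: "negligible (S - (\<Union>i\<in>C. cball (c i) (r i)))"
  proof (rule Vitali_covering_theorem_cballs[of K r S c])
    show "0 < r i" if "i \<in> K" for i
      using that by (auto simp: K_def r_def)
    show "\<exists>i. i \<in> K \<and> x \<in> cball (c i) (r i) \<and> r i < d" if x: "x \<in> S" and d: "0 < d" for x d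
    proof -
      obtain e where e: "0 < e" "ball x e \<subseteq> G"
        using G x by (meson openE subsetD)
      obtain u v where uv: "u < v" "v - u < min d e" "x \<in> {u..v}" "emeasure \<mu> {u..v} \<le> emeasure \<nu> {u..v}"
        using small[OF x, of "min d e"] d e by auto
      have "{u..v} \<subseteq> ball x e"
        using uv by (auto simp: dist_real_def)
      then have "(u, v) \<in> K"
        using uv e by (auto simp: K_def)
      moreover have "r (u, v) < d"
        using uv by (auto simp: r_def)
      ultimately show ?thesis
        using ball uv by (intro exI[of _ "(u, v)"]) auto
    qed
  qed blast
  define U where "U = (\<Union>i\<in>C. {fst i<..<snd i})"
  define M where "M = (\<Union>i\<in>C. {fst i..snd i})"
  have "disjoint_family_on (\<lambda>i. {fst i..snd i}) C"
    using disj ball C unfolding disjoint_family_on_def pairwise_def disjnt_def by (metis subsetD)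
  then have sums: "emeasure \<mu> M = (\<integral>\<^sup>+i. emeasure \<mu> {fst i..snd i} \<partial>count_space C)"
      "emeasure \<nu> M = (\<integral>\<^sup>+i. emeasure \<nu> {fst i..snd i} \<partial>count_space C)"
    unfolding M_def using C by (auto intro!: emeasure_UN_countable)
  have "emeasure \<mu> U \<le> emeasure \<mu> M"
    unfolding U_def M_def using C by (intro emeasure_mono) (fastforce intro!: sets.countable_UN')+
  also have "\<dots> \<le> emeasure \<nu> M"
    unfolding sums using C by (intro nn_integral_mono) (auto simp: K_def)
  also have "\<dots> \<le> emeasure \<nu> G"
    using C G by (intro emeasure_mono) (force simp: M_def K_def)+
  finally have le: "emeasure \<mu> U \<le> emeasure \<nu> G" .
  have "S - U \<subseteq> (S - M) \<union> (\<Union>i\<in>C. {fst i, snd i})"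
    unfolding U_def M_def by (fastforce simp: less_le)
  moreover have "M = (\<Union>i\<in>C. cball (c i) (r i))"
    unfolding M_def using ball C by (intro SUP_cong) auto
  moreover have "negligible (\<Union>i\<in>C. {fst i, snd i})"
    using C by (simp add: negligible_iff_null_sets countable_imp_null_set_lborel null_sets_completionI)
  ultimately have "negligible (S - U)"
    using neg by (metis negligible_Un negligible_subset)
  moreover have "open U" "U \<subseteq> G"
    using C unfolding U_def K_def by (fastforce intro!: open_UN)+
  ultimately show thesis
    using le that by blast
qed

text \<open>The intervals need only contain \<open>x\<close>, which is the form the covering
  argument consumes; those with an endpoint at \<open>x\<close> are the difference
  quotients.\<close>

definition slope_below :: "(real \<Rightarrow> real) \<Rightarrow> real \<Rightarrow> real set" where
  "slope_below f p = {x. \<forall>e>0. \<exists>u v. u < v \<and> v - u < e \<and> x \<in> {u..v} \<and> f v - f u < p * (v - u)}"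

definition slope_above :: "(real \<Rightarrow> real) \<Rightarrow> real \<Rightarrow> real set" where
  "slope_above f q = {x. \<forall>e>0. \<exists>u v. u < v \<and> v - u < e \<and> x \<in> {u..v} \<and> f v - f u > q * (v - u)}"

lemma slope_belowD:
  "x \<in> slope_below f p \<Longrightarrow> 0 < e \<Longrightarrow> \<exists>u v. u < v \<and> v - u < e \<and> x \<in> {u..v} \<and> f v - f u < p * (v - u)"
  by (simp add: slope_below_def)

lemma slope_aboveD:
  "x \<in> slope_above f q \<Longrightarrow> 0 < e \<Longrightarrow> \<exists>u v. u < v \<and> v - u < e \<and> x \<in> {u..v} \<and> f v - f u > q * (v - u)"
  by (simp add: slope_above_def)

lemma not_slope_belowD:
  "x \<notin> slope_below f p \<Longrightarrow>
    \<exists>e>0. \<forall>u v. u < v \<longrightarrow> v - u < e \<longrightarrow> x \<in> {u..v} \<longrightarrow> p * (v - u) \<le> f v - f u"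
  unfolding slope_below_def mem_Collect_eq by (meson not_less)

lemma not_slope_aboveD:
  "x \<notin> slope_above f q \<Longrightarrow>
    \<exists>e>0. \<forall>u v. u < v \<longrightarrow> v - u < e \<longrightarrow> x \<in> {u..v} \<longrightarrow> f v - f u \<le> q * (v - u)"
  unfolding slope_above_def mem_Collect_eq by (meson not_less)

text \<open>A first covering gives \<mu> U \<le> p |G|, a second one inside \<open>U\<close> gives q
  |V| \<le> \<mu> U. So almost all of \<open>S\<close> sits in an open set smaller than
  \<open>G\<close> by the factor p / q < 1, and iteration shrinks the measure to 0.\<close>

lemma negligible_slopes:
  fixes f :: "real \<Rightarrow> real"
  assumes mono: "mono f" and cont: "continuous_on UNIV f" and pq: "0 < p" "p < q"
  shows "negligible (slope_below f p \<inter> slope_above f q)"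
proof -
  define \<mu> where "\<mu> = interval_measure f"
  have \<mu>: "emeasure \<mu> {u..v} = ennreal (f v - f u)" if "u < v" for u v
    unfolding \<mu>_def using that mono cont by (intro emeasure_interval_measure_Icc) (auto dest: monoD)
  have [simp]: "sets \<mu> = sets borel"
    by (simp add: \<mu>_def)
  have scaled: "emeasure (scale_measure (ennreal s) lborel) {u..v} = ennreal (s * (v - u))"
    if "u < v" "0 < s" for s u v :: real
    using that by (simp add: ennreal_mult)
  \<comment> \<open>\<open>r\<close> lies strictly between p / q and 1; the excess r - p / q pays
    for the open cover \<open>H\<close> of the null set that \<open>V\<close> misses.\<close>
  define r where "r = (p / q + 1) / 2"
  have r: "p / q < r" "r < 1" "0 < r"
    using pq by (auto simp: r_def field_simps)
  have shrink: "\<exists>H. open H \<and> S \<subseteq> H \<and> H \<in> lmeasurable \<and> measure lebesgue H \<le> r * measure lebesgue G"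
    if G: "open G" "S \<subseteq> G" "G \<in> lmeasurable" and S: "S \<subseteq> slope_below f p \<inter> slope_above f q" for S G
  proof -
    have "\<exists>u v. u < v \<and> v - u < e \<and> x \<in> {u..v} \<and>
        emeasure \<mu> {u..v} \<le> emeasure (scale_measure (ennreal p) lborel) {u..v}"
      if "x \<in> S" "0 < e" for x e
    proof -
      from S that have "x \<in> slope_below f p"
        by blast
      from slope_belowD[OF this \<open>0 < e\<close>]
      obtain u v where uv: "u < v" "v - u < e" "x \<in> {u..v}" "f v - f u < p * (v - u)"
        by blast
      have "emeasure \<mu> {u..v} \<le> emeasure (scale_measure (ennreal p) lborel) {u..v}"
        unfolding \<mu>[OF uv(1)] scaled[OF uv(1) pq(1)] using uv(4) by (intro ennreal_leI) simp
      with uv show ?thesis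
        by blast
    qed
    from vitali_measure_comparison[where S = S, OF _ _ G(1,2) this] obtain U where
      U: "open U" "U \<subseteq> G" "negligible (S - U)" "emeasure \<mu> U \<le> emeasure (scale_measure (ennreal p) lborel) G"
      by auto
    have "\<exists>u v. u < v \<and> v - u < e \<and> x \<in> {u..v} \<and>
        emeasure (scale_measure (ennreal q) lborel) {u..v} \<le> emeasure \<mu> {u..v}"
      if "x \<in> S \<inter> U" "0 < e" for x e
    proof -
      from S that have "x \<in> slope_above f q"
        by blast
      from slope_aboveD[OF this \<open>0 < e\<close>]
      obtain u v where uv: "u < v" "v - u < e" "x \<in> {u..v}" "f v - f u > q * (v - u)"
        by blast
      have "emeasure (scale_measure (ennreal q) lborel) {u..v} \<le> emeasure \<mu> {u..v}"
        unfolding \<mu>[OF uv(1)] scaled[OF uv(1) order.strict_trans[OF pq]] using uv(4) by (intro ennreal_leI) simp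
      with uv show ?thesis
        by blast
    qed
    from vitali_measure_comparison[where S = "S \<inter> U", OF _ _ U(1) _ this] obtain V where
      V: "open V" "V \<subseteq> U" "negligible (S \<inter> U - V)" "emeasure (scale_measure (ennreal q) lborel) V \<le> emeasure \<mu> U"
      by auto
    have VG: "V \<subseteq> G"
      using U V by blast
    have Vm: "V \<in> lmeasurable"
      using V(1) by (intro fmeasurableI2[OF G(3) VG]) (simp add: borel_open sets_completionI_sets)
    have Gb: "emeasure lborel G = ennreal (measure lebesgue G)" and Vb: "emeasure lborel V = ennreal (measure lebesgue V)"
      using emeasure_eq_measure2[OF G(3)] emeasure_eq_measure2[OF Vm] G(1) V(1)
      by (simp_all add: borel_open)
    have "ennreal q * emeasure lborel V \<le> ennreal p * emeasure lborel G"
      using V(4) U(4) by simp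
    then have le: "q * measure lebesgue V \<le> p * measure lebesgue G"
      using pq by (simp add: Gb Vb flip: ennreal_mult)
    have neg: "negligible (S - V)"
      using negligible_Un[OF U(3) V(3)] by (rule negligible_subset) blast
    show ?thesis
    proof (cases "measure lebesgue G = 0")
      case True
      then have "G = {}"
        using G by (metis negligible_iff_measure open_not_negligible)
      then show ?thesis
        using G by (intro exI[of _ "{}"]) auto
    next
      case False
      define e where "e = (r - p / q) * measure lebesgue G"
      have e: "e > 0"
        using False r by (simp add: e_def zero_less_measure_iff measure_nonneg less_le)
      obtain H where H: "open H" "S - V \<subseteq> H" "H - (S - V) \<in> lmeasurable" "emeasure lebesgue (H - (S - V)) < ennreal e"
        using sets_lebesgue_outer_open[of "S - V" e] neg e by (metis negligible_imp_sets)
      have Hm: "H \<in> lmeasurable"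
        using H neg by (metis Diff_partition Un_commute fmeasurable.Un negligible_imp_measurable)
      have "measure lebesgue H \<le> measure lebesgue ((S - V) \<union> (H - (S - V)))"
        using H by (simp add: Un_absorb1)
      also have "\<dots> \<le> measure lebesgue (S - V) + measure lebesgue (H - (S - V))"
        using neg H by (intro measure_Un_le) (auto intro: negligible_imp_sets)
      also have "measure lebesgue (S - V) = 0"
        using neg by (rule negligible_imp_measure0)
      also have "measure lebesgue (H - (S - V)) < e"
        using H(3,4) e by (simp add: emeasure_eq_measure2 ennreal_less_iff)
      finally have Hle: "measure lebesgue H \<le> e"
        by simp
      have "measure lebesgue (V \<union> H) \<le> measure lebesgue V + measure lebesgue H"
        using Vm Hm by (intro measure_Un_le) auto
      also have "measure lebesgue V \<le> p / q * measure lebesgue G"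
        using le pq by (simp add: field_simps)
      also note Hle
      also have "p / q * measure lebesgue G + e = r * measure lebesgue G"
        by (simp add: e_def algebra_simps)
      finally show ?thesis
        using V H Hm Vm by (intro exI[of _ "V \<union> H"]) auto
    qed
  qed
  \<comment> \<open>The ball supplies a first open neighbourhood of finite measure for the
    iteration.\<close>
  have "negligible (slope_below f p \<inter> slope_above f q \<inter> ball 0 (real n))" for n
    unfolding negligible_outer_le
  proof (intro allI impI)
    fix e :: real assume "e > 0"
    let ?S = "slope_below f p \<inter> slope_above f q \<inter> ball 0 (real n)"
    let ?B = "measure lebesgue (ball 0 (real n) :: real set)"
    have ex: "\<exists>H. open H \<and> ?S \<subseteq> H \<and> H \<in> lmeasurable \<and> measure lebesgue H \<le> r ^ k * ?B" for k
    proof (induction k)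
      case 0
      then show ?case
        by (intro exI[of _ "ball 0 (real n)"]) auto
    next
      case (Suc k)
      then obtain H where H: "open H" "?S \<subseteq> H" "H \<in> lmeasurable" "measure lebesgue H \<le> r ^ k * ?B"
        by blast
      obtain H' where "open H'" "?S \<subseteq> H'" "H' \<in> lmeasurable" "measure lebesgue H' \<le> r * measure lebesgue H"
        using shrink[OF H(1-3)] by blast
      moreover have "r * measure lebesgue H \<le> r * (r ^ k * ?B)"
        using H r by (intro mult_left_mono) auto
      ultimately show ?case
        by (metis mult.assoc order_trans power_Suc)
    qed
    have "(\<lambda>k. r ^ k * ?B) \<longlonglongrightarrow> 0 * ?B"
      using r by (intro tendsto_intros LIMSEQ_power_zero) auto
    then have "\<forall>\<^sub>F k in sequentially. r ^ k * ?B < e"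
      using \<open>e > 0\<close> by (intro order_tendstoD) auto
    then obtain k where "r ^ k * ?B < e"
      using eventually_happens'[OF sequentially_bot] by blast
    then show "\<exists>T. ?S \<subseteq> T \<and> T \<in> lmeasurable \<and> measure lebesgue T \<le> e"
      using ex[of k] by (meson less_le_not_le order_trans)
  qed
  then have "negligible (\<Union>n. slope_below f p \<inter> slope_above f q \<inter> ball 0 (real n))"
    by (intro negligible_countable_Union) auto
  moreover have "slope_below f p \<inter> slope_above f q = (\<Union>n. slope_below f p \<inter> slope_above f q \<inter> ball 0 (real n))"
    using reals_Archimedean2 by auto
  ultimately show ?thesis
    by simp
qed


text \<open>
  Off the negligible sets where two rational slopes disagree, the supremum of the rational
  slopes occurring at arbitrarily small scale is the derivative.
\<close>

lemma lipschitz_mono_differentiable_ae: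
  fixes f :: "real \<Rightarrow> real"
  assumes mono: "mono f" and lip: "L-lipschitz_on UNIV f"
  shows "negligible {x. \<not> f differentiable (at x)}"
proof -
  have cont: "continuous_on UNIV f"
    using lip by (rule lipschitz_on_continuous_on)
  define N where "N = (\<Union>(p, q) \<in> {(p, q) \<in> \<rat> \<times> \<rat>. 0 < p \<and> p < q}. slope_below f p \<inter> slope_above f q)"
  have "countable {(p, q) \<in> \<rat> \<times> \<rat>. 0 < p \<and> (p::real) < q}"
    by (rule countable_subset[of _ "\<rat> \<times> \<rat>"]) (auto simp: countable_rat)
  then have "negligible N"
    unfolding N_def using negligible_slopes[OF mono cont] by (intro negligible_countable_Union) auto
  moreover have "f differentiable (at x)" if x: "x \<notin> N" for x
  proof -
    define Q where "Q = {q \<in> \<rat>. 0 < q \<and> x \<in> slope_above f q}"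
    have Ltop: "f v - f u \<le> L * (v - u)" if "u < v" for u v
      using lipschitz_onD[OF lip, of v u] that by (simp add: dist_real_def)
    have QL: "q \<le> L" if q: "q \<in> Q" for q
    proof -
      obtain u v where uv: "u < v" "f v - f u > q * (v - u)"
        using q slope_aboveD[of x f q 1] by (auto simp: Q_def)
      then have "q * (v - u) < L * (v - u)"
        using Ltop[of u v] by linarith
      with uv show ?thesis
        by (simp add: mult_less_cancel_right)
    qed
    \<comment> \<open>Inserting 0 makes \<open>D\<close> nonnegative and covers an empty
      \<open>Q\<close>, for which the derivative is 0.\<close>
    define D where "D = Sup (insert 0 Q)"
    have bdd: "bdd_above (insert 0 Q)"
      using QL by (intro bdd_aboveI[of _ "max 0 L"]) (fastforce simp: le_max_iff_disj)
    have D0: "0 \<le> D"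
      unfolding D_def using bdd by (intro cSup_upper) auto
    have "(f has_real_derivative D) (at x)"
      unfolding DERIV_def LIM_eq
    proof (intro allI impI)
      fix e :: real assume "e > 0"
      obtain q where q: "q \<in> \<rat>" "D < q" "q < D + e"
        using Rats_dense_in_real[of D "D + e"] \<open>e > 0\<close> by auto
      have "x \<notin> slope_above f q"
      proof
        assume "x \<in> slope_above f q"
        then have "q \<in> Q"
          using q D0 by (auto simp: Q_def)
        then have "q \<le> D"
          unfolding D_def using bdd by (intro cSup_upper) auto
        with q show False
          by simp
      qed
      then obtain e1 where e1: "e1 > 0"
        "\<And>u v. u < v \<Longrightarrow> v - u < e1 \<Longrightarrow> x \<in> {u..v} \<Longrightarrow> f v - f u \<le> q * (v - u)"
        using not_slope_aboveD by blast
      \<comment> \<open>The bound D - e / 2 leaves room for the strict inequality in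
        \<open>near\<close>. If it is positive, a rational \<open>p\<close> between it and some
        \<open>q'\<close> in \<open>Q\<close> cannot occur as a slope from below, since
        \<open>x\<close> would lie in \<open>N\<close>; otherwise monotonicity suffices.\<close>
      obtain e2 where e2: "e2 > 0"
        "\<And>u v. u < v \<Longrightarrow> v - u < e2 \<Longrightarrow> x \<in> {u..v} \<Longrightarrow> (D - e / 2) * (v - u) \<le> f v - f u"
      proof (cases "D - e / 2 > 0")
        case True
        then have "D - e / 2 < Sup (insert 0 Q)" "0 < Sup (insert 0 Q)"
          using \<open>e > 0\<close> by (simp_all add: D_def)
        then obtain q' where q': "q' \<in> Q" "D - e / 2 < q'"
          using less_cSup_iff[of "insert 0 Q" "D - e / 2"] bdd True by auto
        obtain p where p: "p \<in> \<rat>" "D - e / 2 < p" "p < q'"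
          using Rats_dense_in_real[OF q'(2)] by auto
        have "x \<notin> slope_below f p"
          using x q' p True unfolding N_def Q_def by fastforce
        then obtain e2 where e2: "e2 > 0"
          "\<And>u v. u < v \<Longrightarrow> v - u < e2 \<Longrightarrow> x \<in> {u..v} \<Longrightarrow> f v - f u \<ge> p * (v - u)"
          using not_slope_belowD by blast
        show ?thesis
        proof (rule that[OF e2(1)])
          fix u v :: real assume uv: "u < v" "v - u < e2" "x \<in> {u..v}"
          have "(D - e / 2) * (v - u) \<le> p * (v - u)"
            using uv p by (intro mult_right_mono) auto
          then show "(D - e / 2) * (v - u) \<le> f v - f u"
            using e2(2)[OF uv] by simp
        qed
      next
        case False
        show ?thesis
        proof (rule that[of 1])
          fix u v :: real assume uv: "u < v"
          have "(D - e / 2) * (v - u) \<le> 0"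
            using False uv by (intro mult_nonpos_nonneg) auto
          then show "(D - e / 2) * (v - u) \<le> f v - f u"
            using monoD[OF mono, of u v] uv by simp
        qed simp
      qed
      have near: "\<bar>(f v - f u) / (v - u) - D\<bar> < e"
        if uv: "u < v" "v - u < min e1 e2" "x \<in> {u..v}" for u v
      proof -
        have "q * (v - u) < (D + e) * (v - u)"
          using q uv by (intro mult_strict_right_mono) auto
        moreover have "f v - f u \<le> q * (v - u)"
          using e1(2)[of u v] uv by simp
        ultimately have "f v - f u < (D + e) * (v - u)"
          by simp
        moreover have "(D - e) * (v - u) < (D - e / 2) * (v - u)"
          using uv \<open>e > 0\<close> by (intro mult_strict_right_mono) auto
        then have "(D - e) * (v - u) < f v - f u"
          using e2(2)[of u v] uv by linarith
        ultimately show ?thesis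
          using uv by (simp add: abs_less_iff field_simps)
      qed
      show "\<exists>s>0. \<forall>h. h \<noteq> 0 \<and> norm (h - 0) < s \<longrightarrow> norm ((f (x + h) - f x) / h - D) < e"
      proof (intro exI[of _ "min e1 e2"] conjI allI impI)
        fix h :: real assume h: "h \<noteq> 0 \<and> norm (h - 0) < min e1 e2"
        show "norm ((f (x + h) - f x) / h - D) < e"
        proof (cases "h > 0")
          case True
          then show ?thesis
            using near[of x "x + h"] h by simp
        next
          case False
          moreover have "(f (x + h) - f x) / h = (f x - f (x + h)) / (x - (x + h))"
            by (simp add: diff_divide_distrib)
          ultimately show ?thesis
            using near[of "x + h" x] h by simp
        qed
      qed (use e1 e2 in auto)
    qed
    then show ?thesis
      by (auto simp: real_differentiable_def)
  qed
  ultimately show ?thesis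
    by (metis (mono_tags, lifting) mem_Collect_eq negligible_subset subsetI)
qed

lemma mono_lipschitz_half_line_differentiable_ae:
  fixes f :: "real \<Rightarrow> real"
  assumes mono: "mono_on {0..} f" and lip: "L-lipschitz_on {0..} f"
  shows "negligible {x. 0 < x \<and> \<not> f differentiable (at x)}"
proof -
  define g where "g = (\<lambda>x. f (max 0 x))"
  have "mono g"
    unfolding g_def by (intro monoI mono_onD[OF mono]) auto
  moreover have "L-lipschitz_on UNIV g"
  proof (rule lipschitz_onI)
    show "dist (g x) (g y) \<le> L * dist x y" for x y
    proof -
      have "dist (g x) (g y) \<le> L * dist (max 0 x) (max 0 y)"
        unfolding g_def by (intro lipschitz_onD[OF lip]) auto
      also have "\<dots> \<le> L * dist x y"
        using lipschitz_on_nonneg[OF lip] by (intro mult_left_mono) (auto simp: dist_real_def)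
      finally show ?thesis .
    qed
  qed (rule lipschitz_on_nonneg[OF lip])
  ultimately have "negligible {x. \<not> g differentiable (at x)}"
    by (rule lipschitz_mono_differentiable_ae)
  moreover have "f differentiable (at x)" if x: "0 < x" and g: "g differentiable (at x)" for x
  proof -
    obtain D where "(g has_real_derivative D) (at x)"
      using g by (auto simp: real_differentiable_def)
    then have "(f has_real_derivative D) (at x)"
      by (rule has_field_derivative_transform_within_open[of _ _ _ "{0<..}"]) (use x in \<open>auto simp: g_def\<close>)
    then show ?thesis
      by (auto simp: real_differentiable_def)
  qed
  ultimately show ?thesis
    by (elim negligible_subset) auto
qed

section \<open>Extinction of Lipschitz functions\<close>

text \<open>A zero with nonzero derivative is isolated from the other zeros. Zeros with isolation
  radius at least 1 / (n + 1) are separated by the integer parts of their multiples by n +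
  1.\<close>

lemma countable_simple_zeros:
  fixes g :: "real \<Rightarrow> real"
  shows "countable {x. g x = 0 \<and> (\<exists>D. D \<noteq> 0 \<and> (g has_real_derivative D) (at x))}"
proof -
  define A where "A n = {x. g x = 0 \<and> (\<forall>y. y \<noteq> x \<longrightarrow> \<bar>y - x\<bar> * real (Suc n) < 1 \<longrightarrow> g y \<noteq> 0)}" for n
  have "countable (A n)" for n
  proof (rule countableI')
    show "inj_on (\<lambda>x. \<lfloor>x * real (Suc n)\<rfloor>) (A n)"
    proof (rule inj_onI, rule ccontr)
      fix x y assume xy: "x \<in> A n" "y \<in> A n" "\<lfloor>x * real (Suc n)\<rfloor> = \<lfloor>y * real (Suc n)\<rfloor>" "x \<noteq> y"
      have "\<bar>y * real (Suc n) - x * real (Suc n)\<bar> < 1"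
        using xy(3) by linarith
      moreover have "\<bar>y * real (Suc n) - x * real (Suc n)\<bar> = \<bar>y - x\<bar> * real (Suc n)"
        by (metis abs_mult abs_of_nat left_diff_distrib)
      ultimately show False
        using xy by (auto simp: A_def)
    qed
  qed
  moreover have "{x. g x = 0 \<and> (\<exists>D. D \<noteq> 0 \<and> (g has_real_derivative D) (at x))} \<subseteq> (\<Union>n. A n)"
  proof clarify
    fix x D assume x: "g x = 0" "D \<noteq> 0" "(g has_real_derivative D) (at x)"
    have "\<forall>\<^sub>F y in at x. (g y - g x) / (y - x) \<noteq> 0"
      using x(2,3) by (intro tendsto_imp_eventually_ne) (auto simp: has_field_derivative_iff)
    then obtain d where d: "d > 0" "\<And>y. y \<noteq> x \<Longrightarrow> dist y x < d \<Longrightarrow> g y \<noteq> 0"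
      using x(1) by (auto simp: eventually_at)
    obtain n where "inverse (real (Suc n)) < d"
      using reals_Archimedean[OF d(1)] by blast
    then have n: "1 < d * real (Suc n)"
      by (simp add: field_simps)
    have "g y \<noteq> 0" if "y \<noteq> x" "\<bar>y - x\<bar> * real (Suc n) < 1" for y
    proof -
      have "\<bar>y - x\<bar> * real (Suc n) < d * real (Suc n)"
        using that n by linarith
      then have "\<bar>y - x\<bar> < d"
        by (rule mult_right_less_imp_less) simp
      then show ?thesis
        using d(2) that by (simp add: dist_real_def)
    qed
    then have "x \<in> A n"
      using x(1) by (simp add: A_def)
    then show "x \<in> (\<Union>n. A n)"
      by blast
  qed
  ultimately show ?thesis
    by (meson countable_UN countable_subset countableI_type)
qed

text \<open>The last point at which \<open>h\<close> does not exceed the line of slope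
  \<open>e\<close> through the left end must be \<open>b\<close>. Each \<open>x\<close> has to offer
  only one later point with small slope, so points without a derivative can be treated as
  well.\<close>

lemma right_slope_nonpos_imp_le:
  fixes h :: "real \<Rightarrow> real"
  assumes "a \<le> b" and cont: "continuous_on {a..b} h"
    and slope: "\<And>x e. a \<le> x \<Longrightarrow> x < b \<Longrightarrow> 0 < e \<Longrightarrow> \<exists>y. x < y \<and> y \<le> b \<and> h y - h x \<le> e * (y - x)"
  shows "h b \<le> h a"
proof (rule field_le_epsilon)
  fix e0 :: real assume "e0 > 0"
  define e where "e = e0 / (b - a + 1)"
  have e: "e > 0" "e * (b - a) \<le> e0"
    using \<open>e0 > 0\<close> \<open>a \<le> b\<close> by (auto simp: e_def field_simps)
  define S where "S = {x \<in> {a..b}. h x - e * (x - a) \<le> h a}"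
  have "closed S"
    unfolding S_def by (intro continuous_on_closed_Collect_le continuous_intros cont)
  then have S: "compact S"
    by (intro compact_eq_bounded_closed[THEN iffD2] conjI) (auto simp: S_def intro: bounded_subset[of "{a..b}"])
  have "a \<in> S"
    using \<open>a \<le> b\<close> by (auto simp: S_def)
  then obtain s where s: "s \<in> S" "\<And>x. x \<in> S \<Longrightarrow> x \<le> s"
    using compact_attains_sup[OF S] by blast
  have "s = b"
  proof (rule ccontr)
    assume "s \<noteq> b"
    then obtain y where y: "s < y" "y \<le> b" "h y - h s \<le> e * (y - s)"
      using slope[of s e] s e by (auto simp: S_def)
    then have "y \<in> S"
      using s(1) by (auto simp: S_def algebra_simps)
    then show False
      using s(2) y by force
  qed
  then show "h b \<le> h a + e0"
    using s(1) e by (auto simp: S_def)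
qed

text \<open>
  The exceptional null set is absorbed by subtracting a multiple of the measure of a small
  open neighbourhood of it, which grows at unit rate at each of its points.
\<close>

lemma lipschitz_deriv_nonpos_ae_imp_le:
  fixes g :: "real \<Rightarrow> real"
  assumes "a \<le> b" and lip: "L-lipschitz_on {a..b} g" and N: "negligible N"
    and deriv: "\<And>x. a < x \<Longrightarrow> x < b \<Longrightarrow> x \<notin> N \<Longrightarrow> \<exists>D\<le>0. (g has_real_derivative D) (at x)"
  shows "g b \<le> g a"
proof (rule field_le_epsilon)
  fix e :: real assume "e > 0"
  have L: "0 \<le> L"
    using lip by (rule lipschitz_on_nonneg)
  \<comment> \<open>Division by L + 1 covers L = 0.\<close>
  define e' where "e' = e / (L + 1)"
  have e': "e' > 0" "L * e' \<le> e"
    using L \<open>e > 0\<close> by (auto simp: e'_def field_simps)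
  \<comment> \<open>\<open>a\<close> joins the null set because the derivative hypothesis is silent
    there.\<close>
  have N': "negligible (insert a N)"
    using N by simp
  obtain U where U: "open U" "insert a N \<subseteq> U" "U - insert a N \<in> lmeasurable"
      "emeasure lebesgue (U - insert a N) < ennreal e'"
    using sets_lebesgue_outer_open[of "insert a N" e'] N' e' by (metis negligible_imp_sets)
  define \<psi> where "\<psi> = (\<lambda>x. measure lebesgue (U \<inter> {a..x}))"
  have Um: "U \<in> sets lebesgue"
    using U(1) by (simp add: borel_open sets_completionI_sets)
  have Ioc: "{x<..y} \<in> lmeasurable" for x y :: real
    by (rule bounded_set_imp_lmeasurable) (auto intro: bounded_subset[of "{x..y}"])
  have m: "U \<inter> {a..x} \<in> lmeasurable" "U \<inter> {x<..y} \<in> lmeasurable" for x y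
    using fmeasurable_Int_fmeasurable[of "{a..x}" lebesgue U] fmeasurable_Int_fmeasurable[of "{x<..y}" lebesgue U] Um
      Ioc
    by (auto simp: Int_commute)
  have \<psi>: "\<psi> y = \<psi> x + measure lebesgue (U \<inter> {x<..y})" if "a \<le> x" "x \<le> y" for x y
  proof -
    have "U \<inter> {a..y} = (U \<inter> {a..x}) \<union> (U \<inter> {x<..y})" "U \<inter> {x<..y} - U \<inter> {a..x} = U \<inter> {x<..y}"
      using that by auto
    then show ?thesis
      using measure_Un2[OF m(1)[of x] m(2)[of x y]] by (simp add: \<psi>_def)
  qed
  have incr: "measure lebesgue (U \<inter> {x<..y}) \<le> y - x" if "x \<le> y" for x y
    using measure_mono_fmeasurable[of "U \<inter> {x<..y}" "{x<..y}" lebesgue] m(2)[of x y] Ioc that by auto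
  have lip\<psi>: "1-lipschitz_on {a..b} \<psi>"
  proof (rule lipschitz_on_leI)
    show "dist (\<psi> x) (\<psi> y) \<le> 1 * dist x y" if "x \<in> {a..b}" "y \<in> {a..b}" "x \<le> y" for x y
      using \<psi>[of x y] incr[of x y] that by (simp add: dist_real_def)
  qed simp
  define h where "h = (\<lambda>x. g x - L * \<psi> x)"
  have "h b \<le> h a"
  proof (rule right_slope_nonpos_imp_le[OF \<open>a \<le> b\<close>])
    show "continuous_on {a..b} h"
      unfolding h_def using lip lip\<psi> by (intro continuous_intros lipschitz_on_continuous_on)
    fix x d :: real assume x: "a \<le> x" "x < b" and d: "0 < d"
    have h_le: "h y - h x \<le> g y - g x" if "x < y" for y
      using \<psi>[of x y] x that L by (simp add: h_def algebra_simps)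
    show "\<exists>y. x < y \<and> y \<le> b \<and> h y - h x \<le> d * (y - x)"
    proof (cases "x \<in> insert a N")
      case True
      then obtain r where r: "r > 0" "ball x r \<subseteq> U"
        using U by (meson openE subsetD)
      define y where "y = min b (x + r / 2)"
      have y: "x < y" "y \<le> b" "y < x + r"
        using r x by (auto simp: y_def)
      then have "U \<inter> {x<..y} = {x<..y}"
        using r by (auto simp: dist_real_def subset_iff)
      then have "L * \<psi> y = L * \<psi> x + L * (y - x)"
        using \<psi>[of x y] x y by (simp add: distrib_left)
      moreover have "g y - g x \<le> L * (y - x)"
        using lipschitz_onD[OF lip, of y x] x y by (simp add: dist_real_def)
      moreover have "0 \<le> d * (y - x)"
        using d y by simp
      ultimately have "h y - h x \<le> d * (y - x)"
        by (simp add: h_def)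
      with y show ?thesis
        by blast
    next
      case False
      then obtain D where D: "D \<le> 0" "(g has_real_derivative D) (at x)"
        using deriv[of x] x by auto
      then have "\<forall>\<^sub>F y in at_right x. (g y - g x) / (y - x) < d"
        using d by (intro order_tendstoD(2)[of _ D])
          (auto simp: has_field_derivative_iff intro: filterlim_mono at_le)
      moreover have "\<forall>\<^sub>F y in at_right x. x < y \<and> y \<le> b"
        using eventually_at_right_less[of x] eventually_at_right_real[OF x(2)]
        by eventually_elim auto
      ultimately have "\<forall>\<^sub>F y in at_right x. x < y \<and> y \<le> b \<and> g y - g x \<le> d * (y - x)"
        by eventually_elim (simp add: field_simps)
      then obtain y where "x < y \<and> y \<le> b \<and> g y - g x \<le> d * (y - x)"
        using eventually_happens'[OF trivial_limit_at_right_real] by blast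
      then show ?thesis
        using h_le[of y] by (intro exI[of _ y]) auto
    qed
  qed
  moreover have "\<psi> b \<le> e'"
  proof -
    have neg: "measure lebesgue (insert a N) = 0"
      using N' by (rule negligible_imp_measure0)
    have "\<psi> b \<le> measure lebesgue (insert a N \<union> (U - insert a N))"
      unfolding \<psi>_def using m(1) fmeasurable.Un[OF negligible_imp_measurable[OF N'] U(3)]
      by (intro measure_mono_fmeasurable) (auto simp only: fmeasurableD)
    also have "\<dots> \<le> measure lebesgue (insert a N) + measure lebesgue (U - insert a N)"
      using U(3) negligible_imp_measurable[OF N'] by (intro measure_Un_le) auto
    also have "\<dots> < e'"
      using U(3,4) e' by (simp add: neg emeasure_eq_measure2 ennreal_less_iff)
    finally show ?thesis
      by simp
  qed
  moreover have "0 \<le> L * \<psi> a"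
    using L by (simp add: \<psi>_def)
  moreover have "L * \<psi> b \<le> L * e'"
    using L calculation(2) by (intro mult_left_mono)
  ultimately show "g b \<le> g a + e"
    using e' by (simp add: h_def)
qed

text \<open>After its last zero before \<open>t\<close> the function would be positive, hence
  nonincreasing, hence at most its value 0 at that zero.\<close>

lemma nonneg_absorbed_at_zero:
  fixes g :: "real \<Rightarrow> real"
  assumes lip: "L-lipschitz_on {a..} g" and nonneg: "\<And>t. a \<le> t \<Longrightarrow> 0 \<le> g t" and N: "negligible N"
    and deriv: "\<And>t. a < t \<Longrightarrow> t \<notin> N \<Longrightarrow> 0 < g t \<Longrightarrow> \<exists>D\<le>0. (g has_real_derivative D) (at t)"
    and s: "a \<le> s" "s \<le> t" "g s = 0"
  shows "g t = 0"
proof (rule ccontr)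
  assume "g t \<noteq> 0"
  have cont: "continuous_on {s..t} g"
    using lipschitz_on_subset[OF lip, of "{s..t}"] s lipschitz_on_continuous_on by auto
  define Z where "Z = {x \<in> {s..t}. g x = 0}"
  have "closed Z"
    unfolding Z_def by (intro continuous_closed_preimage_constant cont) auto
  then have Z: "compact Z"
    by (intro compact_eq_bounded_closed[THEN iffD2] conjI) (auto simp: Z_def intro: bounded_subset[of "{s..t}"])
  have "s \<in> Z"
    using s by (auto simp: Z_def)
  then obtain c where c: "c \<in> Z" "\<And>x. x \<in> Z \<Longrightarrow> x \<le> c"
    using compact_attains_sup[OF Z] by blast
  have "g t \<le> g c"
  proof (rule lipschitz_deriv_nonpos_ae_imp_le[where g = g, OF _ _ N])
    show "L-lipschitz_on {c..t} g"
      using lip by (rule lipschitz_on_subset) (use c(1) s in \<open>auto simp: Z_def\<close>)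
    fix x assume x: "c < x" "x < t" "x \<notin> N"
    then have "g x \<noteq> 0"
      using c(1) c(2)[of x] by (auto simp: Z_def)
    then show "\<exists>D\<le>0. (g has_real_derivative D) (at x)"
      using deriv[of x] nonneg[of x] x c(1) s by (auto simp: Z_def less_le)
  qed (use c in \<open>auto simp: Z_def\<close>)
  then show False
    using \<open>g t \<noteq> 0\<close> c nonneg[of t] s by (auto simp: Z_def)
qed

text \<open>
  The clock \<open>h\<close> is \<open>t\<close> itself for fluid solutions and the physical time, as a function of the
  intrinsic one, for Skorohod solutions.
\<close>

lemma nonneg_extinct:
  fixes g h :: "real \<Rightarrow> real"
  assumes lip: "L-lipschitz_on {a..} g" and lip_h: "M-lipschitz_on {a..} h"
    and nonneg: "\<And>t. a \<le> t \<Longrightarrow> 0 \<le> g t" and N: "negligible N" and \<kappa>: "0 < \<kappa>"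
    and deriv: "\<And>t. a < t \<Longrightarrow> t \<notin> N \<Longrightarrow> 0 < g t \<Longrightarrow>
      \<exists>D E. (g has_real_derivative D) (at t) \<and> (h has_real_derivative E) (at t) \<and> 0 \<le> E \<and> D \<le> - \<kappa> * E"
    and unbounded: "\<And>K. \<exists>t\<ge>a. K < h t"
  obtains t0 where "a \<le> t0" "\<And>t. t0 \<le> t \<Longrightarrow> g t = 0"
proof -
  \<comment> \<open>While \<open>g\<close> is positive, g + \<kappa> * h cannot increase. By
    \<open>t1\<close> the clock has gained more than g a / \<kappa>, which would exhaust
    \<open>g\<close>.\<close>
  obtain t1 where t1: "a \<le> t1" "h a + g a / \<kappa> < h t1"
    using unbounded by blast
  have "\<exists>t0\<ge>a. g t0 = 0"
  proof (rule ccontr)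
    assume "\<not> ?thesis"
    then have pos: "0 < g t" if "a \<le> t" for t
      using nonneg[of t] that by (force simp: less_le)
    have "g t1 + \<kappa> * h t1 \<le> g a + \<kappa> * h a"
    proof (rule lipschitz_deriv_nonpos_ae_imp_le[where g = "\<lambda>t. g t + \<kappa> * h t", OF t1(1) _ N])
      have "L-lipschitz_on {a..t1} g" "M-lipschitz_on {a..t1} h"
        using lip lip_h by (auto elim: lipschitz_on_subset)
      then show "(L + \<bar>\<kappa>\<bar> * M)-lipschitz_on {a..t1} (\<lambda>t. g t + \<kappa> * h t)"
        using lipschitz_on_cmult_real[of M "{a..t1}" h \<kappa>] by (intro lipschitz_on_add) auto
      fix t assume t: "a < t" "t < t1" "t \<notin> N"
      then obtain D E where DE: "(g has_real_derivative D) (at t)" "(h has_real_derivative E) (at t)" "D \<le> - \<kappa> * E"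
        using deriv[of t] pos[of t] by auto
      have "((\<lambda>t. g t + \<kappa> * h t) has_real_derivative D + \<kappa> * E) (at t)"
        by (intro DERIV_add DERIV_cmult DE)
      with DE(3) show "\<exists>D\<le>0. ((\<lambda>t. g t + \<kappa> * h t) has_real_derivative D) (at t)"
        by (intro exI[of _ "D + \<kappa> * E"]) auto
    qed
    moreover have "\<kappa> * h a + g a < \<kappa> * h t1"
      using t1(2) \<kappa> by (simp add: field_simps)
    ultimately show False
      using nonneg[OF t1(1)] by simp
  qed
  then obtain t0 where t0: "a \<le> t0" "g t0 = 0"
    by blast
  have "g t = 0" if "t0 \<le> t" for t
  proof (rule nonneg_absorbed_at_zero[OF lip nonneg N _ t0(1) that t0(2)])
    fix t assume "a < t" "t \<notin> N" "0 < g t"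
    then obtain D E where "(g has_real_derivative D) (at t)" "0 \<le> E" "D \<le> - \<kappa> * E"
      using deriv by blast
    moreover have "0 \<le> \<kappa> * E"
      using \<kappa> \<open>0 \<le> E\<close> by simp
    ultimately show "\<exists>D\<le>0. (g has_real_derivative D) (at t)"
      by (intro exI[of _ D]) auto
  qed
  with t0 that show thesis
    by blast
qed


section \<open>Eventual signs of Lipschitz functions\<close>

lemma lipschitz_on_pos_part:
  fixes u :: "real \<Rightarrow> real"
  assumes "L-lipschitz_on S u"
  shows "L-lipschitz_on S (\<lambda>t. max 0 (u t))"
proof (rule lipschitz_onI)
  show "dist (max 0 (u x)) (max 0 (u y)) \<le> L * dist x y" if "x \<in> S" "y \<in> S" for x y
    using lipschitz_onD[OF assms that] by (auto simp: dist_real_def)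
qed (rule lipschitz_on_nonneg[OF assms])

lemma has_real_derivative_pos_part:
  assumes D: "(u has_real_derivative D) (at t)" and "0 < u t"
  shows "((\<lambda>t. max 0 (u t)) has_real_derivative D) (at t)"
proof -
  have "\<forall>\<^sub>F s in nhds t. 0 < u s"
    using DERIV_isCont[OF D] \<open>0 < u t\<close> by (intro order_tendstoD) (simp_all add: isCont_def tendsto_at_iff_tendsto_nhds)
  then have "\<forall>\<^sub>F s in nhds t. u s = max 0 (u s)"
    by eventually_elim simp
  then show ?thesis
    using D by (simp add: DERIV_cong_ev)
qed

lemma eventually_nonpos_if_decreasing:
  fixes u :: "real \<Rightarrow> real"
  assumes lip: "L-lipschitz_on {0..} u" and N: "negligible N" and \<kappa>: "0 < \<kappa>"
    and deriv: "\<forall>\<^sub>F t in at_top. t \<notin> N \<longrightarrow> 0 < u t \<longrightarrow> (\<exists>D\<le>- \<kappa>. (u has_real_derivative D) (at t))"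
  shows "\<forall>\<^sub>F t in at_top. u t \<le> 0"
proof -
  obtain a' where a': "\<And>t. a' \<le> t \<Longrightarrow> t \<notin> N \<Longrightarrow> 0 < u t \<Longrightarrow> \<exists>D\<le>- \<kappa>. (u has_real_derivative D) (at t)"
    using deriv unfolding eventually_at_top_linorder by blast
  define a where "a = max 0 a'"
  obtain t0 where "\<And>t. t0 \<le> t \<Longrightarrow> max 0 (u t) = 0"
  proof (rule nonneg_extinct[where g = "\<lambda>t. max 0 (u t)" and h = "\<lambda>t. t" and N = N and \<kappa> = \<kappa> and a = a and L = L and M = 1])
    show "L-lipschitz_on {a..} (\<lambda>t. max 0 (u t))"
      using lipschitz_on_pos_part[OF lipschitz_on_subset[OF lip]] by (simp add: a_def)
    show "\<exists>D E. ((\<lambda>t. max 0 (u t)) has_real_derivative D) (at t) \<and> ((\<lambda>t. t) has_real_derivative E) (at t) \<and>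
        0 \<le> E \<and> D \<le> - \<kappa> * E" if t: "a < t" "t \<notin> N" "0 < max 0 (u t)" for t
    proof -
      have pos: "0 < u t"
        using t(3) by (simp add: less_max_iff_disj)
      then obtain D where D: "D \<le> - \<kappa>" "(u has_real_derivative D) (at t)"
        using a'[of t] t by (auto simp: a_def)
      have "((\<lambda>t. max 0 (u t)) has_real_derivative D) (at t)"
        using D(2) pos by (rule has_real_derivative_pos_part)
      then show ?thesis
        using D(1) by (intro exI[of _ D] exI[of _ 1]) (auto intro!: derivative_eq_intros)
    qed
    show "\<exists>t\<ge>a. K < t" for K
      by (intro exI[of _ "max a (K + 1)"]) auto
    show "1-lipschitz_on {a..} (\<lambda>t. t)"
      by (intro lipschitz_onI) auto
  qed (use N \<kappa> in auto)
  then show ?thesis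
    unfolding eventually_at_top_linorder by (metis max.cobounded2)
qed

text \<open>Without a uniform rate the positive part may persist, but it cannot return once it has
  vanished.\<close>

lemma eventually_sign_if_nonincreasing:
  fixes u :: "real \<Rightarrow> real"
  assumes lip: "L-lipschitz_on {0..} u" and N: "negligible N"
    and deriv: "\<forall>\<^sub>F t in at_top. t \<notin> N \<longrightarrow> 0 < u t \<longrightarrow> (\<exists>D\<le>0. (u has_real_derivative D) (at t))"
  shows "(\<forall>\<^sub>F t in at_top. u t \<le> 0) \<or> (\<forall>\<^sub>F t in at_top. 0 < u t)"
proof -
  obtain a' where a': "\<And>t. a' \<le> t \<Longrightarrow> t \<notin> N \<Longrightarrow> 0 < u t \<Longrightarrow> \<exists>D\<le>0. (u has_real_derivative D) (at t)"
    using deriv unfolding eventually_at_top_linorder by blast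
  define a where "a = max 0 a'"
  have "max 0 (u t) = 0" if s: "a \<le> s" "s \<le> t" "u s \<le> 0" for s t
  proof (rule nonneg_absorbed_at_zero[where g = "\<lambda>t. max 0 (u t)" and N = N and a = a and L = L and s = s])
    show "L-lipschitz_on {a..} (\<lambda>t. max 0 (u t))"
      using lipschitz_on_pos_part[OF lipschitz_on_subset[OF lip]] by (simp add: a_def)
    show "\<exists>D\<le>0. ((\<lambda>t. max 0 (u t)) has_real_derivative D) (at t)" if t: "a < t" "t \<notin> N" "0 < max 0 (u t)" for t
    proof -
      have pos: "0 < u t"
        using t(3) by (simp add: less_max_iff_disj)
      then obtain D where D: "D \<le> 0" "(u has_real_derivative D) (at t)"
        using a'[of t] t by (auto simp: a_def)
      have "((\<lambda>t. max 0 (u t)) has_real_derivative D) (at t)"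
        using D(2) pos by (rule has_real_derivative_pos_part)
      then show ?thesis
        using D(1) by blast
    qed
  qed (use N s in auto)
  then show ?thesis
    unfolding eventually_at_top_linorder by (metis max.cobounded2 not_less)
qed

section \<open>Rates in the balanced network\<close>

text \<open>
  Rates at a station with a low class (mean service time \<open>\<mu>\<close>) and a high class (mean service
  time \<open>\<nu>\<close>): \<open>p\<close>, \<open>q\<close> are the arrival rates and \<open>r\<close>, \<open>s\<close> the departure rates of the low and the
  high class, \<open>a\<close> is the share of the workload that the policy assigns to the high class, and \<open>x\<close> is
  the work of the high class in excess of that share, with derivative \<open>x'\<close>.  The last alternative covers an empty station.
\<close>

definition station_rates ::
  "real \<Rightarrow> real \<Rightarrow> real \<Rightarrow> real \<Rightarrow> real \<Rightarrow> real \<Rightarrow> real \<Rightarrow> real \<Rightarrow> real \<Rightarrow> bool" where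
  "station_rates \<mu> \<nu> a p q r s x x' \<longleftrightarrow>
     0 \<le> r \<and> 0 \<le> s \<and> \<mu> * r + \<nu> * s \<le> 1 \<and> x' = (1 - a) * (\<nu> * q - \<nu> * s) - a * (\<mu> * p - \<mu> * r) \<and>
     (0 < x \<longrightarrow> a < 1 \<and> r = 0 \<and> \<nu> * s = 1) \<and>
     (x < 0 \<longrightarrow> 0 < a \<and> \<mu> * r = 1 \<and> s = 0) \<and>
     (x = 0 \<longrightarrow> x' = 0 \<and> (\<mu> * r + \<nu> * s = 1 \<or> r = p \<and> s = q))"

lemma station_ratesD:
  assumes "station_rates \<mu> \<nu> a p q r s x x'"
  shows "0 \<le> r" "0 \<le> s" "\<mu> * r + \<nu> * s \<le> 1"
    "x' = (1 - a) * (\<nu> * q - \<nu> * s) - a * (\<mu> * p - \<mu> * r)"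
    "0 < x \<Longrightarrow> a < 1" "0 < x \<Longrightarrow> r = 0" "0 < x \<Longrightarrow> \<nu> * s = 1"
    "x < 0 \<Longrightarrow> 0 < a" "x < 0 \<Longrightarrow> \<mu> * r = 1" "x < 0 \<Longrightarrow> s = 0" "x = 0 \<Longrightarrow> x' = 0"
  using assms unfolding station_rates_def by auto

text \<open>At a fully used station, x' = 0 and the utilization are two linear equations for the
  rates. Their solution mixes, with weights \<open>a\<close> and 1 - a, the work entering one class
  and the capacity left by the other.\<close>

lemma station_rates_zeroE:
  assumes "station_rates \<mu> \<nu> a p q r s 0 x'"
  obtains "r = p" "s = q"
  | "\<mu> * r = a * (\<mu> * p) + (1 - a) * (1 - \<nu> * q)" "\<nu> * s = a * (1 - \<mu> * p) + (1 - a) * (\<nu> * q)"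
proof (cases "r = p \<and> s = q")
  case False
  then have full: "\<nu> * s = 1 - \<mu> * r" and bal: "0 = (1 - a) * (\<nu> * q - \<nu> * s) - a * (\<mu> * p - \<mu> * r)"
    using assms unfolding station_rates_def by auto
  have "\<mu> * r = a * (\<mu> * p) + (1 - a) * (1 - \<nu> * q)"
    using bal unfolding full by (simp add: algebra_simps)
  moreover from this have "\<nu> * s = a * (1 - \<mu> * p) + (1 - a) * (\<nu> * q)"
    unfolding full by (simp add: algebra_simps)
  ultimately show ?thesis
    using that by blast
qed (use that in blast)

lemma convex_le: "0 \<le> a \<Longrightarrow> a \<le> 1 \<Longrightarrow> u \<le> w \<Longrightarrow> v \<le> w \<Longrightarrow> a * u + (1 - a) * v \<le> (w::real)"
  using convex_bound_le[of u w v a "1 - a"] by simp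

lemma convex_ge: "0 \<le> a \<Longrightarrow> a \<le> 1 \<Longrightarrow> w \<le> u \<Longrightarrow> w \<le> v \<Longrightarrow> (w::real) \<le> a * u + (1 - a) * v"
  using convex_le[of a "- u" "- w" "- v"] by simp

lemma le_if_mult_le: "0 < c \<Longrightarrow> c * u \<le> c * w \<Longrightarrow> u \<le> (w::real)"
  by simp

context
  fixes \<mu> \<nu> a :: real
  assumes pos: "0 < \<mu>" "0 < \<nu>" and sum1: "\<mu> + \<nu> = 1" and a: "0 \<le> a" "a \<le> 1"
begin

text \<open>The rate 1 is the balanced level since \<mu> + \<nu> = 1: the mixtures of
  \<open>station_rates_zeroE\<close> preserve comparison with it, and a class served alone departs
  at rate above 1. Bounds on arrivals thus become bounds on departures and can be followed along the
  route.\<close>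

lemma station_rates_nonneg_dev:
  assumes st: "station_rates \<mu> \<nu> a p q r s x x'" and "0 \<le> x" "p \<le> 1" "1 \<le> q"
  shows "r \<le> 1" "1 \<le> s"
proof -
  have "r \<le> 1 \<and> 1 \<le> s"
  proof (cases "x = 0")
    case True
    from st[unfolded True] show ?thesis
    proof (cases rule: station_rates_zeroE)
      case 2
      have "\<mu> * p \<le> \<mu> * 1" "\<nu> * 1 \<le> \<nu> * q"
        using assms pos by (auto intro: mult_left_mono)
      then have le: "\<mu> * p \<le> \<mu>" "1 - \<nu> * q \<le> \<mu>" "\<nu> \<le> 1 - \<mu> * p" "\<nu> \<le> \<nu> * q"
        using sum1 by simp_all
      have "\<mu> * r \<le> \<mu> * 1" "\<nu> * 1 \<le> \<nu> * s"
        unfolding 2 using convex_le[OF a le(1,2)] convex_ge[OF a le(3,4)] by simp_all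
      then show ?thesis
        using pos by simp
    qed (use assms in auto)
  next
    case False
    then have rs: "r = 0" "\<nu> * s = 1"
      using station_ratesD[OF st] assms by auto
    then have "\<nu> * 1 \<le> \<nu> * s"
      using pos sum1 by simp
    then have "1 \<le> s"
      using pos by (simp only: mult_le_cancel_left_pos)
    with rs show ?thesis
      by simp
  qed
  then show "r \<le> 1" "1 \<le> s"
    by auto
qed

lemma station_rates_nonpos_dev:
  assumes st: "station_rates \<mu> \<nu> a p q r s x x'" and "x \<le> 0" "1 \<le> p" "q \<le> 1"
  shows "1 \<le> r" "s \<le> 1"
proof -
  have "1 \<le> r \<and> s \<le> 1"
  proof (cases "x = 0")
    case True
    from st[unfolded True] show ?thesis
    proof (cases rule: station_rates_zeroE)
      case 2
      have "\<mu> * 1 \<le> \<mu> * p" "\<nu> * q \<le> \<nu> * 1"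
        using assms pos by (auto intro: mult_left_mono)
      then have le: "\<mu> \<le> \<mu> * p" "\<mu> \<le> 1 - \<nu> * q" "1 - \<mu> * p \<le> \<nu>" "\<nu> * q \<le> \<nu>"
        using sum1 by simp_all
      have "\<mu> * 1 \<le> \<mu> * r" "\<nu> * s \<le> \<nu> * 1"
        unfolding 2 using convex_ge[OF a le(1,2)] convex_le[OF a le(3,4)] by simp_all
      then show ?thesis
        using pos by simp
    qed (use assms in auto)
  next
    case False
    then have rs: "s = 0" "\<mu> * r = 1"
      using station_ratesD[OF st] assms by auto
    then have "\<mu> * 1 \<le> \<mu> * r"
      using pos sum1 by simp
    then have "1 \<le> r"
      using pos by (simp only: mult_le_cancel_left_pos)
    with rs show ?thesis
      by simp
  qed
  then show "1 \<le> r" "s \<le> 1"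
    by auto
qed

lemma station_rates_bounds:
  assumes st: "station_rates \<mu> \<nu> a p q r s x x'"
  shows "\<mu> * r \<le> 1" "\<nu> * s \<le> 1"
  using station_ratesD(1-3)[OF st] mult_nonneg_nonneg[of \<mu> r] mult_nonneg_nonneg[of \<nu> s] pos by linarith+

end

section \<open>Drift of a nonzero deviation\<close>

lemma station_rates_pos_dev_slope:
  assumes st: "station_rates \<mu> \<nu> a p q r s x x'" and "0 < x"
  shows "x' = (1 - a) * (\<nu> * q - 1) - a * (\<mu> * p)"
  using station_ratesD[OF st] \<open>0 < x\<close> by simp

lemma station_rates_neg_dev_slope:
  assumes st: "station_rates \<mu> \<nu> a p q r s x x'" and "x < 0"
  shows "x' = (1 - a) * (\<nu> * q) + a * (1 - \<mu> * p)"
  using station_ratesD[OF st] \<open>x < 0\<close> by (simp add: algebra_simps)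

lemma station_rates_pos_dev_slope_le:
  assumes st: "station_rates \<mu> \<nu> a p q r s x x'" and "0 < x" "0 \<le> a" "0 \<le> \<mu>" "0 \<le> p"
    and q: "\<nu> * q \<le> 1 + B"
  shows "x' \<le> (1 - a) * B"
proof -
  have "a < 1" "0 \<le> a * (\<mu> * p)"
    using station_ratesD[OF st] assms by auto
  moreover from this have "(1 - a) * (\<nu> * q - 1) \<le> (1 - a) * B"
    using q by (intro mult_left_mono) auto
  ultimately show ?thesis
    using station_rates_pos_dev_slope[OF st \<open>0 < x\<close>] by linarith
qed

lemma station_rates_neg_dev_slope_ge:
  assumes st: "station_rates \<mu> \<nu> a p q r s x x'" and "x < 0" "a \<le> 1" "0 \<le> \<nu>" "0 \<le> q"
    and p: "\<mu> * p \<le> 1 - B"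
  shows "a * B \<le> x'"
proof -
  have "0 < a" "0 \<le> (1 - a) * (\<nu> * q)"
    using station_ratesD[OF st] assms by auto
  moreover from this have "a * B \<le> a * (1 - \<mu> * p)"
    using p by (intro mult_left_mono) auto
  ultimately show ?thesis
    using station_rates_neg_dev_slope[OF st \<open>x < 0\<close>] by linarith
qed

text \<open>\<open>a\<close>, \<open>b\<close>, \<open>c\<close> stand for the shares of the
  workload that the policy gives to classes 4, 5 and 6. At \<alpha> = 1 the conditions
  \<open>near_critical\<close> reduce, up to positive factors, to m5 < 1, m6 < 1 and m6 < 1.\<close>

locale dhv_balanced =
  fixes m1 m2 m3 m4 m5 m6 a b c \<alpha> :: real
  assumes pos: "0 < m1" "0 < m2" "0 < m3" "0 < m4" "0 < m5" "0 < m6"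
    and unit: "m1 + m4 = 1" "m2 + m5 = 1" "m3 + m6 = 1"
    and abc: "0 \<le> a" "a \<le> 1" "0 \<le> b" "b \<le> 1" "0 \<le> c" "c \<le> 1"
    and \<alpha>: "0 < \<alpha>" "\<alpha> < 1"
    and near_critical: "m5 * (1 - m1 * \<alpha>) < m4" "m6 * (1 - m1 * \<alpha>) < m4" "m6 * (1 - m2 * \<alpha>) < m5"
begin

text \<open>\<open>d1\<close> to \<open>d6\<close> are departure rates; along the route each of the
  first five is the arrival rate of the next class.\<close>

definition rates ::
  "real \<Rightarrow> real \<Rightarrow> real \<Rightarrow> real \<Rightarrow> real \<Rightarrow> real \<Rightarrow> real \<Rightarrow> real \<Rightarrow> real \<Rightarrow> real \<Rightarrow> real \<Rightarrow> real \<Rightarrow> bool" where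
  "rates d1 d2 d3 d4 d5 d6 x x' y y' z z' \<longleftrightarrow>
     station_rates m1 m4 a \<alpha> d3 d1 d4 x x' \<and>
     station_rates m2 m5 b d1 d4 d2 d5 y y' \<and>
     station_rates m3 m6 c d2 d5 d3 d6 z z'"

lemma lt1: "m1 < 1" "m2 < 1" "m3 < 1" "m4 < 1" "m5 < 1" "m6 < 1"
  using pos unit by linarith+

text \<open>The rate at which class 4 can be served in the capacity that class 1 leaves when it is
  served at rate \<alpha>. It tends to 1 with \<alpha>, and it bounds \<open>d4\<close> when x = 0
  and d3 \<le> 1.\<close>

definition \<beta> :: real where "\<beta> = (1 - m1 * \<alpha>) / m4"

lemma \<beta>: "1 \<le> \<beta>" "m5 * \<beta> < 1" "m6 * \<beta> < 1" "m4 * \<beta> = 1 - m1 * \<alpha>"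
proof -
  have "m1 * \<alpha> \<le> m1"
    using pos \<alpha> by (simp add: mult_left_le)
  then have "m4 \<le> 1 - m1 * \<alpha>"
    using unit by linarith
  then show "1 \<le> \<beta>"
    using pos by (simp add: \<beta>_def)
  show "m5 * \<beta> < 1" "m6 * \<beta> < 1" "m4 * \<beta> = 1 - m1 * \<alpha>"
    using near_critical pos by (simp_all add: \<beta>_def)
qed

context
  fixes d1 d2 d3 d4 d5 d6 x x' y y' z z' :: real
  assumes rates: "rates d1 d2 d3 d4 d5 d6 x x' y y' z z'"
begin

lemma stations:
  shows st1: "station_rates m1 m4 a \<alpha> d3 d1 d4 x x'"
    and st2: "station_rates m2 m5 b d1 d4 d2 d5 y y'"
    and st3: "station_rates m3 m6 c d2 d5 d3 d6 z z'"
  using rates unfolding rates_def by auto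

lemma d_nonneg: "0 \<le> d1" "0 \<le> d2" "0 \<le> d3" "0 \<le> d4" "0 \<le> d5" "0 \<le> d6"
  using stations by (auto dest: station_ratesD)

lemma d_le: "m1 * d1 \<le> 1" "m4 * d4 \<le> 1" "m2 * d2 \<le> 1" "m5 * d5 \<le> 1" "m3 * d3 \<le> 1" "m6 * d6 \<le> 1"
  using station_rates_bounds[OF _ _ _ _ _ st1] station_rates_bounds[OF _ _ _ _ _ st2]
    station_rates_bounds[OF _ _ _ _ _ st3] pos unit abc
  by auto

lemma ge1_if_full: "0 < m \<Longrightarrow> m < 1 \<Longrightarrow> m * d = 1 \<Longrightarrow> 1 \<le> (d::real)"
  by (rule le_if_mult_le[of m]) auto

text \<open>Class 1 is fed from outside only, with work at rate m1 * \<alpha>, so the bound holds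
  whatever the other stations do. This is why the sign of \<open>x\<close> can settle first.\<close>

lemma slope_x_neg: "x < 0 \<Longrightarrow> a * (1 - m1 * \<alpha>) \<le> x'"
  using station_rates_neg_dev_slope_ge[OF st1] abc pos d_nonneg by simp

text \<open>Serving class 3 alone makes \<open>d3\<close> at least 1; followed through stations 1
  and 2, this limits \<open>d2\<close>, the inflow of class 3 itself, to 1.\<close>

lemma slope_z_neg:
  assumes "0 \<le> x" "0 \<le> y" "z < 0"
  shows "c * (1 - m3) \<le> z'"
proof (rule station_rates_neg_dev_slope_ge[OF st3])
  have "1 \<le> d3"
    using ge1_if_full station_ratesD[OF st3] pos lt1 assms by blast
  then have "d1 \<le> 1" "1 \<le> d4"
    using station_rates_nonneg_dev[OF _ _ _ _ _ st1] pos unit abc \<alpha> assms by auto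
  then have "d2 \<le> 1"
    using station_rates_nonneg_dev[OF _ _ _ _ _ st2] pos unit abc assms by auto
  then show "m3 * d2 \<le> 1 - (1 - m3)"
    using pos by simp
qed (use assms abc pos d_nonneg in auto)

lemma slope_x_pos:
  assumes "0 < x" "0 \<le> y" "0 \<le> z"
  shows "x' \<le> - ((1 - a) * (1 - m4))"
proof -
  have "d1 = 0" "1 \<le> d4"
    using ge1_if_full station_ratesD[OF st1] pos lt1 assms by blast+
  then have "d2 \<le> 1" "1 \<le> d5"
    using station_rates_nonneg_dev[OF _ _ _ _ _ st2] pos unit abc assms by auto
  then have "d3 \<le> 1"
    using station_rates_nonneg_dev[OF _ _ _ _ _ st3] pos unit abc assms by auto
  then have "m4 * d3 \<le> 1 + - (1 - m4)"
    using pos by simp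
  then show ?thesis
    using station_rates_pos_dev_slope_le[OF st1, of "- (1 - m4)"] assms abc pos \<alpha> by (simp add: algebra_simps)
qed

text \<open>Station 1 receives at most 1 in both classes, so \<open>d4\<close> cannot be compared
  with the rate 1; \<beta> takes its place.\<close>

lemma slope_y_pos:
  assumes "x = 0" "0 < y" "0 \<le> z"
  shows "y' \<le> - ((1 - b) * (1 - m5 * \<beta>))"
proof -
  have "d2 = 0" "1 \<le> d5"
    using ge1_if_full station_ratesD[OF st2] pos lt1 assms by blast+
  then have d3: "d3 \<le> 1"
    using station_rates_nonneg_dev[OF _ _ _ _ _ st3] pos unit abc assms by auto
  have "d4 \<le> \<beta>"
    using st1[unfolded assms(1)]
  proof (cases rule: station_rates_zeroE)
    case 1
    then show ?thesis
      using d3 \<beta> by simp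
  next
    case 2
    have "m4 * d3 \<le> m4 * \<beta>"
      using d3 \<beta> pos by (intro mult_left_mono) auto
    then have "m4 * d4 \<le> m4 * \<beta>"
      unfolding 2 using \<beta> by (intro convex_le abc) auto
    then show ?thesis
      using pos by simp
  qed
  then have "m5 * d4 \<le> m5 * \<beta>"
    using pos by simp
  then have "m5 * d4 \<le> 1 + - (1 - m5 * \<beta>)"
    by simp
  from station_rates_pos_dev_slope_le[OF st2 _ _ _ _ this] show ?thesis
    using assms abc pos d_nonneg by (simp add: algebra_simps)
qed

text \<open>With class 3 unserved, station 1 emits d4 \<le> \<beta> and d1 \<ge> \<alpha>. At
  station 2, \<open>d5\<close> equals \<open>d4\<close> or mixes it with the rate that the capacity
  left by class 2 allows. These two sources are the arguments of the maximum, both below 1 by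
  \<open>near_critical\<close>.\<close>

lemma slope_z_pos:
  assumes "x = 0" "y = 0" "0 < z"
  shows "z' \<le> - ((1 - c) * (1 - max (m6 * \<beta>) (m6 * (1 - m2 * \<alpha>) / m5)))" (is "_ \<le> - ((1 - c) * (1 - ?M))")
proof -
  have d3: "d3 = 0"
    using station_ratesD[OF st3] assms by blast
  have le1: "m1 * \<alpha> \<le> 1"
    using pos lt1 \<alpha> by (intro mult_le_one) auto
  have "d4 \<le> \<beta> \<and> \<alpha> \<le> d1"
    using st1[unfolded assms(1)]
  proof (cases rule: station_rates_zeroE)
    case 1
    then show ?thesis
      using d3 \<beta> by simp
  next
    case 2
    have "m4 * d4 \<le> m4 * \<beta>"
      unfolding 2 d3 \<beta>(4) using le1 by (intro convex_le abc) auto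
    moreover have "m1 * \<alpha> \<le> m1 * d1"
      unfolding 2 d3 using le1 by (intro convex_ge abc) auto
    ultimately show ?thesis
      using pos by simp
  qed
  then have d4: "m6 * d4 \<le> m6 * \<beta>" and d1: "m2 * \<alpha> \<le> m2 * d1"
    using pos by auto
  have "m6 * d5 \<le> ?M"
    using st2[unfolded assms(2)]
  proof (cases rule: station_rates_zeroE)
    case 1
    then show ?thesis
      using d4 by simp
  next
    case 2
    have "m6 * d5 = m6 / m5 * (m5 * d5)"
      using pos by simp
    also have "\<dots> = b * (m6 * (1 - m2 * d1) / m5) + (1 - b) * (m6 * d4)"
      unfolding 2 using pos by (simp add: field_simps)
    also have "\<dots> \<le> ?M"
    proof (intro convex_le abc)
      have "m6 * (1 - m2 * d1) / m5 \<le> m6 * (1 - m2 * \<alpha>) / m5"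
        using d1 pos by (intro divide_right_mono mult_left_mono) auto
      then show "m6 * (1 - m2 * d1) / m5 \<le> ?M"
        by simp
      show "m6 * d4 \<le> ?M"
        using d4 by simp
    qed
    finally show ?thesis .
  qed
  then have "m6 * d5 \<le> 1 + - (1 - ?M)"
    by simp
  from station_rates_pos_dev_slope_le[OF st3 _ _ _ _ this] show ?thesis
    using assms abc pos d_nonneg by (simp only: mult_minus_right)
qed

text \<open>Class 2 served alone makes \<open>d3\<close> at least 1 through station 3, and station 1
  then holds \<open>d1\<close>, the inflow of class 2, to at most 1.\<close>

lemma slope_y_neg:
  assumes "0 \<le> x" "y < 0" "z \<le> 0"
  shows "b * (1 - m2) \<le> y'"
proof (rule station_rates_neg_dev_slope_ge[OF st2])
  have "1 \<le> d2" "d5 = 0"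
    using ge1_if_full station_ratesD[OF st2] pos lt1 assms by blast+
  then have "1 \<le> d3"
    using station_rates_nonpos_dev[OF _ _ _ _ _ st3] pos unit abc assms by auto
  then have "d1 \<le> 1"
    using station_rates_nonneg_dev[OF _ _ _ _ _ st1] pos unit abc \<alpha> assms by auto
  then show "m2 * d1 \<le> 1 - (1 - m2)"
    using pos by simp
qed (use assms abc pos d_nonneg in auto)

text \<open>No signs elsewhere enter: the capacity bound m3 * d3 \<le> 1 limits the work entering
  class 4 to m4 / m3. This ratio and the analogous ones below act as gains of the cycle or, when at
  most 1, exclude growth.\<close>

lemma slope_x_pos_any: "0 < x \<Longrightarrow> x' \<le> (1 - a) * (m4 / m3 - 1)"
proof (rule station_rates_pos_dev_slope_le[OF st1])
  have "m4 * d3 = m4 / m3 * (m3 * d3)"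
    using pos by simp
  also have "\<dots> \<le> m4 / m3 * 1"
    using d_le pos by (intro mult_left_mono) auto
  finally show "m4 * d3 \<le> 1 + (m4 / m3 - 1)"
    by simp
qed (use abc pos \<alpha> in auto)

lemma slope_y_neg_any: "y < 0 \<Longrightarrow> b * (1 - m2 / m1) \<le> y'"
proof (rule station_rates_neg_dev_slope_ge[OF st2])
  have "m2 * d1 = m2 / m1 * (m1 * d1)"
    using pos by simp
  also have "\<dots> \<le> m2 / m1 * 1"
    using d_le pos by (intro mult_left_mono) auto
  finally show "m2 * d1 \<le> 1 - (1 - m2 / m1)"
    by simp
qed (use abc pos d_nonneg in auto)

lemma slope_z_pos_any: "0 < z \<Longrightarrow> z' \<le> (1 - c) * (m6 / m5 - 1)"
proof (rule station_rates_pos_dev_slope_le[OF st3])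
  have "m6 * d5 = m6 / m5 * (m5 * d5)"
    using pos by simp
  also have "\<dots> \<le> m6 / m5 * 1"
    using d_le pos by (intro mult_left_mono) auto
  finally show "m6 * d5 \<le> 1 + (m6 / m5 - 1)"
    by simp
qed (use abc pos d_nonneg in auto)

lemma slope_z_neg_any: "z < 0 \<Longrightarrow> c * (1 - m3 / m2) \<le> z'"
proof (rule station_rates_neg_dev_slope_ge[OF st3])
  have "m3 * d2 = m3 / m2 * (m2 * d2)"
    using pos by simp
  also have "\<dots> \<le> m3 / m2 * 1"
    using d_le pos by (intro mult_left_mono) auto
  finally show "m3 * d2 \<le> 1 - (1 - m3 / m2)"
    by simp
qed (use abc pos d_nonneg in auto)

lemma slope_y_pos_x_pos:
  assumes "0 < x" "0 < y"
  shows "y' \<le> (1 - b) * (m5 / m4 - 1)"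
proof (rule station_rates_pos_dev_slope_le[OF st2])
  have "m4 * d4 = 1"
    using station_ratesD[OF st1] assms by blast
  then show "m5 * d4 \<le> 1 + (m5 / m4 - 1)"
    using pos by (simp add: field_simps)
qed (use abc pos d_nonneg assms in auto)

text \<open>Starvation: while class 6 has the server, class 3 emits nothing and class 4 receives
  nothing. The next two lemmas are the same effect of class 4 on class 2 and of class 2 on class
  6.\<close>

lemma slope_x_pos_z_pos:
  assumes "0 < x" "0 < z"
  shows "x' \<le> - (1 - a)"
  using station_rates_pos_dev_slope_le[OF st1, of "- 1"] station_ratesD[OF st3] assms abc pos \<alpha> by simp

lemma slope_y_neg_x_pos:
  assumes "0 < x" "y < 0"
  shows "b \<le> y'"
  using station_rates_neg_dev_slope_ge[OF st2, of 1] station_ratesD[OF st1] assms abc pos d_nonneg by simp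

lemma slope_z_pos_y_neg:
  assumes "y < 0" "0 < z"
  shows "z' \<le> - (1 - c)"
  using station_rates_pos_dev_slope_le[OF st3, of "- 1"] station_ratesD[OF st2] assms abc pos d_nonneg by simp

end

end

section \<open>Collapse of the deviations\<close>

text \<open>With l1 = 1 and a surplus \<open>e\<close> in each further weight, closing the cycle
  requires A * B * C + e * (B * C + C) < 1. The additional 1 in the denominator of \<open>e\<close>
  makes this strict and covers C = 0.\<close>

lemma cyclic_weights:
  fixes A B C :: real
  assumes "0 \<le> A" "0 \<le> B" "0 \<le> C" "A * B * C < 1"
  obtains l1 l2 l3 where "0 < l1" "0 < l2" "0 < l3" "l1 * A < l2" "l2 * B < l3" "l3 * C < l1"
proof -
  define e where "e = (1 - A * B * C) / (1 + B * C + C)"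
  have BC: "0 \<le> B * C"
    using assms by simp
  then have K: "0 < 1 + B * C + C"
    using assms by linarith
  then have e: "0 < e"
    using assms by (simp add: e_def)
  have "e * (B * C + C) < e * (1 + B * C + C)"
    using e by (intro mult_strict_left_mono) auto
  also have "\<dots> = 1 - A * B * C"
    using K by (simp add: e_def)
  finally have "((A + e) * B + e) * C < 1"
    by (simp add: algebra_simps)
  moreover have "0 < (A + e) * B + e"
    using assms e by (intro add_nonneg_pos) auto
  ultimately show thesis
    using assms e by (intro that[of 1 "A + e" "(A + e) * B + e"]) auto
qed

lemma (in dhv_balanced) alpha_service_lt_1: "m1 * \<alpha> < 1"
proof -
  have "m1 * \<alpha> \<le> m1"
    using pos \<alpha> by (simp add: mult_left_le)
  then show ?thesis
    using lt1 by linarith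
qed

locale dhv_trajectory = dhv_balanced +
  fixes x y z :: "real \<Rightarrow> real" and L :: real and N :: "real set"
  assumes lipschitz: "L-lipschitz_on {0..} x" "L-lipschitz_on {0..} y" "L-lipschitz_on {0..} z"
    and N: "negligible N"
    and rates_ae: "\<And>t. 0 < t \<Longrightarrow> t \<notin> N \<Longrightarrow> \<exists>d1 d2 d3 d4 d5 d6 x' y' z'.
      rates d1 d2 d3 d4 d5 d6 (x t) x' (y t) y' (z t) z' \<and>
      (x has_real_derivative x') (at t) \<and> (y has_real_derivative y') (at t) \<and> (z has_real_derivative z') (at t)"
begin

lemma lipschitz_combination: "(\<bar>p\<bar> * L + \<bar>q\<bar> * L + \<bar>r\<bar> * L)-lipschitz_on {0..} (\<lambda>t. p * x t + q * y t + r * z t)"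
  by (intro lipschitz_on_add lipschitz_on_cmult_real lipschitz)

lemma derivative_combination:
  assumes "0 < t" "t \<notin> N"
    and slope: "\<And>d1 d2 d3 d4 d5 d6 x' y' z'. rates d1 d2 d3 d4 d5 d6 (x t) x' (y t) y' (z t) z' \<Longrightarrow>
      p * x' + q * y' + r * z' \<le> B"
  shows "\<exists>D\<le>B. ((\<lambda>t. p * x t + q * y t + r * z t) has_real_derivative D) (at t)"
proof -
  obtain d1 d2 d3 d4 d5 d6 x' y' z' where R: "rates d1 d2 d3 d4 d5 d6 (x t) x' (y t) y' (z t) z'"
    and D: "(x has_real_derivative x') (at t)" "(y has_real_derivative y') (at t)" "(z has_real_derivative z') (at t)"
    using rates_ae[OF assms(1,2)] by blast
  have "((\<lambda>t. p * x t + q * y t + r * z t) has_real_derivative p * x' + q * y' + r * z') (at t)"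
    by (intro DERIV_add DERIV_cmult D)
  then show ?thesis
    using slope[OF R] by blast
qed

text \<open>Linear forms cover both the sign of a single deviation, with coefficients 0 and 1 or -
  1, and the weighted sum of the cyclic case. \<open>Q\<close> carries what is already known for
  large times.\<close>

lemma eventually_combination_nonpos:
  assumes "0 < \<kappa>" and Q: "\<forall>\<^sub>F t in at_top. Q t"
    and slope: "\<And>t d1 d2 d3 d4 d5 d6 x' y' z'. rates d1 d2 d3 d4 d5 d6 (x t) x' (y t) y' (z t) z' \<Longrightarrow>
      Q t \<Longrightarrow> 0 < p * x t + q * y t + r * z t \<Longrightarrow> p * x' + q * y' + r * z' \<le> - \<kappa>"
  shows "\<forall>\<^sub>F t in at_top. p * x t + q * y t + r * z t \<le> 0"
proof (rule eventually_nonpos_if_decreasing[OF lipschitz_combination N \<open>0 < \<kappa>\<close>])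
  show "\<forall>\<^sub>F t in at_top. t \<notin> N \<longrightarrow> 0 < p * x t + q * y t + r * z t \<longrightarrow>
      (\<exists>D\<le>- \<kappa>. ((\<lambda>t. p * x t + q * y t + r * z t) has_real_derivative D) (at t))"
    using Q eventually_gt_at_top[of 0] by eventually_elim (blast intro: derivative_combination slope)
qed

lemma eventually_combination_sign:
  assumes Q: "\<forall>\<^sub>F t in at_top. Q t"
    and slope: "\<And>t d1 d2 d3 d4 d5 d6 x' y' z'. rates d1 d2 d3 d4 d5 d6 (x t) x' (y t) y' (z t) z' \<Longrightarrow>
      Q t \<Longrightarrow> 0 < p * x t + q * y t + r * z t \<Longrightarrow> p * x' + q * y' + r * z' \<le> 0"
  shows "(\<forall>\<^sub>F t in at_top. p * x t + q * y t + r * z t \<le> 0) \<or> (\<forall>\<^sub>F t in at_top. 0 < p * x t + q * y t + r * z t)"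
proof (rule eventually_sign_if_nonincreasing[OF lipschitz_combination N])
  show "\<forall>\<^sub>F t in at_top. t \<notin> N \<longrightarrow> 0 < p * x t + q * y t + r * z t \<longrightarrow>
      (\<exists>D\<le>0. ((\<lambda>t. p * x t + q * y t + r * z t) has_real_derivative D) (at t))"
    using Q eventually_gt_at_top[of 0] by eventually_elim (blast intro: derivative_combination slope)
qed

text \<open>
  Positive and negative parts of a deviation decrease at rates proportional to a ratio parameter or
  its complement \<open>v\<close>; where \<open>v = 0\<close> that part of the deviation is absent, and any positive rate may
  be claimed.
\<close>

definition nz :: "real \<Rightarrow> real" where "nz v = (if 0 < v then v else 1)"

lemma nz: "0 < nz v" "0 < v \<Longrightarrow> nz v = v"
  by (auto simp: nz_def)

lemma parameter_bounds:
  assumes "rates d1 d2 d3 d4 d5 d6 u u' v v' w w'"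
  shows "0 < u \<Longrightarrow> a < 1" "u < 0 \<Longrightarrow> 0 < a" "0 < v \<Longrightarrow> b < 1" "v < 0 \<Longrightarrow> 0 < b" "0 < w \<Longrightarrow> c < 1" "w < 0 \<Longrightarrow> 0 < c"
    "u = 0 \<Longrightarrow> u' = 0" "v = 0 \<Longrightarrow> v' = 0" "w = 0 \<Longrightarrow> w' = 0"
  using stations[OF assms] by (auto dest: station_ratesD)

lemma eventually_x_nonneg: "\<forall>\<^sub>F t in at_top. 0 \<le> x t"
proof -
  have "\<forall>\<^sub>F t in at_top. (- 1) * x t + 0 * y t + 0 * z t \<le> 0"
  proof (rule eventually_combination_nonpos[where \<kappa> = "nz a * (1 - m1 * \<alpha>)" and Q = "\<lambda>_. True"])
    show "0 < nz a * (1 - m1 * \<alpha>)"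
      using nz alpha_service_lt_1 by simp
    show "(- 1) * x' + 0 * y' + 0 * z' \<le> - (nz a * (1 - m1 * \<alpha>))"
      if R: "rates d1 d2 d3 d4 d5 d6 (x t) x' (y t) y' (z t) z'" and neg: "0 < (- 1) * x t + 0 * y t + 0 * z t"
      for t d1 d2 d3 d4 d5 d6 x' y' z'
      using slope_x_neg[OF R] parameter_bounds[OF R] neg by (simp add: nz)
  qed simp
  then show ?thesis
    by simp
qed

lemma eventually_z_nonneg:
  assumes "\<forall>\<^sub>F t in at_top. 0 \<le> y t"
  shows "\<forall>\<^sub>F t in at_top. 0 \<le> z t"
proof -
  have "\<forall>\<^sub>F t in at_top. 0 * x t + 0 * y t + (- 1) * z t \<le> 0"
  proof (rule eventually_combination_nonpos[where \<kappa> = "nz c * (1 - m3)" and Q = "\<lambda>t. 0 \<le> x t \<and> 0 \<le> y t"])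
    show "0 < nz c * (1 - m3)"
      using nz lt1 by simp
    show "\<forall>\<^sub>F t in at_top. 0 \<le> x t \<and> 0 \<le> y t"
      using eventually_x_nonneg assms by eventually_elim simp
    show "0 * x' + 0 * y' + (- 1) * z' \<le> - (nz c * (1 - m3))"
      if R: "rates d1 d2 d3 d4 d5 d6 (x t) x' (y t) y' (z t) z'" and Q: "0 \<le> x t \<and> 0 \<le> y t"
        and neg: "0 < 0 * x t + 0 * y t + (- 1) * z t"
      for t d1 d2 d3 d4 d5 d6 x' y' z'
      using slope_z_neg[OF R] parameter_bounds[OF R] Q neg by (simp add: nz)
  qed
  then show ?thesis
    by simp
qed

lemma eventually_x_zero:
  assumes "\<forall>\<^sub>F t in at_top. 0 \<le> y t" "\<forall>\<^sub>F t in at_top. 0 \<le> z t"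
  shows "\<forall>\<^sub>F t in at_top. x t = 0"
proof -
  have "\<forall>\<^sub>F t in at_top. 1 * x t + 0 * y t + 0 * z t \<le> 0"
  proof (rule eventually_combination_nonpos[where \<kappa> = "nz (1 - a) * (1 - m4)" and Q = "\<lambda>t. 0 \<le> y t \<and> 0 \<le> z t"])
    show "0 < nz (1 - a) * (1 - m4)"
      using nz lt1 by simp
    show "\<forall>\<^sub>F t in at_top. 0 \<le> y t \<and> 0 \<le> z t"
      using assms by eventually_elim simp
    show "1 * x' + 0 * y' + 0 * z' \<le> - (nz (1 - a) * (1 - m4))"
      if R: "rates d1 d2 d3 d4 d5 d6 (x t) x' (y t) y' (z t) z'" and Q: "0 \<le> y t \<and> 0 \<le> z t"
        and pos: "0 < 1 * x t + 0 * y t + 0 * z t"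
      for t d1 d2 d3 d4 d5 d6 x' y' z'
      using slope_x_pos[OF R] parameter_bounds[OF R] Q pos by (simp add: nz)
  qed
  with eventually_x_nonneg show ?thesis
    by eventually_elim simp
qed

lemma eventually_y_nonpos:
  assumes "\<forall>\<^sub>F t in at_top. x t = 0" "\<forall>\<^sub>F t in at_top. 0 \<le> z t"
  shows "\<forall>\<^sub>F t in at_top. y t \<le> 0"
proof -
  have "\<forall>\<^sub>F t in at_top. 0 * x t + 1 * y t + 0 * z t \<le> 0"
  proof (rule eventually_combination_nonpos[where \<kappa> = "nz (1 - b) * (1 - m5 * \<beta>)" and Q = "\<lambda>t. x t = 0 \<and> 0 \<le> z t"])
    show "0 < nz (1 - b) * (1 - m5 * \<beta>)"
      using nz \<beta> by simp
    show "\<forall>\<^sub>F t in at_top. x t = 0 \<and> 0 \<le> z t"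
      using assms by eventually_elim simp
    show "0 * x' + 1 * y' + 0 * z' \<le> - (nz (1 - b) * (1 - m5 * \<beta>))"
      if R: "rates d1 d2 d3 d4 d5 d6 (x t) x' (y t) y' (z t) z'" and Q: "x t = 0 \<and> 0 \<le> z t"
        and pos: "0 < 0 * x t + 1 * y t + 0 * z t"
      for t d1 d2 d3 d4 d5 d6 x' y' z'
      using slope_y_pos[OF R] parameter_bounds[OF R] Q pos by (simp add: nz)
  qed
  then show ?thesis
    by simp
qed

definition \<delta> :: real where "\<delta> = 1 - max (m6 * \<beta>) (m6 * (1 - m2 * \<alpha>) / m5)"

lemma \<delta>: "0 < \<delta>"
  using \<beta> near_critical pos by (simp add: \<delta>_def)

lemma eventually_z_nonpos:
  assumes "\<forall>\<^sub>F t in at_top. x t = 0" "\<forall>\<^sub>F t in at_top. y t = 0"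
  shows "\<forall>\<^sub>F t in at_top. z t \<le> 0"
proof -
  have "\<forall>\<^sub>F t in at_top. 0 * x t + 0 * y t + 1 * z t \<le> 0"
  proof (rule eventually_combination_nonpos[where \<kappa> = "nz (1 - c) * \<delta>" and Q = "\<lambda>t. x t = 0 \<and> y t = 0"])
    show "0 < nz (1 - c) * \<delta>"
      using nz \<delta> by simp
    show "\<forall>\<^sub>F t in at_top. x t = 0 \<and> y t = 0"
      using assms by eventually_elim simp
    show "0 * x' + 0 * y' + 1 * z' \<le> - (nz (1 - c) * \<delta>)"
      if R: "rates d1 d2 d3 d4 d5 d6 (x t) x' (y t) y' (z t) z'" and Q: "x t = 0 \<and> y t = 0"
        and pos: "0 < 0 * x t + 0 * y t + 1 * z t"
      for t d1 d2 d3 d4 d5 d6 x' y' z'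
      using slope_z_pos[OF R, folded \<delta>_def] parameter_bounds[OF R] Q pos by (simp add: nz)
  qed
  then show ?thesis
    by simp
qed

lemma eventually_y_nonneg:
  assumes "\<forall>\<^sub>F t in at_top. z t \<le> 0"
  shows "\<forall>\<^sub>F t in at_top. 0 \<le> y t"
proof -
  have "\<forall>\<^sub>F t in at_top. 0 * x t + (- 1) * y t + 0 * z t \<le> 0"
  proof (rule eventually_combination_nonpos[where \<kappa> = "nz b * (1 - m2)" and Q = "\<lambda>t. 0 \<le> x t \<and> z t \<le> 0"])
    show "0 < nz b * (1 - m2)"
      using nz lt1 by simp
    show "\<forall>\<^sub>F t in at_top. 0 \<le> x t \<and> z t \<le> 0"
      using eventually_x_nonneg assms by eventually_elim simp
    show "0 * x' + (- 1) * y' + 0 * z' \<le> - (nz b * (1 - m2))"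
      if R: "rates d1 d2 d3 d4 d5 d6 (x t) x' (y t) y' (z t) z'" and Q: "0 \<le> x t \<and> z t \<le> 0"
        and neg: "0 < 0 * x t + (- 1) * y t + 0 * z t"
      for t d1 d2 d3 d4 d5 d6 x' y' z'
      using slope_y_neg[OF R] parameter_bounds[OF R] Q neg by (simp add: nz)
  qed
  then show ?thesis
    by simp
qed

text \<open>Work enters class 2 at rate at most m2 / m1 < 1, so the negative part of
  \<open>y\<close> dies out by itself and the cycle is cut there.\<close>

lemma collapse_if_m2_less_m1:
  assumes "m2 < m1"
  shows "\<forall>\<^sub>F t in at_top. x t = 0 \<and> y t = 0 \<and> z t = 0"
proof -
  have "\<forall>\<^sub>F t in at_top. 0 * x t + (- 1) * y t + 0 * z t \<le> 0"
  proof (rule eventually_combination_nonpos[where \<kappa> = "nz b * (1 - m2 / m1)" and Q = "\<lambda>_. True"])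
    show "0 < nz b * (1 - m2 / m1)"
      using nz assms pos by simp
    show "0 * x' + (- 1) * y' + 0 * z' \<le> - (nz b * (1 - m2 / m1))"
      if R: "rates d1 d2 d3 d4 d5 d6 (x t) x' (y t) y' (z t) z'"
        and neg: "0 < 0 * x t + (- 1) * y t + 0 * z t"
      for t d1 d2 d3 d4 d5 d6 x' y' z'
      using slope_y_neg_any[OF R] parameter_bounds[OF R] neg by (simp add: nz)
  qed simp
  then have y: "\<forall>\<^sub>F t in at_top. 0 \<le> y t"
    by simp
  note z = eventually_z_nonneg[OF y]
  note x0 = eventually_x_zero[OF y z]
  have y0: "\<forall>\<^sub>F t in at_top. y t = 0"
    using y eventually_y_nonpos[OF x0 z] by eventually_elim simp
  show ?thesis
    using x0 y0 z eventually_z_nonpos[OF x0 y0] by eventually_elim simp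
qed

text \<open>Here the cycle is cut at class 6, whose work arrives at rate at most m6 / m5 <
  1.\<close>

lemma collapse_if_m6_less_m5:
  assumes "m6 < m5"
  shows "\<forall>\<^sub>F t in at_top. x t = 0 \<and> y t = 0 \<and> z t = 0"
proof -
  have "\<forall>\<^sub>F t in at_top. 0 * x t + 0 * y t + 1 * z t \<le> 0"
  proof (rule eventually_combination_nonpos[where \<kappa> = "nz (1 - c) * (1 - m6 / m5)" and Q = "\<lambda>_. True"])
    show "0 < nz (1 - c) * (1 - m6 / m5)"
      using nz assms pos by simp
    show "0 * x' + 0 * y' + 1 * z' \<le> - (nz (1 - c) * (1 - m6 / m5))"
      if R: "rates d1 d2 d3 d4 d5 d6 (x t) x' (y t) y' (z t) z'"
        and pos: "0 < 0 * x t + 0 * y t + 1 * z t"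
      for t d1 d2 d3 d4 d5 d6 x' y' z'
      using slope_z_pos_any[OF R] parameter_bounds[OF R] pos by (simp add: nz algebra_simps)
  qed simp
  then have z: "\<forall>\<^sub>F t in at_top. z t \<le> 0"
    by simp
  note y = eventually_y_nonneg[OF z]
  note z' = eventually_z_nonneg[OF y]
  note x0 = eventually_x_zero[OF y z']
  show ?thesis
    using x0 y z z' eventually_y_nonpos[OF x0 z'] by eventually_elim simp
qed

text \<open>
  In the remaining case the signs of \<open>y\<close> and \<open>z\<close> settle, and the only possible cycle of growth is
  the one of the pseudostation formed by classes 2, 4 and 6: a unit of \<open>y\<^sup>-\<close> produces \<open>m4 / m3 - 1\<close>
  units of \<open>x\<close>, a unit of \<open>x\<close> produces \<open>m6 / m5 - 1\<close> units of \<open>z\<close>, and a unit of \<open>z\<close> produces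
  \<open>m2 / m1 - 1\<close> units of \<open>y\<^sup>-\<close>.
\<close>

lemma cycle_gain_less_1:
  assumes "m2 + m4 + m6 < 2" "m1 \<le> m2" "m5 \<le> m6"
  shows "max 0 (m4 / m3 - 1) * (m2 / m1 - 1) * (m6 / m5 - 1) < 1"
proof (cases "m4 \<le> m3")
  case True
  then have "m4 / m3 - 1 \<le> 0"
    using pos by simp
  then show ?thesis
    by simp
next
  case False
  \<comment> \<open>The denominators of the gains are permuted. By the unit sums, each of the new
    quotients is below 1 exactly when m1 + m3 + m5 > 1, that is, m2 + m4 + m6 < 2.\<close>
  define u v w where "u = (m4 - m3) / m5" and "v = (m2 - m1) / m3" and "w = (m6 - m5) / m1"
  have uvw: "0 \<le> u" "0 \<le> v" "0 \<le> w" "u < 1" "v < 1" "w < 1"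
    using assms False pos unit by (simp_all add: u_def v_def w_def)
  have "u * v \<le> 1"
    using uvw by (intro mult_le_one) auto
  then have "u * v * w < 1"
    using uvw mult_left_le_one_le[of w "u * v"] by (simp add: mult.commute)
  moreover have "u * v * w = (m4 / m3 - 1) * (m2 / m1 - 1) * (m6 / m5 - 1)"
    using pos by (simp add: u_def v_def w_def field_simps)
  moreover have "max 0 (m4 / m3 - 1) = m4 / m3 - 1"
    using False pos by simp
  ultimately show ?thesis
    by simp
qed

text \<open>The negative part of \<open>z\<close>, and after it the positive part of
  \<open>y\<close>, cannot grow, so each is eventually absent or present for good. In the second
  alternative the comparison lemmas apply and give the desired sign all the same.\<close>

lemma collapse_if_cyclic:
  assumes sum: "m2 + m4 + m6 < 2" and le: "m1 \<le> m2" "m5 \<le> m6"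
  shows "\<forall>\<^sub>F t in at_top. x t = 0 \<and> y t = 0 \<and> z t = 0"
proof -
  have "(\<forall>\<^sub>F t in at_top. 0 * x t + 0 * y t + (- 1) * z t \<le> 0) \<or> (\<forall>\<^sub>F t in at_top. 0 < 0 * x t + 0 * y t + (- 1) * z t)"
  proof (rule eventually_combination_sign[where Q = "\<lambda>_. True"])
    show "0 * x' + 0 * y' + (- 1) * z' \<le> 0"
      if R: "rates d1 d2 d3 d4 d5 d6 (x t) x' (y t) y' (z t) z'" and neg: "0 < 0 * x t + 0 * y t + (- 1) * z t"
      for t d1 d2 d3 d4 d5 d6 x' y' z'
    proof -
      \<comment> \<open>m5 \<le> m6 means m3 \<le> m2.\<close>
      have "0 \<le> c * (1 - m3 / m2)"
        using abc le pos unit by (intro mult_nonneg_nonneg) (auto simp: field_simps)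
      then show ?thesis
        using slope_z_neg_any[OF R] neg by simp
    qed
  qed simp
  then have z: "\<forall>\<^sub>F t in at_top. 0 \<le> z t"
  proof
    assume "\<forall>\<^sub>F t in at_top. 0 < 0 * x t + 0 * y t + (- 1) * z t"
    then have "\<forall>\<^sub>F t in at_top. z t \<le> 0"
      by eventually_elim simp
    then show ?thesis
      by (intro eventually_z_nonneg eventually_y_nonneg)
  qed simp
  have "(\<forall>\<^sub>F t in at_top. 0 * x t + 1 * y t + 0 * z t \<le> 0) \<or> (\<forall>\<^sub>F t in at_top. 0 < 0 * x t + 1 * y t + 0 * z t)"
  proof (rule eventually_combination_sign[where Q = "\<lambda>t. 0 \<le> x t \<and> 0 \<le> z t"])
    show "\<forall>\<^sub>F t in at_top. 0 \<le> x t \<and> 0 \<le> z t"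
      using eventually_x_nonneg z by eventually_elim simp
    show "0 * x' + 1 * y' + 0 * z' \<le> 0"
      if R: "rates d1 d2 d3 d4 d5 d6 (x t) x' (y t) y' (z t) z'" and Q: "0 \<le> x t \<and> 0 \<le> z t"
        and y: "0 < 0 * x t + 1 * y t + 0 * z t"
      for t d1 d2 d3 d4 d5 d6 x' y' z'
    proof (cases "x t = 0")
      case True
      have "0 \<le> (1 - b) * (1 - m5 * \<beta>)"
        using abc \<beta> by simp
      then show ?thesis
        using slope_y_pos[OF R] True Q y by simp
    next
      case False
      \<comment> \<open>m1 \<le> m2 means m5 \<le> m4.\<close>
      have "(1 - b) * (m5 / m4 - 1) \<le> 0"
        using abc le pos unit by (intro mult_nonneg_nonpos) (auto simp: field_simps)
      then show ?thesis
        using slope_y_pos_x_pos[OF R] False Q y by simp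
    qed
  qed
  then have y: "\<forall>\<^sub>F t in at_top. y t \<le> 0"
  proof
    assume "\<forall>\<^sub>F t in at_top. 0 < 0 * x t + 1 * y t + 0 * z t"
    then have "\<forall>\<^sub>F t in at_top. 0 \<le> y t"
      by eventually_elim simp
    then show ?thesis
      using z by (intro eventually_y_nonpos eventually_x_zero)
  qed simp
  \<comment> \<open>The truncation at 0 is for m4 < m3, which the case assumptions leave
    open.\<close>
  define A B C where "A = max 0 (m4 / m3 - 1)" and "B = m2 / m1 - 1" and "C = m6 / m5 - 1"
  have ABC: "0 \<le> A" "0 \<le> B" "0 \<le> C" "A * B * C < 1"
    using cycle_gain_less_1[OF sum le] le pos by (auto simp: A_def B_def C_def)
  obtain l1 l2 l3 where l: "0 < l1" "0 < l2" "0 < l3" "l1 * A < l2" "l2 * B < l3" "l3 * C < l1"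
    using cyclic_weights[OF ABC] by blast
  \<comment> \<open>The slopes of the deviations carry the factors 1 - a, b and 1 - c, which the
    division cancels; \<open>q\<close> is negative because \<open>y\<close> is nonpositive.\<close>
  define p q r where "p = l1 / nz (1 - a)" and "q = - (l2 / nz b)" and "r = l3 / nz (1 - c)"
  have pqr: "0 < p" "q < 0" "0 < r"
    using l nz by (auto simp: p_def q_def r_def)
  \<comment> \<open>One entry for each nonzero sign pattern, in the order of the cases below: one
    active deviation, two, all three. With two, the starved one falls at full speed and outweighs
    the gain of the other.\<close>
  define \<kappa> where "\<kappa> = Min {l1 * (1 - m4), l2 * (1 - m2), l3 * \<delta>, l2 - l1 * A, l1 - l3 * C, l3 - l2 * B, l1 + l2 + l3}"
  have \<kappa>: "0 < \<kappa>"
    unfolding \<kappa>_def using l lt1 \<delta> by (subst Min_gr_iff) (auto simp del: Min_insert)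
  have \<kappa>_le: "\<kappa> \<le> l1 * (1 - m4)" "\<kappa> \<le> l2 * (1 - m2)" "\<kappa> \<le> l3 * \<delta>" "\<kappa> \<le> l2 - l1 * A" "\<kappa> \<le> l1 - l3 * C"
      "\<kappa> \<le> l3 - l2 * B" "\<kappa> \<le> l1 + l2 + l3"
    unfolding \<kappa>_def by (rule Min_le; simp)+
  have "\<forall>\<^sub>F t in at_top. p * x t + q * y t + r * z t \<le> 0"
  proof (rule eventually_combination_nonpos[OF \<kappa>, where Q = "\<lambda>t. 0 \<le> x t \<and> y t \<le> 0 \<and> 0 \<le> z t"])
    show "\<forall>\<^sub>F t in at_top. 0 \<le> x t \<and> y t \<le> 0 \<and> 0 \<le> z t"
      using eventually_x_nonneg y z by eventually_elim simp
    fix t d1 d2 d3 d4 d5 d6 x' y' z'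
    assume R: "rates d1 d2 d3 d4 d5 d6 (x t) x' (y t) y' (z t) z'" and Q: "0 \<le> x t \<and> y t \<le> 0 \<and> 0 \<le> z t"
      and f: "0 < p * x t + q * y t + r * z t"
    note P = parameter_bounds[OF R]
    have X: "p * x' \<le> l1 * B'" if "0 < x t" "x' \<le> (1 - a) * B'" for B'
    proof -
      have "p * x' \<le> p * ((1 - a) * B')"
        using that pqr by (intro mult_left_mono) auto
      also have "\<dots> = l1 * B'"
        using P(1) that nz(2)[of "1 - a"] by (simp add: p_def)
      finally show ?thesis .
    qed
    have Y: "q * y' \<le> - (l2 * B')" if "y t < 0" "b * B' \<le> y'" for B'
    proof -
      have "q * y' \<le> q * (b * B')"
        using that pqr by (intro mult_left_mono_neg) auto
      also have "\<dots> = - (l2 * B')"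
        using P(4) that nz(2)[of b] by (simp add: q_def)
      finally show ?thesis .
    qed
    have Z: "r * z' \<le> l3 * B'" if "0 < z t" "z' \<le> (1 - c) * B'" for B'
    proof -
      have "r * z' \<le> r * ((1 - c) * B')"
        using that pqr by (intro mult_left_mono) auto
      also have "\<dots> = l3 * B'"
        using P(5) that nz(2)[of "1 - c"] by (simp add: r_def)
      finally show ?thesis .
    qed
    have "(1 - a) * (m4 / m3 - 1) \<le> (1 - a) * A"
      using abc by (intro mult_left_mono) (auto simp: A_def)
    then have X1: "0 < x t \<Longrightarrow> p * x' \<le> l1 * A"
      using X[of A] slope_x_pos_any[OF R] by simp
    have X2: "0 < x t \<Longrightarrow> 0 < z t \<Longrightarrow> p * x' \<le> - l1"
      using X[of "- 1"] slope_x_pos_z_pos[OF R] by simp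
    have X3: "0 < x t \<Longrightarrow> y t = 0 \<Longrightarrow> z t = 0 \<Longrightarrow> p * x' \<le> - (l1 * (1 - m4))"
      using X[of "- (1 - m4)"] slope_x_pos[OF R] by (simp del: minus_diff_eq)
    have Y1: "y t < 0 \<Longrightarrow> q * y' \<le> l2 * B"
      using Y[of "- B"] slope_y_neg_any[OF R] by (simp add: B_def right_diff_distrib)
    have Y2: "y t < 0 \<Longrightarrow> 0 < x t \<Longrightarrow> q * y' \<le> - l2"
      using Y[of 1] slope_y_neg_x_pos[OF R] by simp
    have Y3: "y t < 0 \<Longrightarrow> z t = 0 \<Longrightarrow> q * y' \<le> - (l2 * (1 - m2))"
      using Y[of "1 - m2"] slope_y_neg[OF R] Q by simp
    have Z1: "0 < z t \<Longrightarrow> r * z' \<le> l3 * C"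
      using Z[of C] slope_z_pos_any[OF R] by (simp add: C_def)
    have Z2: "0 < z t \<Longrightarrow> y t < 0 \<Longrightarrow> r * z' \<le> - l3"
      using Z[of "- 1"] slope_z_pos_y_neg[OF R] by simp
    have Z3: "0 < z t \<Longrightarrow> x t = 0 \<Longrightarrow> y t = 0 \<Longrightarrow> r * z' \<le> - (l3 * \<delta>)"
      using Z[of "- \<delta>"] slope_z_pos[OF R, folded \<delta>_def] by simp
    have zero: "x t = 0 \<Longrightarrow> p * x' = 0" "y t = 0 \<Longrightarrow> q * y' = 0" "z t = 0 \<Longrightarrow> r * z' = 0"
      using P(7-9) by simp_all
    consider "0 < x t" "y t = 0" "z t = 0" | "x t = 0" "y t < 0" "z t = 0" | "x t = 0" "y t = 0" "0 < z t"
      | "0 < x t" "y t < 0" "z t = 0" | "0 < x t" "y t = 0" "0 < z t" | "x t = 0" "y t < 0" "0 < z t"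
      | "0 < x t" "y t < 0" "0 < z t" | "x t = 0" "y t = 0" "z t = 0"
      using Q unfolding le_less by metis
    then show "p * x' + q * y' + r * z' \<le> - \<kappa>"
    proof cases
      case 1
      then show ?thesis using X3 zero \<kappa>_le(1) by linarith
    next
      case 2
      then show ?thesis using Y3 zero \<kappa>_le(2) by linarith
    next
      case 3
      then show ?thesis using Z3 zero \<kappa>_le(3) by linarith
    next
      case 4
      then show ?thesis using X1 Y2 zero \<kappa>_le(4) by linarith
    next
      case 5
      then show ?thesis using X2 Z1 zero \<kappa>_le(5) by linarith
    next
      case 6
      then show ?thesis using Y1 Z2 zero \<kappa>_le(6) by linarith
    next
      case 7
      then show ?thesis using X2 Y2 Z2 \<kappa>_le(7) by linarith
    next
      case 8
      then show ?thesis using f by simp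
    qed
  qed
  \<comment> \<open>Each of the three terms is nonnegative, so a nonpositive sum forces all to
    vanish.\<close>
  with eventually_x_nonneg y z show ?thesis
  proof eventually_elim
    case (elim t)
    have "0 \<le> p * x t" "0 \<le> q * y t" "0 \<le> r * z t"
      using elim pqr by (auto intro: mult_nonneg_nonneg mult_nonpos_nonpos)
    with elim have "p * x t = 0" "q * y t = 0" "r * z t = 0"
      by linarith+
    then show ?case
      using pqr by simp
  qed
qed

theorem collapse:
  assumes "m2 + m4 + m6 < 2"
  shows "\<forall>\<^sub>F t in at_top. x t = 0 \<and> y t = 0 \<and> z t = 0"
  using collapse_if_m2_less_m1 collapse_if_m6_less_m5 collapse_if_cyclic[OF assms] by linarith

end

section \<open>Skorohod problems\<close>

text \<open>The positive minimum of \<open>w\<close> on [s, t] times the Stieltjes mass of [s, t] is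
  a lower bound for the vanishing integral.\<close>

lemma complementary_imp_constant:
  assumes compl: "complementary w y" and w: "continuous_on {0..} w" and y: "continuous_on {0..} y" "mono_on {0..} y"
    and st: "0 \<le> s" "s \<le> t" and pos: "\<And>u. s \<le> u \<Longrightarrow> u \<le> t \<Longrightarrow> 0 < w u"
  shows "y t = y s"
proof -
  define F where "F = (\<lambda>t. y (max 0 t))"
  have F_mono: "F u \<le> F v" if "u \<le> v" for u v
    unfolding F_def using that by (intro mono_onD[OF y(2)]) auto
  have F_cont: "continuous_on UNIV F"
    unfolding F_def by (rule continuous_on_compose2[OF y(1)]) (auto intro!: continuous_intros)
  obtain v where v: "v \<in> {s..t}" "\<And>u. u \<in> {s..t} \<Longrightarrow> w v \<le> w u"
    using continuous_attains_inf[of "{s..t}" w] continuous_on_subset[OF w, of "{s..t}"] st by auto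
  have "w v > 0"
    using v pos by simp
  have "ennreal (w v) * emeasure (interval_measure F) {s..t} =
      (\<integral>\<^sup>+u. ennreal (w v) * indicator {s..t} u \<partial>interval_measure F)"
    by (simp add: nn_integral_cmult_indicator)
  also have "\<dots> \<le> (\<integral>\<^sup>+u\<in>{0..}. ennreal (w u) \<partial>interval_measure F)"
    using v st by (intro nn_integral_mono) (auto simp: indicator_def intro!: ennreal_leI)
  also have "\<dots> = 0"
    using compl unfolding complementary_def F_def .
  finally have "emeasure (interval_measure F) {s..t} = 0"
    using \<open>w v > 0\<close> by (simp add: ennreal_eq_0_iff)
  then have "ennreal (F t - F s) = 0"
    using emeasure_interval_measure_Icc[OF st(2) F_mono F_cont] by simp
  then have "F t \<le> F s"
    by (simp add: ennreal_eq_0_iff)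
  then show ?thesis
    using F_mono[OF st(2)] st by (simp add: F_def)
qed

text \<open>Complementarity is replaced by its consequence \<open>const\<close>, which survives a
  change of time and so serves fluid and Skorohod solutions alike.\<close>

lemma derivative_zero_if_locally_constant:
  fixes w y :: "real \<Rightarrow> real"
  assumes const: "\<And>s u. 0 \<le> s \<Longrightarrow> s \<le> u \<Longrightarrow> (\<And>v. s \<le> v \<Longrightarrow> v \<le> u \<Longrightarrow> 0 < w v) \<Longrightarrow> y u = y s"
    and w: "isCont w t" "0 < w t" "0 < t" and D: "(y has_real_derivative D) (at t)"
  shows "D = 0"
proof -
  have "\<forall>\<^sub>F s in at t. 0 < w s"
    using w by (intro order_tendstoD(1)) (auto simp: isCont_def)
  then have "\<exists>d>0. \<forall>s. s \<noteq> t \<and> dist s t < d \<longrightarrow> 0 < w s"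
    by (simp add: eventually_at)
  then obtain d where d: "d > 0" "\<And>s. s \<noteq> t \<Longrightarrow> dist s t < d \<Longrightarrow> 0 < w s"
    by blast
  have eq: "y s = y t" if s: "s \<in> {max 0 (t - d)<..<t + d}" for s
  proof -
    have "0 < w v" if "min s t \<le> v" "v \<le> max s t" for v
      using d(2)[of v] w(2) s that by (cases "v = t") (auto simp: dist_real_def)
    then have pos: "0 < w v" if "s \<le> v \<and> v \<le> t \<or> t \<le> v \<and> v \<le> s" for v
      using that by force
    show ?thesis
    proof (cases "s \<le> t")
      case True
      then show ?thesis
        using const[of s t] pos s by auto
    next
      case False
      then show ?thesis
        using const[of t s] pos w(3) by auto
    qed
  qed
  have "((\<lambda>_. y t) has_real_derivative D) (at t)"
    by (rule has_field_derivative_transform_within_open[where S = "{max 0 (t - d)<..<t + d}", OF D _ _ eq])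
      (use d(1) w(3) in auto)
  then show ?thesis
    using DERIV_unique[OF _ DERIV_const] by blast
qed

lemma derivative_zero_at_minimum:
  fixes w :: "real \<Rightarrow> real"
  assumes D: "(w has_real_derivative D) (at t)" and "0 < t" "w t = 0" and nonneg: "\<And>s. 0 \<le> s \<Longrightarrow> 0 \<le> w s"
  shows "D = 0"
  by (rule DERIV_local_min[OF D \<open>0 < t\<close>]) (use assms in \<open>auto intro!: nonneg\<close>)

lemma derivative_nonneg_if_mono_on:
  assumes "mono_on {0..} f" "0 < t" "(f has_real_derivative D) (at t)"
  shows "0 \<le> D"
  by (rule mono_on_imp_deriv_nonneg[OF assms(1,3)]) (use assms in simp)

text \<open>
  Reparametrising by \<open>t + \<Sum>\<^sub>j Y\<^sub>j t\<close> turns the merely continuous solution into a Lipschitz one.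
\<close>

lemma skorohod_time_change:
  fixes R :: "('j::finite, 'j) rmat" and \<theta> :: "'j rvec"
  assumes sp: "skorohod_solution R \<theta> Y W"
  obtains \<tau> S :: "real \<Rightarrow> real" and N L where
    "\<And>s. 0 \<le> s \<Longrightarrow> 0 \<le> \<tau> s" "1-lipschitz_on {0..} \<tau>"
    "\<And>t. 0 \<le> t \<Longrightarrow> \<tau> (S t) = t" "\<And>t. 0 \<le> t \<Longrightarrow> t \<le> S t"
    "\<And>j. L-lipschitz_on {0..} (\<lambda>s. W (\<tau> s) $ j)" "negligible N"
    "\<And>s. 0 < s \<Longrightarrow> s \<notin> N \<Longrightarrow> \<exists>\<sigma> y w. 0 \<le> \<sigma> \<and> (\<tau> has_real_derivative \<sigma>) (at s) \<and> w = \<sigma> *\<^sub>R \<theta> + R *v y \<and>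
      (\<forall>j. 0 \<le> y $ j \<and> ((\<lambda>s. W (\<tau> s) $ j) has_real_derivative w $ j) (at s) \<and>
        (0 < W (\<tau> s) $ j \<longrightarrow> y $ j = 0) \<and> (W (\<tau> s) $ j = 0 \<longrightarrow> w $ j = 0))"
proof -
  note sp' = sp[unfolded skorohod_solution_def]
  have contY: "continuous_on {0..} (\<lambda>t. Y t $ j)" and contW: "continuous_on {0..} (\<lambda>t. W t $ j)" for j
    using sp' by (simp_all add: continuous_on_component)
  have W: "W t = W 0 + t *\<^sub>R \<theta> + R *v Y t" and W_nonneg: "0 \<le> W t $ j" if "0 \<le> t" for t j
    using sp' that by blast+
  have Y0: "Y 0 = 0" and Y_mono: "mono_on {0..} (\<lambda>t. Y t $ j)"
    and compl: "complementary (\<lambda>t. W t $ j) (\<lambda>t. Y t $ j)" for j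
    using sp' by blast+
  define S where "S = (\<lambda>t. t + (\<Sum>j\<in>UNIV. Y t $ j))"
  have YD: "Y s $ j \<le> Y t $ j" if "0 \<le> s" "s \<le> t" for s t j
    using that by (intro mono_onD[OF Y_mono]) auto
  have sumD: "(\<Sum>j\<in>UNIV. Y s $ j) \<le> (\<Sum>j\<in>UNIV. Y t $ j)" if "0 \<le> s" "s \<le> t" for s t
    using YD[OF that] by (intro sum_mono)
  have S0: "S 0 = 0"
    by (simp add: S_def Y0)
  have S_ge: "t \<le> S t" if "0 \<le> t" for t
    using sumD[of 0 t] that by (simp add: S_def Y0)
  have S_gap: "t - s \<le> S t - S s" if "0 \<le> s" "s \<le> t" for s t
    using sumD[OF that] by (simp add: S_def)
  have S_cont: "continuous_on {0..} S"
    unfolding S_def by (intro continuous_intros contY)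
  have S_surj: "\<exists>t\<ge>0. S t = s" if s: "0 \<le> s" for s
  proof -
    have "continuous_on {0..s} S"
      by (rule continuous_on_subset[OF S_cont]) auto
    then obtain t where "0 \<le> t" "S t = s"
      using IVT'[of S 0 s s] S0 S_ge[OF s] s by auto
    then show ?thesis
      by blast
  qed
  \<comment> \<open>\<open>S\<close> is strictly increasing and maps onto the half-line, so the
    choice is unique and \<open>\<tau>\<close> is the inverse of \<open>S\<close>.\<close>
  define \<tau> where "\<tau> = (\<lambda>s. SOME t. 0 \<le> t \<and> S t = s)"
  have \<tau>: "0 \<le> \<tau> s \<and> S (\<tau> s) = s" if "0 \<le> s" for s
    unfolding \<tau>_def by (rule someI_ex) (rule S_surj[OF that])
  have \<tau>S: "\<tau> (S t) = t" if "0 \<le> t" for t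
  proof -
    have t': "0 \<le> \<tau> (S t)" "S (\<tau> (S t)) = S t"
      using \<tau>[of "S t"] S_ge[OF that] that by auto
    then show ?thesis
      using S_gap[of t "\<tau> (S t)"] S_gap[of "\<tau> (S t)" t] that by (cases "t \<le> \<tau> (S t)") auto
  qed
  have \<tau>_mono: "\<tau> s \<le> \<tau> s'" if "0 \<le> s" "s \<le> s'" for s s'
    using S_gap[of "\<tau> s'" "\<tau> s"] \<tau>[of s] \<tau>[of s'] that by (cases "\<tau> s' \<le> \<tau> s") auto
  \<comment> \<open>Elapsed intrinsic time splits into physical time and the pushing increments. All
    parts are nonnegative, so each is bounded by the total: this is the source of the Lipschitz
    constants 1.\<close>
  have split: "(\<tau> s' - \<tau> s) + (\<Sum>j\<in>UNIV. Y (\<tau> s') $ j - Y (\<tau> s) $ j) = s' - s" if "0 \<le> s" "s \<le> s'" for s s'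
    using \<tau>[of s] \<tau>[of s'] that unfolding S_def by (simp add: sum_subtractf)
  have Y\<tau>_mono: "Y (\<tau> s) $ j \<le> Y (\<tau> s') $ j" if "0 \<le> s" "s \<le> s'" for s s' j
    using YD[of "\<tau> s" "\<tau> s'" j] \<tau>[of s] \<tau>_mono[OF that] that by simp
  have \<tau>_incr: "\<tau> s' - \<tau> s \<le> s' - s" if "0 \<le> s" "s \<le> s'" for s s'
  proof -
    have "0 \<le> (\<Sum>j\<in>UNIV. Y (\<tau> s') $ j - Y (\<tau> s) $ j)"
      using Y\<tau>_mono[OF that] by (intro sum_nonneg) simp
    then show ?thesis
      using split[OF that] by linarith
  qed
  have Y_incr: "Y (\<tau> s') $ j - Y (\<tau> s) $ j \<le> s' - s" if "0 \<le> s" "s \<le> s'" for s s' j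
  proof -
    have "Y (\<tau> s') $ j - Y (\<tau> s) $ j \<le> (\<Sum>j\<in>UNIV. Y (\<tau> s') $ j - Y (\<tau> s) $ j)"
      using Y\<tau>_mono[OF that] by (intro member_le_sum) auto
    then show ?thesis
      using split[OF that] \<tau>_mono[OF that] by linarith
  qed
  have \<tau>_lip: "1-lipschitz_on {0..} \<tau>"
    by (rule lipschitz_on_leI) (use \<tau>_incr \<tau>_mono in \<open>auto simp: dist_real_def\<close>)
  have Y_lip: "1-lipschitz_on {0..} (\<lambda>s. Y (\<tau> s) $ j)" for j
    by (rule lipschitz_on_leI) (use Y_incr Y\<tau>_mono in \<open>auto simp: dist_real_def abs_minus_commute\<close>)
  have \<tau>_mono_on: "mono_on {0..} \<tau>" and Y_mono_on: "mono_on {0..} (\<lambda>s. Y (\<tau> s) $ j)" for j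
    using \<tau>_mono Y\<tau>_mono by (auto intro!: mono_onI)
  have W\<tau>: "W (\<tau> s) $ j = W 0 $ j + (\<tau> s * \<theta> $ j + (\<Sum>i\<in>UNIV. R $ j $ i * Y (\<tau> s) $ i))" if "0 \<le> s" for s j
    using W[of "\<tau> s"] \<tau>[OF that] by (simp add: matrix_vector_mult_def)
  define M where "M = (\<lambda>j. \<bar>\<theta> $ j\<bar> + (\<Sum>i\<in>UNIV. \<bar>R $ j $ i\<bar>))"
  have W_lip: "(Max (range M))-lipschitz_on {0..} (\<lambda>s. W (\<tau> s) $ j)" for j
  proof (rule lipschitz_on_mono)
    show "M j \<le> Max (range M)"
      by simp
    show "(M j)-lipschitz_on {0..} (\<lambda>s. W (\<tau> s) $ j)"
    proof (rule lipschitz_on_leI)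
      fix s s' :: real assume s: "s \<in> {0..}" "s' \<in> {0..}" "s \<le> s'"
      have "W (\<tau> s') $ j - W (\<tau> s) $ j =
          \<theta> $ j * (\<tau> s' - \<tau> s) + (\<Sum>i\<in>UNIV. R $ j $ i * (Y (\<tau> s') $ i - Y (\<tau> s) $ i))"
        using s by (simp add: W\<tau> algebra_simps sum_subtractf)
      also have "\<bar>\<dots>\<bar> \<le> \<bar>\<theta> $ j\<bar> * (s' - s) + (\<Sum>i\<in>UNIV. \<bar>R $ j $ i\<bar> * (s' - s))"
      proof (intro order_trans[OF abs_triangle_ineq] add_mono order_trans[OF sum_abs] sum_mono)
        show "\<bar>\<theta> $ j * (\<tau> s' - \<tau> s)\<bar> \<le> \<bar>\<theta> $ j\<bar> * (s' - s)"
          using s \<tau>_incr[of s s'] \<tau>_mono[of s s'] unfolding abs_mult by (intro mult_left_mono) auto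
        show "\<bar>R $ j $ i * (Y (\<tau> s') $ i - Y (\<tau> s) $ i)\<bar> \<le> \<bar>R $ j $ i\<bar> * (s' - s)" for i
          using s Y_incr[of s s' i] Y\<tau>_mono[of s s' i] unfolding abs_mult by (intro mult_left_mono) auto
      qed
      finally show "dist (W (\<tau> s) $ j) (W (\<tau> s') $ j) \<le> M j * dist s s'"
        using s by (simp add: dist_real_def M_def sum_distrib_right distrib_right abs_minus_commute)
    qed (simp add: M_def sum_nonneg)
  qed simp
  define N where "N = {s. 0 < s \<and> \<not> \<tau> differentiable (at s)} \<union> (\<Union>j. {s. 0 < s \<and> \<not> (\<lambda>s. Y (\<tau> s) $ j) differentiable (at s)})"
  have N: "negligible N"
    unfolding N_def
    by (intro negligible_Un negligible_Union finite_imageI finite_class.finite_UNIV)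
      (auto intro: mono_lipschitz_half_line_differentiable_ae[OF \<tau>_mono_on \<tau>_lip]
        mono_lipschitz_half_line_differentiable_ae[OF Y_mono_on Y_lip])
  show thesis
  proof (rule that[of \<tau> S "Max (range M)" N])
    fix s assume s: "0 < s" "s \<notin> N"
    then obtain \<sigma> where \<sigma>: "(\<tau> has_real_derivative \<sigma>) (at s)"
      by (auto simp: N_def real_differentiable_def)
    have "\<exists>D. ((\<lambda>s. Y (\<tau> s) $ j) has_real_derivative D) (at s)" for j
      using s by (auto simp: N_def real_differentiable_def)
    then obtain D where D: "\<And>j. ((\<lambda>s. Y (\<tau> s) $ j) has_real_derivative D j) (at s)"
      by metis
    define y where "y = (\<chi> j. D j)"
    define w where "w = \<sigma> *\<^sub>R \<theta> + R *v y"
    have w: "((\<lambda>s. W (\<tau> s) $ j) has_real_derivative w $ j) (at s)" for j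
    proof -
      have "((\<lambda>s. W 0 $ j + (\<tau> s * \<theta> $ j + (\<Sum>i\<in>UNIV. R $ j $ i * Y (\<tau> s) $ i))) has_real_derivative
          0 + (\<sigma> * \<theta> $ j + (\<Sum>i\<in>UNIV. R $ j $ i * D i))) (at s)"
        by (intro DERIV_add DERIV_const DERIV_cmult_right \<sigma> DERIV_sum DERIV_cmult D)
      then have "((\<lambda>s. W (\<tau> s) $ j) has_real_derivative 0 + (\<sigma> * \<theta> $ j + (\<Sum>i\<in>UNIV. R $ j $ i * D i))) (at s)"
        by (rule has_field_derivative_transform_within_open[of _ _ _ "{0<..}"]) (use s W\<tau> in auto)
      then show ?thesis
        by (simp add: w_def y_def matrix_vector_mult_def)
    qed
    have "0 \<le> y $ j" for j
      using derivative_nonneg_if_mono_on[OF Y_mono_on s(1) D] by (simp add: y_def)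
    moreover have "0 \<le> \<sigma>"
      using derivative_nonneg_if_mono_on[OF \<tau>_mono_on s(1) \<sigma>] .
    moreover have "w $ j = 0" if "W (\<tau> s) $ j = 0" for j
      by (rule derivative_zero_at_minimum[OF w s(1) that]) (use W_nonneg \<tau> in auto)
    moreover have "y $ j = 0" if "0 < W (\<tau> s) $ j" for j
    proof -
      have "D j = 0"
      proof (rule derivative_zero_if_locally_constant[OF _ DERIV_isCont[OF w] that s(1) D])
        \<comment> \<open>An interval of intrinsic time on which station \<open>j\<close> is
          nonempty corresponds to one of physical time, each point of which is traced back through
          \<open>S\<close>.\<close>
        fix u v assume uv: "0 \<le> u" "u \<le> v" and pos: "\<And>r. u \<le> r \<Longrightarrow> r \<le> v \<Longrightarrow> 0 < W (\<tau> r) $ j"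
        have "0 < W r $ j" if r: "\<tau> u \<le> r" "r \<le> \<tau> v" for r
        proof -
          have r0: "0 \<le> r"
            using \<tau>[OF uv(1)] r by simp
          have "u \<le> S r" "S r \<le> v"
            using S_gap[of "\<tau> u" r] S_gap[of r "\<tau> v"] \<tau>[of u] \<tau>[of v] uv r r0 by auto
          then show ?thesis
            using pos[of "S r"] \<tau>S[OF r0] by simp
        qed
        then show "Y (\<tau> v) $ j = Y (\<tau> u) $ j"
          using \<tau>_mono[OF uv] \<tau>[of u] uv by (intro complementary_imp_constant[OF compl contW contY Y_mono]) auto
      qed
      then show ?thesis
        by (simp add: y_def)
    qed
    ultimately show "\<exists>\<sigma> y w. 0 \<le> \<sigma> \<and> (\<tau> has_real_derivative \<sigma>) (at s) \<and> w = \<sigma> *\<^sub>R \<theta> + R *v y \<and>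
      (\<forall>j. 0 \<le> y $ j \<and> ((\<lambda>s. W (\<tau> s) $ j) has_real_derivative w $ j) (at s) \<and>
        (0 < W (\<tau> s) $ j \<longrightarrow> y $ j = 0) \<and> (W (\<tau> s) $ j = 0 \<longrightarrow> w $ j = 0))"
      using w \<sigma> by (intro exI[of _ \<sigma>] exI[of _ y] exI[of _ w]) (auto simp: w_def)
  qed (use \<tau> \<tau>_lip \<tau>S S_ge W_lip N in auto)
qed

section \<open>Stability of the collapsed workload\<close>

lemma sum_dhv_class: "(\<Sum>k\<in>UNIV. f k) = f Class1 + f Class2 + f Class3 + f Class4 + f Class5 + f Class6"
  for f :: "dhv_class \<Rightarrow> real"
  by (simp add: UNIV_dhv_class)

lemma sum_dhv_station: "(\<Sum>j\<in>UNIV. f j) = f Station1 + f Station2 + f Station3"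
  for f :: "dhv_station \<Rightarrow> real"
  by (simp add: UNIV_dhv_station)

lemma all_dhv_class: "(\<forall>k. P k) \<longleftrightarrow> P Class1 \<and> P Class2 \<and> P Class3 \<and> P Class4 \<and> P Class5 \<and> P Class6"
  by (metis dhv_class.exhaust)

lemma all_dhv_station: "(\<forall>j. P j) \<longleftrightarrow> P Station1 \<and> P Station2 \<and> P Station3"
  by (metis dhv_station.exhaust)

lemma matrix_inv_inverse:
  fixes A :: "('n::finite, 'n) rmat"
  assumes "invertible A"
  shows "A ** matrix_inv A = mat 1" "matrix_inv A ** A = mat 1"
proof -
  have "A ** matrix_inv A = mat 1 \<and> matrix_inv A ** A = mat 1"
    using assms unfolding matrix_inv_def invertible_def by (rule someI_ex)
  then show "A ** matrix_inv A = mat 1" "matrix_inv A ** A = mat 1"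
    by auto
qed

lemma matrix_inv_eqI:
  fixes A B :: "('n::finite, 'n) rmat"
  assumes "A ** B = mat 1" "B ** A = mat 1"
  shows "matrix_inv A = B"
proof -
  have "invertible A"
    using assms unfolding invertible_def by blast
  then have "matrix_inv A ** (A ** B) = B"
    by (simp add: matrix_mul_assoc matrix_inv_inverse)
  then show ?thesis
    by (simp add: assms)
qed

text \<open>A job in class \<open>l\<close> passes exactly once through \<open>l\<close> and every
  later class.\<close>

lemma visit_matrix_dhv:
  "visit_matrix dhv_routing = (\<chi> k l. if class_number l \<le> class_number k then 1 else 0)"
  unfolding visit_matrix_def
  by (rule matrix_inv_eqI)
    (simp_all add: vec_eq_iff all_dhv_class matrix_matrix_mult_def sum_dhv_class dhv_routing_def transpose_def mat_def)

lemma matrix_mult_nth: "(A ** B) $ i $ j = (\<Sum>k\<in>UNIV. A $ i $ k * B $ k $ j)"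
  by (simp add: matrix_matrix_mult_def)

lemma service_matrix_nth: "(constituency s ** diag_mat m) $ j $ k = (if s k = j then m $ k else 0)"
proof -
  have "(constituency s ** diag_mat m) $ j $ k = (\<Sum>i\<in>UNIV. (if s i = j then 1 else 0) * (if i = k then m $ i else 0))"
    by (simp add: matrix_mult_nth constituency_def diag_mat_def)
  also have "\<dots> = (\<Sum>i\<in>UNIV. if i = k then (if s k = j then m $ k else 0) else 0)"
    by (intro sum.cong) auto
  finally show ?thesis
    by simp
qed

lemma ratio_matrixD:
  assumes "ratio_matrix m s \<Delta>"
  shows "0 \<le> \<Delta> $ k $ j" "s k \<noteq> j \<Longrightarrow> \<Delta> $ k $ j = 0" "(\<Sum>k | s k = j. m $ k * \<Delta> $ k $ j) = 1"
proof -
  show "0 \<le> \<Delta> $ k $ j" "s k \<noteq> j \<Longrightarrow> \<Delta> $ k $ j = 0"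
    using assms by (auto simp: ratio_matrix_def)
  have "(constituency s ** diag_mat m ** \<Delta>) $ j $ j = 1"
    using assms by (simp add: ratio_matrix_def mat_def)
  then have "(\<Sum>k\<in>UNIV. (if s k = j then m $ k else 0) * \<Delta> $ k $ j) = 1"
    by (simp only: matrix_mult_nth[of "constituency s ** diag_mat m"] service_matrix_nth)
  moreover have "(\<Sum>k\<in>UNIV. (if s k = j then m $ k else 0) * \<Delta> $ k $ j) = (\<Sum>k | s k = j. m $ k * \<Delta> $ k $ j)"
    by (intro sum.mono_neutral_cong_right) auto
  ultimately show "(\<Sum>k | s k = j. m $ k * \<Delta> $ k $ j) = 1"
    by simp
qed

text \<open>The minors of the workload matrix are linear in the pair of ratios of each station
  involved, and no such pair is zero; positivity is thereby reduced to the coefficients of the pure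
  products.\<close>

lemma mixture_pos:
  fixes u v p q :: real
  assumes "0 \<le> u" "0 \<le> v" "u \<noteq> 0 \<or> v \<noteq> 0" "0 < p" "0 < q"
  shows "0 < u * p + v * q"
  using assms by (cases "u = 0") (auto intro: add_pos_nonneg)

lemma cramer3:
  fixes w1 w2 w3 :: real
  assumes "g11 * w1 + g12 * w2 + g13 * w3 = v1" "g21 * w1 + g22 * w2 + g23 * w3 = v2"
    "g31 * w1 + g32 * w2 + g33 * w3 = v3"
  shows "(g11 * (g22 * g33 - g23 * g32) - g12 * (g21 * g33 - g23 * g31) + g13 * (g21 * g32 - g22 * g31)) * w1 =
      v1 * (g22 * g33 - g23 * g32) - g12 * (v2 * g33 - g23 * v3) + g13 * (v2 * g32 - g22 * v3)"
  unfolding assms[symmetric] by algebra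

lemma cramer2:
  fixes w1 w2 :: real
  assumes "g11 * w1 + g12 * w2 = v1" "g21 * w1 + g22 * w2 = v2"
  shows "(g11 * g22 - g12 * g21) * w1 = v1 * g22 - g12 * v2"
  unfolding assms[symmetric] by algebra

locale dhv_workload =
  fixes m1 m2 m3 m4 m5 m6 \<delta>1 \<delta>2 \<delta>3 \<delta>4 \<delta>5 \<delta>6 :: real
  assumes pos: "0 < m1" "0 < m2" "0 < m3" "0 < m4" "0 < m5" "0 < m6"
    and unit: "m1 + m4 = 1" "m2 + m5 = 1" "m3 + m6 = 1"
    and \<delta>_nonneg: "0 \<le> \<delta>1" "0 \<le> \<delta>2" "0 \<le> \<delta>3" "0 \<le> \<delta>4" "0 \<le> \<delta>5" "0 \<le> \<delta>6"
    and \<delta>_unit: "m1 * \<delta>1 + m4 * \<delta>4 = 1" "m2 * \<delta>2 + m5 * \<delta>5 = 1" "m3 * \<delta>3 + m6 * \<delta>6 = 1"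
begin

text \<open>Entries of C M Q \<Delta>. Both visits of a job to a station cost 1 in total, whence the
  coefficient 1 for a class with both visits ahead; with only the second visit ahead it is the
  service time of the high class.\<close>

definition "g11 = \<delta>1 + m4 * \<delta>4"
definition "g12 = m4 * \<delta>2"
definition "g13 = m4 * \<delta>3"
definition "g21 = \<delta>1 + m5 * \<delta>4"
definition "g22 = \<delta>2 + m5 * \<delta>5"
definition "g23 = m5 * \<delta>3"
definition "g31 = \<delta>1 + m6 * \<delta>4"
definition "g32 = \<delta>2 + m6 * \<delta>5"
definition "g33 = \<delta>3 + m6 * \<delta>6"

lemmas g_defs = g11_def g12_def g13_def g21_def g22_def g23_def g31_def g32_def g33_def

lemma \<delta>_ne: "\<delta>1 \<noteq> 0 \<or> \<delta>4 \<noteq> 0" "\<delta>2 \<noteq> 0 \<or> \<delta>5 \<noteq> 0" "\<delta>3 \<noteq> 0 \<or> \<delta>6 \<noteq> 0"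
  using \<delta>_unit by auto

lemmas mix1 = mixture_pos[OF \<delta>_nonneg(1,4) \<delta>_ne(1)]
  and mix2 = mixture_pos[OF \<delta>_nonneg(2,5) \<delta>_ne(2)]
  and mix3 = mixture_pos[OF \<delta>_nonneg(3,6) \<delta>_ne(3)]

lemma service_low: "m1 = 1 - m4" "m2 = 1 - m5" "m3 = 1 - m6"
  using unit by auto

lemma g_pos: "0 < g11" "0 < g22" "0 < g33" "0 < g22 - g12" "0 < g33 - g13" "0 < g33 - g23"
  using mix1[of 1 m4] mix2[of 1 m5] mix3[of 1 m6] mix2[of m1 m5] mix3[of m1 m6] mix3[of m2 m6] pos
  unfolding g_defs service_low by (simp_all add: algebra_simps)

lemma minor12_pos: "0 < g11 * g22 - g12 * g21"
proof -
  have "0 < \<delta>1 * (\<delta>2 * m1 + \<delta>5 * m5) + \<delta>4 * (\<delta>2 * (m4 * m2) + \<delta>5 * (m4 * m5))"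
    using pos by (intro mix1 mix2) auto
  then show ?thesis
    unfolding g_defs service_low by (simp add: algebra_simps)
qed

lemma minor13_pos: "0 < g11 * g33 - g13 * g31"
proof -
  have "0 < \<delta>1 * (\<delta>3 * m1 + \<delta>6 * m6) + \<delta>4 * (\<delta>3 * (m4 * m3) + \<delta>6 * (m4 * m6))"
    using pos by (intro mix1 mix3) auto
  then show ?thesis
    unfolding g_defs service_low by (simp add: algebra_simps)
qed

lemma minor23_pos: "0 < g22 * g33 - g23 * g32"
proof -
  have "0 < \<delta>2 * (\<delta>3 * m2 + \<delta>6 * m6) + \<delta>5 * (\<delta>3 * (m5 * m3) + \<delta>6 * (m5 * m6))"
    using pos by (intro mix2 mix3) auto
  then show ?thesis
    unfolding g_defs service_low by (simp add: algebra_simps)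
qed

text \<open>The determinant with its first column replaced by ones: Cramer's numerator for
  \<open>w1\<close> under equal drifts, up to the factor - \<sigma>.\<close>

definition "nominal_minor = (g22 * g33 - g23 * g32) - g12 * (g33 - g23) + g13 * (g32 - g22)"

lemma nominal_minor_pos: "0 < nominal_minor"
proof -
  \<comment> \<open>The coefficients of the expansion are products of service times, except that of
    \<delta>5 * \<delta>3; this identity writes it as a sum of such products.\<close>
  have "0 < m5 * m1 * m3 + m2 * m4 * m6"
    using pos by (intro add_pos_pos mult_pos_pos)
  then have K: "0 < m5 * (1 - m6 - m4) + m4 * m6"
    unfolding service_low by (simp add: algebra_simps)
  have "0 < \<delta>2 * (\<delta>3 * (m1 * m2) + \<delta>6 * (m1 * m6)) +
      \<delta>5 * (\<delta>3 * (m5 * (1 - m6 - m4) + m4 * m6) + \<delta>6 * (m5 * m6))"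
    using pos K by (intro mix2 mix3) auto
  then show ?thesis
    unfolding g_defs service_low nominal_minor_def by (simp add: algebra_simps)
qed

definition "determinant = g11 * (g22 * g33 - g23 * g32) - g12 * (g21 * g33 - g23 * g31) + g13 * (g21 * g32 - g22 * g31)"

text \<open>The first column is \<delta>1 times the column of ones plus \<delta>4 times (m4, m5,
  m6); the first part contributes \<open>nominal_minor\<close>.\<close>

lemma determinant_pos: "0 < determinant"
proof -
  have "0 < \<delta>1 * nominal_minor + \<delta>4 * (\<delta>2 * (\<delta>3 * (m4 * m2 * m3) + \<delta>6 * (m4 * m2 * m6)) +
      \<delta>5 * (\<delta>3 * (m4 * m5 * m3) + \<delta>6 * (m4 * m5 * m6)))"
    using pos by (intro mix1 mix2 mix3 nominal_minor_pos mult_pos_pos)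
  then show ?thesis
    unfolding g_defs service_low nominal_minor_def determinant_def by (simp add: algebra_simps)
qed

text \<open>One quotient for each choice of those among stations 2 and 3 whose workload is
  momentarily constant: the values of - w1 / \<sigma> by Cramer's rule.\<close>

definition "rate1 = Min {1 / g11, (g22 - g12) / (g11 * g22 - g12 * g21), (g33 - g13) / (g11 * g33 - g13 * g31),
    nominal_minor / determinant}"

definition "rate2 = min (1 / g22) ((g33 - g23) / (g22 * g33 - g23 * g32))"

lemma rates_pos: "0 < rate1" "0 < rate2"
  using g_pos minor12_pos minor13_pos minor23_pos nominal_minor_pos determinant_pos
  by (simp_all add: rate1_def rate2_def)

text \<open>
  \<open>w\<close> is the rate of change of the station workloads while the weighted workloads \<open>G w\<close> have
  downward drift \<open>\<sigma>\<close>, compensated by the pushing rates \<open>y\<close> at idle stations.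
\<close>

context
  fixes w1 w2 w3 y1 y2 y3 \<sigma> :: real
  assumes drift: "g11 * w1 + g12 * w2 + g13 * w3 = y1 - \<sigma>" "g21 * w1 + g22 * w2 + g23 * w3 = y2 - \<sigma>"
      "g31 * w1 + g32 * w2 + g33 * w3 = y3 - \<sigma>"
    and idle: "y2 = 0 \<or> w2 = 0" "y3 = 0 \<or> w3 = 0"
    and \<sigma>: "0 \<le> \<sigma>"
begin

text \<open>Where \<open>w2\<close> or \<open>w3\<close> is nonzero its pushing rate vanishes and
  its row is kept; where it is zero, its row and column are dropped. What remains is a square system
  with equal right-hand sides.\<close>

lemma workload1_rate:
  assumes "y1 = 0"
  shows "w1 \<le> - rate1 * \<sigma>"
proof -
  have "\<exists>r. w1 = - r * \<sigma> \<and> rate1 \<le> r"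
  proof (cases "w2 = 0"; cases "w3 = 0")
    assume "w2 = 0" "w3 = 0"
    then have "w1 = - (1 / g11) * \<sigma>"
      using drift(1) assms g_pos by (simp add: field_simps)
    then show ?thesis
      by (intro exI[of _ "1 / g11"]) (simp add: rate1_def)
  next
    assume w: "w2 = 0" "w3 \<noteq> 0"
    then have "(g11 * g33 - g13 * g31) * w1 = (0 - \<sigma>) * g33 - g13 * (0 - \<sigma>)"
      using drift(1,3) assms idle by (intro cramer2[of _ _ _ w3]) auto
    then have "w1 = - ((g33 - g13) / (g11 * g33 - g13 * g31)) * \<sigma>"
      using minor13_pos by (simp add: field_simps)
    then show ?thesis
      by (intro exI[of _ "(g33 - g13) / (g11 * g33 - g13 * g31)"]) (simp add: rate1_def)
  next
    assume w: "w2 \<noteq> 0" "w3 = 0"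
    then have "(g11 * g22 - g12 * g21) * w1 = (0 - \<sigma>) * g22 - g12 * (0 - \<sigma>)"
      using drift(1,2) assms idle by (intro cramer2[of _ _ _ w2]) auto
    then have "w1 = - ((g22 - g12) / (g11 * g22 - g12 * g21)) * \<sigma>"
      using minor12_pos by (simp add: field_simps)
    then show ?thesis
      by (intro exI[of _ "(g22 - g12) / (g11 * g22 - g12 * g21)"]) (simp add: rate1_def)
  next
    assume w: "w2 \<noteq> 0" "w3 \<noteq> 0"
    then have "determinant * w1 =
        (0 - \<sigma>) * (g22 * g33 - g23 * g32) - g12 * ((0 - \<sigma>) * g33 - g23 * (0 - \<sigma>)) +
        g13 * ((0 - \<sigma>) * g32 - g22 * (0 - \<sigma>))"
      unfolding determinant_def using drift assms idle by (intro cramer3[of _ _ _ w2 _ w3]) auto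
    also have "\<dots> = - nominal_minor * \<sigma>"
      by (simp add: nominal_minor_def algebra_simps)
    finally have "w1 = - (nominal_minor / determinant) * \<sigma>"
      using determinant_pos by (simp add: field_simps)
    then show ?thesis
      by (intro exI[of _ "nominal_minor / determinant"]) (simp add: rate1_def)
  qed
  then obtain r where r: "w1 = - r * \<sigma>" "rate1 \<le> r"
    by blast
  then show ?thesis
    using mult_right_mono[OF r(2) \<sigma>] by simp
qed

lemma workload2_rate:
  assumes "w1 = 0" "y2 = 0"
  shows "w2 \<le> - rate2 * \<sigma>"
proof -
  have "\<exists>r. w2 = - r * \<sigma> \<and> rate2 \<le> r"
  proof (cases "w3 = 0")
    case True
    then have "w2 = - (1 / g22) * \<sigma>"
      using drift(2) assms g_pos by (simp add: field_simps)
    then show ?thesis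
      by (intro exI[of _ "1 / g22"]) (simp add: rate2_def)
  next
    case False
    then have "(g22 * g33 - g23 * g32) * w2 = (0 - \<sigma>) * g33 - g23 * (0 - \<sigma>)"
      using drift(2,3) assms idle by (intro cramer2[of _ _ _ w3]) auto
    then have "w2 = - ((g33 - g23) / (g22 * g33 - g23 * g32)) * \<sigma>"
      using minor23_pos by (simp add: field_simps)
    then show ?thesis
      by (intro exI[of _ "(g33 - g23) / (g22 * g33 - g23 * g32)"]) (simp add: rate2_def)
  qed
  then obtain r where r: "w2 = - r * \<sigma>" "rate2 \<le> r"
    by blast
  then show ?thesis
    using mult_right_mono[OF r(2) \<sigma>] by simp
qed

lemma workload3_rate:
  assumes "w1 = 0" "w2 = 0" "y3 = 0"
  shows "w3 \<le> - (1 / g33) * \<sigma>"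
  using drift(3) assms g_pos by (simp add: field_simps)

end

end

locale dhv_ratio =
  fixes m :: "real^dhv_class" and \<Delta> :: "real^dhv_station^dhv_class"
  assumes m_pos: "0 < m $ k"
    and m_unit: "m $ Class1 + m $ Class4 = 1" "m $ Class2 + m $ Class5 = 1" "m $ Class3 + m $ Class6 = 1"
    and ratio: "ratio_matrix m dhv_server \<Delta>"
begin

lemma \<Delta>_unit:
  "m $ Class1 * \<Delta> $ Class1 $ Station1 + m $ Class4 * \<Delta> $ Class4 $ Station1 = 1"
  "m $ Class2 * \<Delta> $ Class2 $ Station2 + m $ Class5 * \<Delta> $ Class5 $ Station2 = 1"
  "m $ Class3 * \<Delta> $ Class3 $ Station3 + m $ Class6 * \<Delta> $ Class6 $ Station3 = 1"
proof -
  have "{k. dhv_server k = Station1} = {Class1, Class4}" "{k. dhv_server k = Station2} = {Class2, Class5}"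
      "{k. dhv_server k = Station3} = {Class3, Class6}"
    by (auto elim: dhv_class.exhaust simp: set_eq_iff all_dhv_class)
  then show
    "m $ Class1 * \<Delta> $ Class1 $ Station1 + m $ Class4 * \<Delta> $ Class4 $ Station1 = 1"
    "m $ Class2 * \<Delta> $ Class2 $ Station2 + m $ Class5 * \<Delta> $ Class5 $ Station2 = 1"
    "m $ Class3 * \<Delta> $ Class3 $ Station3 + m $ Class6 * \<Delta> $ Class6 $ Station3 = 1"
    using ratio_matrixD(3)[OF ratio, of Station1] ratio_matrixD(3)[OF ratio, of Station2]
      ratio_matrixD(3)[OF ratio, of Station3] by simp_all
qed

sublocale dhv_workload "m $ Class1" "m $ Class2" "m $ Class3" "m $ Class4" "m $ Class5" "m $ Class6"
  "\<Delta> $ Class1 $ Station1" "\<Delta> $ Class2 $ Station2" "\<Delta> $ Class3 $ Station3"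
  "\<Delta> $ Class4 $ Station1" "\<Delta> $ Class5 $ Station2" "\<Delta> $ Class6 $ Station3"
  by unfold_locales (use m_pos m_unit ratio_matrixD(1)[OF ratio] \<Delta>_unit in auto)

abbreviation "G \<equiv> total_workload_matrix dhv_routing m dhv_server \<Delta>"

lemma total_workload_mult:
  "(G *v w) $ Station1 = g11 * w $ Station1 + g12 * w $ Station2 + g13 * w $ Station3"
  "(G *v w) $ Station2 = g21 * w $ Station1 + g22 * w $ Station2 + g23 * w $ Station3"
  "(G *v w) $ Station3 = g31 * w $ Station1 + g32 * w $ Station2 + g33 * w $ Station3"
proof -
  have entry: "G $ j $ i = (\<Sum>l\<in>UNIV. (\<Sum>k\<in>UNIV. (if dhv_server k = j then m $ k else 0) *
      (if class_number l \<le> class_number k then 1 else 0)) * \<Delta> $ l $ i)" for i j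
    by (simp only: total_workload_matrix_def visit_matrix_dhv matrix_mult_nth[of "_ ** (_ :: ('a::finite, 'b::finite) rmat)"]
        matrix_mult_nth[of "constituency _ ** _"] service_matrix_nth vec_lambda_beta)
  show
    "(G *v w) $ Station1 = g11 * w $ Station1 + g12 * w $ Station2 + g13 * w $ Station3"
    "(G *v w) $ Station2 = g21 * w $ Station1 + g22 * w $ Station2 + g23 * w $ Station3"
    "(G *v w) $ Station3 = g31 * w $ Station1 + g32 * w $ Station2 + g33 * w $ Station3"
    by (simp_all add: matrix_vector_mult_def entry sum_dhv_class sum_dhv_station g_defs service_low
        ratio_matrixD(2)[OF ratio])
qed

lemma invertible_total_workload: "invertible G"
proof -
  have "w = 0" if w: "G *v w = 0" for w
  proof -
    have eq: "g11 * w $ Station1 + g12 * w $ Station2 + g13 * w $ Station3 = 0"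
      "g21 * w $ Station1 + g22 * w $ Station2 + g23 * w $ Station3 = 0"
      "g31 * w $ Station1 + g32 * w $ Station2 + g33 * w $ Station3 = 0"
      unfolding total_workload_mult[symmetric] w by simp_all
    have "determinant * w $ Station1 = 0"
      using cramer3[OF eq] by (simp add: determinant_def)
    then have w1: "w $ Station1 = 0"
      using determinant_pos by simp
    have "(g22 * g33 - g23 * g32) * w $ Station2 = 0"
      using cramer2[of g22 "w $ Station2" g23 "w $ Station3" 0 g32 g33 0] eq w1 by simp
    then have w2: "w $ Station2 = 0"
      using minor23_pos by simp
    have "w $ Station3 = 0"
      using eq w1 w2 g_pos by simp
    with w1 w2 show ?thesis
      by (simp add: vec_eq_iff all_dhv_station)
  qed
  then show ?thesis
    by (simp add: invertible_left_inverse matrix_left_invertible_ker)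
qed

text \<open>Workload decays in proportion to physical time, not to intrinsic time: during pure
  pushing \<sigma> = 0 and no decrease is guaranteed. Hence \<open>\<tau>\<close> as the clock in
  \<open>nonneg_extinct\<close>.\<close>

lemma skorohod_stable_dhv:
  assumes "\<alpha> < 1" and \<rho>: "\<And>j. traffic_intensity (dhv_arrivals \<alpha>) dhv_routing m dhv_server $ j = \<alpha>"
  shows "skorohod_stable (reflection_matrix dhv_routing m dhv_server \<Delta>) (drift_vector (dhv_arrivals \<alpha>) dhv_routing m dhv_server \<Delta>)"
  unfolding skorohod_stable_def
proof (intro allI impI)
  let ?R = "reflection_matrix dhv_routing m dhv_server \<Delta>"
  let ?\<theta> = "drift_vector (dhv_arrivals \<alpha>) dhv_routing m dhv_server \<Delta>"
  fix Y W assume sp: "skorohod_solution ?R ?\<theta> Y W"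
  have W_nonneg: "0 \<le> W t $ j" if "0 \<le> t" for t j
    using sp that unfolding skorohod_solution_def by blast
  have GR: "G ** ?R = mat 1"
    unfolding reflection_matrix_def using invertible_total_workload by (rule matrix_inv_inverse)
  from sp show "\<exists>T\<ge>0. \<forall>t\<ge>T. W t = 0"
  proof (rule skorohod_time_change)
    fix \<tau> S N L
    assume \<tau>: "\<And>s. 0 \<le> s \<Longrightarrow> 0 \<le> \<tau> s" "1-lipschitz_on {0..} \<tau>"
      and \<tau>S: "\<And>t. 0 \<le> t \<Longrightarrow> \<tau> (S t) = t" "\<And>t. 0 \<le> t \<Longrightarrow> t \<le> S t"
      and lip: "\<And>j. L-lipschitz_on {0..} (\<lambda>s. W (\<tau> s) $ j)" and N: "negligible N"
      and rates: "\<And>s. 0 < s \<Longrightarrow> s \<notin> N \<Longrightarrow> \<exists>\<sigma> y w. 0 \<le> \<sigma> \<and> (\<tau> has_real_derivative \<sigma>) (at s) \<and> w = \<sigma> *\<^sub>R ?\<theta> + ?R *v y \<and>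
        (\<forall>j. 0 \<le> y $ j \<and> ((\<lambda>s. W (\<tau> s) $ j) has_real_derivative w $ j) (at s) \<and>
          (0 < W (\<tau> s) $ j \<longrightarrow> y $ j = 0) \<and> (W (\<tau> s) $ j = 0 \<longrightarrow> w $ j = 0))"
    have decay: "\<exists>\<sigma> w. 0 \<le> \<sigma> \<and> (\<tau> has_real_derivative \<sigma>) (at s) \<and>
        (\<forall>j. ((\<lambda>s. W (\<tau> s) $ j) has_real_derivative w $ j) (at s)) \<and>
        (0 < W (\<tau> s) $ Station1 \<longrightarrow> w $ Station1 \<le> - (rate1 * (1 - \<alpha>)) * \<sigma>) \<and>
        (W (\<tau> s) $ Station1 = 0 \<longrightarrow> 0 < W (\<tau> s) $ Station2 \<longrightarrow> w $ Station2 \<le> - (rate2 * (1 - \<alpha>)) * \<sigma>) \<and>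
        (W (\<tau> s) $ Station1 = 0 \<longrightarrow> W (\<tau> s) $ Station2 = 0 \<longrightarrow> 0 < W (\<tau> s) $ Station3 \<longrightarrow>
          w $ Station3 \<le> - (1 / g33 * (1 - \<alpha>)) * \<sigma>)"
      if s: "0 < s" "s \<notin> N" for s
    proof -
      obtain \<sigma> y w where *: "0 \<le> \<sigma>" "(\<tau> has_real_derivative \<sigma>) (at s)" "w = \<sigma> *\<^sub>R ?\<theta> + ?R *v y"
        "\<And>j. ((\<lambda>s. W (\<tau> s) $ j) has_real_derivative w $ j) (at s)"
        "\<And>j. 0 < W (\<tau> s) $ j \<longrightarrow> y $ j = 0" "\<And>j. W (\<tau> s) $ j = 0 \<longrightarrow> w $ j = 0"
        using rates[OF s] by blast
      \<comment> \<open>Multiplication by \<open>G\<close> undoes the reflection matrix and turns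
        the drift into the common value \<alpha> - 1 at all stations.\<close>
      have "G *v w = \<sigma> *\<^sub>R (G *v ?\<theta>) + (G ** ?R) *v y"
        by (simp add: *(3) matrix_vector_right_distrib matrix_vector_mul_assoc matrix_vector_mult_scaleR)
      also have "G *v ?\<theta> = (G ** ?R) *v (traffic_intensity (dhv_arrivals \<alpha>) dhv_routing m dhv_server - 1)"
        by (simp add: drift_vector_def matrix_vector_mul_assoc)
      finally have Gw: "G *v w = \<sigma> *\<^sub>R (mat 1 *v (traffic_intensity (dhv_arrivals \<alpha>) dhv_routing m dhv_server - 1)) + mat 1 *v y"
        unfolding GR .
      have "(G *v w) $ j = y $ j - (1 - \<alpha>) * \<sigma>" for j
        unfolding Gw by (simp add: \<rho> algebra_simps)
      then have drift: "g11 * w $ Station1 + g12 * w $ Station2 + g13 * w $ Station3 = y $ Station1 - (1 - \<alpha>) * \<sigma>"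
        "g21 * w $ Station1 + g22 * w $ Station2 + g23 * w $ Station3 = y $ Station2 - (1 - \<alpha>) * \<sigma>"
        "g31 * w $ Station1 + g32 * w $ Station2 + g33 * w $ Station3 = y $ Station3 - (1 - \<alpha>) * \<sigma>"
        using total_workload_mult[of w] by simp_all
      have idle: "y $ j = 0 \<or> w $ j = 0" for j
        using *(5)[of j] *(6)[of j] W_nonneg[OF \<tau>(1)[of s], of j] s by (auto simp: less_le)
      have \<sigma>: "0 \<le> (1 - \<alpha>) * \<sigma>"
        using *(1) \<open>\<alpha> < 1\<close> by simp
      show ?thesis
        using workload1_rate[OF drift idle idle \<sigma>] workload2_rate[OF drift idle idle \<sigma>]
          workload3_rate[OF drift idle idle \<sigma>] *(1,2,4,5,6)
        by (intro exI[of _ \<sigma>] exI[of _ w]) (simp add: mult.assoc)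
    qed
    \<comment> \<open>\<open>\<tau>\<close> takes every nonnegative value, at the intrinsic times
      given by \<open>S\<close>.\<close>
    have unbounded: "\<exists>t\<ge>a. K < \<tau> t" for a K
      using \<tau>S[of "max a (max 0 (K + 1))"] by (intro exI[of _ "S (max a (max 0 (K + 1)))"]) auto
    have sub: "L-lipschitz_on {a..} (\<lambda>s. W (\<tau> s) $ j)" "1-lipschitz_on {a..} \<tau>" if "0 \<le> a" for a j
      using that by (auto intro: lipschitz_on_subset[OF lip] lipschitz_on_subset[OF \<tau>(2)])
    obtain s1 where s1: "0 \<le> s1" "\<And>s. s1 \<le> s \<Longrightarrow> W (\<tau> s) $ Station1 = 0"
    proof (rule nonneg_extinct[OF sub[of 0] _ N _ _ unbounded, where \<kappa> = "rate1 * (1 - \<alpha>)"])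
      fix s assume s: "0 < s" "s \<notin> N" "0 < W (\<tau> s) $ Station1"
      then show "\<exists>D E. ((\<lambda>s. W (\<tau> s) $ Station1) has_real_derivative D) (at s) \<and> (\<tau> has_real_derivative E) (at s) \<and>
          0 \<le> E \<and> D \<le> - (rate1 * (1 - \<alpha>)) * E"
        using decay[OF s(1,2)] by blast
    qed (use W_nonneg \<tau> rates_pos \<open>\<alpha> < 1\<close> in auto)
    obtain s2 where s2: "s1 \<le> s2" "\<And>s. s2 \<le> s \<Longrightarrow> W (\<tau> s) $ Station2 = 0"
    proof (rule nonneg_extinct[OF sub[OF s1(1)] _ N _ _ unbounded, where \<kappa> = "rate2 * (1 - \<alpha>)"])
      fix s assume s: "s1 < s" "s \<notin> N" "0 < W (\<tau> s) $ Station2"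
      then show "\<exists>D E. ((\<lambda>s. W (\<tau> s) $ Station2) has_real_derivative D) (at s) \<and> (\<tau> has_real_derivative E) (at s) \<and>
          0 \<le> E \<and> D \<le> - (rate2 * (1 - \<alpha>)) * E"
        using decay[OF order.strict_trans1[OF s1(1) s(1)] s(2)] s1(2)[OF less_imp_le[OF s(1)]] by blast
    qed (use W_nonneg \<tau> rates_pos s1 \<open>\<alpha> < 1\<close> in auto)
    have s2_nonneg: "0 \<le> s2"
      using s1 s2 by simp
    obtain s3 where s3: "s2 \<le> s3" "\<And>s. s3 \<le> s \<Longrightarrow> W (\<tau> s) $ Station3 = 0"
    proof (rule nonneg_extinct[OF sub[OF s2_nonneg] _ N _ _ unbounded, where \<kappa> = "1 / g33 * (1 - \<alpha>)"])
      fix s assume s: "s2 < s" "s \<notin> N" "0 < W (\<tau> s) $ Station3"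
      then show "\<exists>D E. ((\<lambda>s. W (\<tau> s) $ Station3) has_real_derivative D) (at s) \<and> (\<tau> has_real_derivative E) (at s) \<and>
          0 \<le> E \<and> D \<le> - (1 / g33 * (1 - \<alpha>)) * E"
        using decay[OF order.strict_trans1[OF s2_nonneg s(1)] s(2)] s1(2)[OF order.trans[OF s2(1) less_imp_le[OF s(1)]]] s2(2)[OF less_imp_le[OF s(1)]] by blast
    qed (use W_nonneg \<tau> g_pos s2_nonneg \<open>\<alpha> < 1\<close> in auto)
    have s3_nonneg: "0 \<le> s3"
      using s2_nonneg s3 by simp
    have "W t = 0" if "s3 \<le> t" for t
    proof -
      \<comment> \<open>Back to physical time: as t \<le> S t, the intrinsic time of
        \<open>t\<close> is past \<open>s3\<close>.\<close>
      have t: "0 \<le> t" "s3 \<le> S t"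
        using s3_nonneg that \<tau>S(2)[of t] by auto
      have "W (\<tau> (S t)) $ j = 0" for j
        using t s1(2)[of "S t"] s2 s3 by (cases j) auto
      then show ?thesis
        using \<tau>S(1)[OF t(1)] by (simp add: vec_eq_iff)
    qed
    with s3_nonneg show ?thesis
      by blast
  qed
qed

end

section \<open>Deviations of a fluid solution\<close>

lemma has_vector_derivative_vecI:
  fixes f :: "real \<Rightarrow> real^'n::finite"
  assumes "\<And>i. ((\<lambda>t. f t $ i) has_real_derivative f' $ i) (at t)"
  shows "(f has_vector_derivative f') (at t)"
  unfolding has_vector_derivative_def
proof (subst has_derivative_componentwise_within, rule ballI)
  fix b :: "real^'n" assume "b \<in> Basis"
  then obtain i where b: "b = axis i 1"
    by (auto simp: Basis_vec_def)
  show "((\<lambda>x. f x \<bullet> b) has_derivative (\<lambda>h. h *\<^sub>R f' \<bullet> b)) (at t)"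
    using assms[of i] by (simp add: b inner_axis has_field_derivative_def mult.commute[of _ "f' $ i"])
qed

lemma has_vector_derivative_vecD:
  fixes f :: "real \<Rightarrow> real^'n::finite"
  assumes "(f has_vector_derivative f') (at t)"
  shows "((\<lambda>t. f t $ i) has_real_derivative f' $ i) (at t)"
  using bounded_linear.has_vector_derivative[OF bounded_linear_vec_nth assms]
  by (simp add: has_real_derivative_iff_has_vector_derivative)

lemma lipschitz_on_scaled_component:
  fixes f :: "real \<Rightarrow> real^'n::finite"
  assumes "L-lipschitz_on S f" "0 \<le> c" "c \<le> 1"
  shows "L-lipschitz_on S (\<lambda>t. c * f t $ i)"
proof (rule lipschitz_onI)
  show "dist (c * f x $ i) (c * f y $ i) \<le> L * dist x y" if "x \<in> S" "y \<in> S" for x y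
  proof -
    have "dist (c * f x $ i) (c * f y $ i) = c * dist (f x $ i) (f y $ i)"
      using assms by (simp add: dist_real_def abs_mult flip: right_diff_distrib)
    also have "\<dots> \<le> 1 * dist (f x) (f y)"
      using assms by (intro mult_mono dist_vec_nth_le) auto
    also have "\<dots> \<le> L * dist x y"
      using lipschitz_onD[OF assms(1) that] by simp
    finally show ?thesis .
  qed
qed (rule lipschitz_on_nonneg[OF assms(1)])

lemma fluid_solutionD:
  assumes "fluid_solution \<alpha> P m s \<Delta> Z W \<epsilon> T Y"
  shows "\<exists>L. L-lipschitz_on {0..} Z" "\<exists>L. L-lipschitz_on {0..} W" "\<exists>L. L-lipschitz_on {0..} \<epsilon>"
    "\<exists>L. L-lipschitz_on {0..} T" "\<exists>L. L-lipschitz_on {0..} Y"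
    "0 \<le> t \<Longrightarrow> Z t = Z 0 + t *\<^sub>R \<alpha> - ((mat 1 - transpose P) ** matrix_inv (diag_mat m)) *v T t"
    "0 \<le> t \<Longrightarrow> 0 \<le> Z t $ k"
    "0 \<le> t \<Longrightarrow> W t = (constituency s ** diag_mat m) *v Z t"
    "0 \<le> t \<Longrightarrow> \<epsilon> t = Z t - \<Delta> *v W t"
    "mono_on {0..} (\<lambda>t. T t $ k)"
    "0 \<le> t \<Longrightarrow> Y t = t *\<^sub>R 1 - constituency s *v T t"
    "mono_on {0..} (\<lambda>t. Y t $ j)" "complementary (\<lambda>t. W t $ j) (\<lambda>t. Y t $ j)"
    "0 < t \<Longrightarrow> (T has_vector_derivative T') (at t) \<Longrightarrow>
      priority_sum s (\<epsilon> t) (\<epsilon> t) k * (1 - priority_sum s (\<epsilon> t) T' k) = 0"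
  using assms unfolding fluid_solution_def by - (elim conjE, meson)+

text \<open>C M \<Delta> = I makes the scaled deviations of the two classes opposite, so a station
  has a single deviation coordinate, and a nonzero value singles out the class that must receive the
  whole server. \<open>not_simple_zero\<close> sets aside the countably many times at which the
  deviation crosses 0 with nonzero slope.\<close>

lemma two_class_station_rates:
  fixes m :: "'k::{finite,linorder} rvec" and s :: "'k \<Rightarrow> 'j::finite"
  assumes fs: "fluid_solution \<alpha> P m s \<Delta> Z W \<epsilon> T Y" and ratio: "ratio_matrix m s \<Delta>"
    and m_pos: "\<And>k. 0 < m $ k" and kl: "k < l" "{i. s i = j} = {k, l}"
    and t: "0 < t" and T': "(T has_vector_derivative T') (at t)"
    and DZ: "((\<lambda>t. Z t $ k) has_real_derivative p - T' $ k / m $ k) (at t)"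
      "((\<lambda>t. Z t $ l) has_real_derivative q - T' $ l / m $ l) (at t)"
    and not_simple_zero: "\<forall>D. m $ l * \<epsilon> t $ l = 0 \<longrightarrow> ((\<lambda>t. m $ l * \<epsilon> t $ l) has_real_derivative D) (at t) \<longrightarrow> D = 0"
  shows "\<exists>D. station_rates (m $ k) (m $ l) (m $ l * \<Delta> $ l $ j) p q (T' $ k / m $ k) (T' $ l / m $ l) (m $ l * \<epsilon> t $ l) D \<and>
    ((\<lambda>t. m $ l * \<epsilon> t $ l) has_real_derivative D) (at t)"
proof -
  note F = fluid_solutionD[OF fs]
  define a where "a = m $ l * \<Delta> $ l $ j"
  have "k \<noteq> l"
    using kl(1) by simp
  have s: "s i = j \<longleftrightarrow> i = k \<or> i = l" for i
    using kl(2) by auto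
  then have sj: "s k = j" "s l = j"
    by auto
  have sum_station: "(\<Sum>i\<in>UNIV. (if s i = j then f i else 0)) = f k + f l" for f :: "'k \<Rightarrow> real"
  proof -
    have "(\<Sum>i\<in>UNIV. (if s i = j then f i else 0)) = (\<Sum>i | s i = j. f i)"
      by (intro sum.mono_neutral_cong_right) auto
    then show ?thesis
      using kl(2) \<open>k \<noteq> l\<close> by simp
  qed
  have a: "m $ k * \<Delta> $ k $ j = 1 - a" "0 \<le> a" "0 \<le> 1 - a"
  proof -
    have "m $ k * \<Delta> $ k $ j + m $ l * \<Delta> $ l $ j = 1"
      using ratio_matrixD(3)[OF ratio, of j] kl(2) \<open>k \<noteq> l\<close> by simp
    moreover have "0 \<le> m $ i * \<Delta> $ i $ j" for i
      using m_pos[of i] ratio_matrixD(1)[OF ratio, of i j] by simp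
    from this[of k] this[of l] calculation
    show "m $ k * \<Delta> $ k $ j = 1 - a" "0 \<le> a" "0 \<le> 1 - a"
      by (simp_all add: a_def)
  qed
  have W: "W t $ j = m $ k * Z t $ k + m $ l * Z t $ l" if "0 \<le> t" for t
  proof -
    have "W t $ j = (\<Sum>i\<in>UNIV. (if s i = j then m $ i * Z t $ i else 0))"
      unfolding F(8)[OF that] matrix_vector_mult_def by (auto simp: service_matrix_nth intro!: sum.cong)
    then show ?thesis
      by (simp add: sum_station)
  qed
  have \<epsilon>: "\<epsilon> t $ i = Z t $ i - \<Delta> $ i $ j * W t $ j" if "0 \<le> t" "s i = j" for t i
  proof -
    have "(\<Delta> *v W t) $ i = (\<Sum>j'\<in>UNIV. \<Delta> $ i $ j' * W t $ j')"
      by (simp add: matrix_vector_mult_def)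
    also have "\<dots> = (\<Sum>j'\<in>UNIV. if j' = j then \<Delta> $ i $ j * W t $ j else 0)"
      using ratio_matrixD(2)[OF ratio, of i] that by (intro sum.cong) auto
    finally show ?thesis
      using F(9)[OF that(1)] by simp
  qed
  have dev_l: "m $ l * \<epsilon> t $ l = (1 - a) * (m $ l * Z t $ l) - a * (m $ k * Z t $ k)" if "0 \<le> t" for t
  proof -
    have *: "\<epsilon> t $ l = Z t $ l - \<Delta> $ l $ j * (m $ k * Z t $ k + m $ l * Z t $ l)"
      using \<epsilon>[OF that, of l] W[OF that] s by simp
    show ?thesis
      unfolding * a_def by (simp add: algebra_simps)
  qed
  have dev_k: "m $ k * \<epsilon> t $ k = - (m $ l * \<epsilon> t $ l)" if "0 \<le> t" for t
  proof -
    have "\<epsilon> t $ k = Z t $ k - \<Delta> $ k $ j * W t $ j"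
      using \<epsilon>[OF that, of k] s by simp
    then have "m $ k * \<epsilon> t $ k = m $ k * Z t $ k - (m $ k * \<Delta> $ k $ j) * W t $ j"
      by (simp only: right_diff_distrib mult.assoc)
    then show ?thesis
      unfolding dev_l[OF that] a(1) W[OF that] by (simp add: algebra_simps)
  qed
  define r r' where "r = T' $ k / m $ k" and "r' = T' $ l / m $ l"
  have mr: "m $ k * r = T' $ k" "m $ l * r' = T' $ l"
    using m_pos[of k] m_pos[of l] by (simp_all add: r_def r'_def)
  have DT: "((\<lambda>t. T t $ i) has_real_derivative T' $ i) (at t)" for i
    by (rule has_vector_derivative_vecD[OF T'])
  have T'_nonneg: "0 \<le> T' $ i" for i
    using derivative_nonneg_if_mono_on[OF F(10) t DT] .
  have Y: "Y t $ j = t - (T t $ k + T t $ l)" if "0 \<le> t" for t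
  proof -
    have "(constituency s *v T t) $ j = (\<Sum>i\<in>UNIV. (if s i = j then T t $ i else 0))"
      unfolding matrix_vector_mult_def constituency_def by (auto intro!: sum.cong)
    then show ?thesis
      using F(11)[OF that] by (simp add: sum_station)
  qed
  have DY: "((\<lambda>t. Y t $ j) has_real_derivative 1 - (T' $ k + T' $ l)) (at t)"
    by (rule has_field_derivative_transform_within_open[where S = "{0<..}", OF DERIV_diff[OF DERIV_ident DERIV_add[OF DT[of k] DT[of l]]]])
      (use t Y in auto)
  have util: "T' $ k + T' $ l \<le> 1"
    using derivative_nonneg_if_mono_on[OF F(12) t DY] by simp
  define D where "D = (1 - a) * (m $ l * (q - r')) - a * (m $ k * (p - r))"
  have DZ': "((\<lambda>t. Z t $ k) has_real_derivative p - r) (at t)" "((\<lambda>t. Z t $ l) has_real_derivative q - r') (at t)"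
    using DZ by (simp_all add: r_def r'_def)
  have DX: "((\<lambda>t. m $ l * \<epsilon> t $ l) has_real_derivative D) (at t)"
    unfolding D_def
    by (rule has_field_derivative_transform_within_open[where S = "{0<..}",
          OF DERIV_diff[OF DERIV_cmult[OF DERIV_cmult[OF DZ'(2)]] DERIV_cmult[OF DERIV_cmult[OF DZ'(1)]]]])
      (use t dev_l in auto)
  have Zk: "0 \<le> m $ k * Z t $ k" and Zl: "0 \<le> m $ l * Z t $ l"
    using F(7)[of t] t m_pos[of k] m_pos[of l] by simp_all
  have pos_case: "a < 1 \<and> r = 0 \<and> m $ l * r' = 1" if x: "0 < m $ l * \<epsilon> t $ l"
  proof -
    \<comment> \<open>For a = 1 the deviation would be - (m $ k * Z t $ k), which is not positive;
      \<open>neg_case\<close> excludes a = 0 in the same way.\<close>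
    have "a < 1"
    proof (rule ccontr)
      assume "\<not> a < 1"
      then have "a = 1"
        using a by simp
      then show False
        using x dev_l[of t] Zk t by simp
    qed
    moreover have signs: "0 < \<epsilon> t $ l" "\<not> 0 < \<epsilon> t $ k"
      using zero_less_mult_pos[OF x m_pos] mult_pos_pos[OF m_pos[of k], of "\<epsilon> t $ k"] x dev_k[of t] t by linarith+
    then have "{i. i \<le> l \<and> s i = s l \<and> 0 < \<epsilon> t $ i} = {l}"
      using s unfolding sj by auto
    then have "T' $ l = 1"
      using F(14)[OF t T', of l] signs by (simp add: priority_sum_def)
    moreover from this have "T' $ k = 0"
      using util T'_nonneg[of k] by simp
    ultimately show ?thesis
      using mr by (simp add: r_def)
  qed
  have neg_case: "0 < a \<and> m $ k * r = 1 \<and> r' = 0" if x: "m $ l * \<epsilon> t $ l < 0"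
  proof -
    have "0 < a"
    proof (rule ccontr)
      assume "\<not> 0 < a"
      then have "a = 0"
        using a by simp
      then show False
        using x dev_l[of t] Zl t by simp
    qed
    moreover have "0 < m $ k * \<epsilon> t $ k"
      using x dev_k[of t] t by simp
    then have signs: "0 < \<epsilon> t $ k" "\<not> 0 < \<epsilon> t $ l"
      using zero_less_mult_pos[OF _ m_pos] mult_pos_pos[OF m_pos[of l], of "\<epsilon> t $ l"] x by (blast, linarith)
    then have "{i. i \<le> k \<and> s i = s k \<and> 0 < \<epsilon> t $ i} = {k}"
      using s kl(1) unfolding sj by auto
    then have "T' $ k = 1"
      using F(14)[OF t T', of k] signs by (simp add: priority_sum_def)
    moreover from this have "T' $ l = 0"
      using util T'_nonneg[of l] by simp
    ultimately show ?thesis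
      using mr by (simp add: r'_def)
  qed
  have zero_case: "D = 0 \<and> (m $ k * r + m $ l * r' = 1 \<or> r = p \<and> r' = q)" if x: "m $ l * \<epsilon> t $ l = 0"
  proof
    show "D = 0"
      using not_simple_zero x DX by blast
    show "m $ k * r + m $ l * r' = 1 \<or> r = p \<and> r' = q"
    \<comment> \<open>At an empty station both queues are at their minimum 0, so departures match
      arrivals. Otherwise complementarity stops \<open>Y\<close>, and the server is fully
      used.\<close>
    proof (cases "W t $ j = 0")
      case True
      then have zero: "Z t $ k = 0" "Z t $ l = 0"
        using W[of t] Zk Zl t m_pos[of k] m_pos[of l] by (auto simp: add_nonneg_eq_0_iff)
      have "p - r = 0" "q - r' = 0"
        using derivative_zero_at_minimum[OF DZ'(1) t zero(1) F(7)] derivative_zero_at_minimum[OF DZ'(2) t zero(2) F(7)]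
        by auto
      then show ?thesis
        by simp
    next
      case False
      then have Wpos: "0 < W t $ j"
        using W[of t] Zk Zl t by simp
      obtain LW LY where lip: "LW-lipschitz_on {0..} W" "LY-lipschitz_on {0..} Y"
        using F(2,5) by blast
      have contW: "continuous_on {0..} (\<lambda>t. W t $ j)" and contY: "continuous_on {0..} (\<lambda>t. Y t $ j)"
        using lip by (auto intro: continuous_on_component lipschitz_on_continuous_on)
      have cont: "isCont (\<lambda>t. W t $ j) t"
        using contW t by (intro continuous_on_interior[of "{0..}"]) auto
      have "1 - (T' $ k + T' $ l) = 0"
      proof (rule derivative_zero_if_locally_constant[where w = "\<lambda>t. W t $ j", OF _ cont Wpos t DY])
        show "Y v $ j = Y u $ j" if "0 \<le> u" "u \<le> v" "\<And>r. u \<le> r \<Longrightarrow> r \<le> v \<Longrightarrow> 0 < W r $ j" for u v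
          using complementary_imp_constant[OF F(13) contW contY F(12) that] .
      qed
      then show ?thesis
        using mr by simp
    qed
  qed
  have "station_rates (m $ k) (m $ l) a p q r r' (m $ l * \<epsilon> t $ l) D"
    unfolding station_rates_def
    using T'_nonneg[of k] T'_nonneg[of l] m_pos[of k] m_pos[of l] util mr pos_case neg_case zero_case
    by (auto simp: D_def r_def r'_def right_diff_distrib)
  then show ?thesis
    using DX unfolding a_def r_def r'_def by blast
qed

context dhv_ratio
begin

lemma fluid_queue_nth:
  assumes fs: "fluid_solution (dhv_arrivals \<alpha>) dhv_routing m dhv_server \<Delta> Z W \<epsilon> T Y" and "0 \<le> t"
  shows "Z t $ Class1 = Z 0 $ Class1 + (t * \<alpha> - T t $ Class1 / m $ Class1)"
    "Z t $ Class2 = Z 0 $ Class2 + (T t $ Class1 / m $ Class1 - T t $ Class2 / m $ Class2)"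
    "Z t $ Class3 = Z 0 $ Class3 + (T t $ Class2 / m $ Class2 - T t $ Class3 / m $ Class3)"
    "Z t $ Class4 = Z 0 $ Class4 + (T t $ Class3 / m $ Class3 - T t $ Class4 / m $ Class4)"
    "Z t $ Class5 = Z 0 $ Class5 + (T t $ Class4 / m $ Class4 - T t $ Class5 / m $ Class5)"
    "Z t $ Class6 = Z 0 $ Class6 + (T t $ Class5 / m $ Class5 - T t $ Class6 / m $ Class6)"
proof -
  have ne: "m $ k \<noteq> 0" for k
    using m_pos[of k] by simp
  have "matrix_inv (diag_mat m) = diag_mat (\<chi> k. 1 / m $ k)"
    by (rule matrix_inv_eqI)
      (simp_all add: vec_eq_iff all_dhv_class matrix_mult_nth sum_dhv_class diag_mat_def mat_def ne)
  then have "(mat 1 - transpose dhv_routing) ** matrix_inv (diag_mat m) *v T t =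
      (\<chi> k. T t $ k / m $ k - (\<Sum>l\<in>UNIV. if class_number k = class_number l + 1 then T t $ l / m $ l else 0))"
    by (simp add: vec_eq_iff all_dhv_class matrix_vector_mult_def matrix_mult_nth sum_dhv_class diag_mat_def
        mat_def transpose_def dhv_routing_def)
  with fluid_solutionD(6)[OF assms] show
    "Z t $ Class1 = Z 0 $ Class1 + (t * \<alpha> - T t $ Class1 / m $ Class1)"
    "Z t $ Class2 = Z 0 $ Class2 + (T t $ Class1 / m $ Class1 - T t $ Class2 / m $ Class2)"
    "Z t $ Class3 = Z 0 $ Class3 + (T t $ Class2 / m $ Class2 - T t $ Class3 / m $ Class3)"
    "Z t $ Class4 = Z 0 $ Class4 + (T t $ Class3 / m $ Class3 - T t $ Class4 / m $ Class4)"
    "Z t $ Class5 = Z 0 $ Class5 + (T t $ Class4 / m $ Class4 - T t $ Class5 / m $ Class5)"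
    "Z t $ Class6 = Z 0 $ Class6 + (T t $ Class5 / m $ Class5 - T t $ Class6 / m $ Class6)"
    by (simp_all add: dhv_arrivals_def sum_dhv_class)
qed

lemma fluid_queue_deriv:
  assumes fs: "fluid_solution (dhv_arrivals \<alpha>) dhv_routing m dhv_server \<Delta> Z W \<epsilon> T Y"
    and t: "0 < t" and DT: "\<And>k. ((\<lambda>t. T t $ k) has_real_derivative T' $ k) (at t)"
  shows "((\<lambda>t. Z t $ Class1) has_real_derivative \<alpha> - T' $ Class1 / m $ Class1) (at t)"
    "((\<lambda>t. Z t $ Class2) has_real_derivative T' $ Class1 / m $ Class1 - T' $ Class2 / m $ Class2) (at t)"
    "((\<lambda>t. Z t $ Class3) has_real_derivative T' $ Class2 / m $ Class2 - T' $ Class3 / m $ Class3) (at t)"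
    "((\<lambda>t. Z t $ Class4) has_real_derivative T' $ Class3 / m $ Class3 - T' $ Class4 / m $ Class4) (at t)"
    "((\<lambda>t. Z t $ Class5) has_real_derivative T' $ Class4 / m $ Class4 - T' $ Class5 / m $ Class5) (at t)"
    "((\<lambda>t. Z t $ Class6) has_real_derivative T' $ Class5 / m $ Class5 - T' $ Class6 / m $ Class6) (at t)"
proof -
  have *: "((\<lambda>t. Z t $ k) has_real_derivative D) (at t)"
    if "(f has_real_derivative D) (at t)" "\<And>t. 0 \<le> t \<Longrightarrow> Z t $ k = Z 0 $ k + f t" for k f D
  proof -
    have "((\<lambda>t. Z 0 $ k + f t) has_real_derivative 0 + D) (at t)"
      by (intro DERIV_add DERIV_const that(1))
    then have "((\<lambda>t. Z t $ k) has_real_derivative 0 + D) (at t)"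
    proof (rule has_field_derivative_transform_within_open[where S = "{0<..}"])
      show "Z 0 $ k + f u = Z u $ k" if "u \<in> {0<..}" for u
        using that by (intro \<open>\<And>t. 0 \<le> t \<Longrightarrow> Z t $ k = Z 0 $ k + f t\<close>[symmetric]) simp
    qed (use t in auto)
    then show ?thesis
      by simp
  qed
  have "((\<lambda>t. t * \<alpha>) has_real_derivative \<alpha>) (at t)"
    by (auto intro!: derivative_eq_intros)
  note D = DERIV_diff[OF this DERIV_cdivide[OF DT]] DERIV_diff[OF DERIV_cdivide[OF DT] DERIV_cdivide[OF DT]]
  show
    "((\<lambda>t. Z t $ Class1) has_real_derivative \<alpha> - T' $ Class1 / m $ Class1) (at t)"
    "((\<lambda>t. Z t $ Class2) has_real_derivative T' $ Class1 / m $ Class1 - T' $ Class2 / m $ Class2) (at t)"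
    "((\<lambda>t. Z t $ Class3) has_real_derivative T' $ Class2 / m $ Class2 - T' $ Class3 / m $ Class3) (at t)"
    "((\<lambda>t. Z t $ Class4) has_real_derivative T' $ Class3 / m $ Class3 - T' $ Class4 / m $ Class4) (at t)"
    "((\<lambda>t. Z t $ Class5) has_real_derivative T' $ Class4 / m $ Class4 - T' $ Class5 / m $ Class5) (at t)"
    "((\<lambda>t. Z t $ Class6) has_real_derivative T' $ Class5 / m $ Class5 - T' $ Class6 / m $ Class6) (at t)"
    by (rule *[OF D(1)] *[OF D(2)], rule fluid_queue_nth[OF fs], assumption)+
qed

lemma state_space_collapse_dhv:
  assumes balanced: "dhv_balanced (m $ Class1) (m $ Class2) (m $ Class3) (m $ Class4) (m $ Class5) (m $ Class6)
      (m $ Class4 * \<Delta> $ Class4 $ Station1) (m $ Class5 * \<Delta> $ Class5 $ Station2) (m $ Class6 * \<Delta> $ Class6 $ Station3) \<alpha>"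
    and sum: "m $ Class2 + m $ Class4 + m $ Class6 < 2"
  shows "state_space_collapse (dhv_arrivals \<alpha>) dhv_routing m dhv_server \<Delta>"
  unfolding state_space_collapse_def
proof (intro allI impI)
  fix Z W \<epsilon> T Y
  assume fs: "fluid_solution (dhv_arrivals \<alpha>) dhv_routing m dhv_server \<Delta> Z W \<epsilon> T Y"
  note F = fluid_solutionD[OF fs]
  define dev where "dev = (\<lambda>k t. m $ k * \<epsilon> t $ k)"
  define N where "N = (\<Union>k. {t. 0 < t \<and> \<not> (\<lambda>t. T t $ k) differentiable (at t)}) \<union>
    (\<Union>k. {t. dev k t = 0 \<and> (\<exists>D. D \<noteq> 0 \<and> (dev k has_real_derivative D) (at t))})"
  obtain L LT where L: "L-lipschitz_on {0..} \<epsilon>" and LT: "LT-lipschitz_on {0..} T"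
    using F(3,4) by blast
  have lt1: "0 \<le> m $ Class4" "m $ Class4 \<le> 1" "0 \<le> m $ Class5" "m $ Class5 \<le> 1" "0 \<le> m $ Class6" "m $ Class6 \<le> 1"
    using m_unit m_pos[of Class1] m_pos[of Class2] m_pos[of Class3] m_pos[of Class4] m_pos[of Class5] m_pos[of Class6]
    by linarith+
  have stations: "{i. dhv_server i = Station1} = {Class1, Class4}" "{i. dhv_server i = Station2} = {Class2, Class5}"
      "{i. dhv_server i = Station3} = {Class3, Class6}"
    by (simp_all add: set_eq_iff all_dhv_class)
  have "dhv_trajectory (m $ Class1) (m $ Class2) (m $ Class3) (m $ Class4) (m $ Class5) (m $ Class6)
      (m $ Class4 * \<Delta> $ Class4 $ Station1) (m $ Class5 * \<Delta> $ Class5 $ Station2) (m $ Class6 * \<Delta> $ Class6 $ Station3) \<alpha>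
      (dev Class4) (dev Class5) (dev Class6) L N"
  proof (intro dhv_trajectory.intro[OF balanced] dhv_trajectory_axioms.intro)
    show "L-lipschitz_on {0..} (dev Class4)" "L-lipschitz_on {0..} (dev Class5)" "L-lipschitz_on {0..} (dev Class6)"
      unfolding dev_def using lipschitz_on_scaled_component[OF L] lt1 by auto
    have "LT-lipschitz_on {0..} (\<lambda>t. T t $ k)" for k
      using lipschitz_on_scaled_component[OF LT, of 1 k] by simp
    then have "negligible {t. 0 < t \<and> \<not> (\<lambda>t. T t $ k) differentiable (at t)}" for k
      using mono_lipschitz_half_line_differentiable_ae[OF F(10)] by blast
    moreover have "negligible {t. dev k t = 0 \<and> (\<exists>D. D \<noteq> 0 \<and> (dev k has_real_derivative D) (at t))}" for k
      using countable_simple_zeros[of "dev k"]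
      by (simp add: negligible_iff_null_sets countable_imp_null_set_lborel null_sets_completionI)
    ultimately show "negligible N"
      unfolding N_def by (intro negligible_Un negligible_Union finite_imageI finite_class.finite_UNIV) auto
    fix t :: real assume t: "0 < t" "t \<notin> N"
    have "\<exists>D. ((\<lambda>t. T t $ k) has_real_derivative D) (at t)" for k
      using t by (auto simp: N_def real_differentiable_def)
    then obtain D where D: "\<And>k. ((\<lambda>t. T t $ k) has_real_derivative D k) (at t)"
      by metis
    define T' where "T' = (\<chi> k. D k)"
    have DT: "((\<lambda>t. T t $ k) has_real_derivative T' $ k) (at t)" for k
      using D by (simp add: T'_def)
    have T': "(T has_vector_derivative T') (at t)"
      using DT by (rule has_vector_derivative_vecI)
    have nsz: "\<forall>D. m $ k * \<epsilon> t $ k = 0 \<longrightarrow> ((\<lambda>t. m $ k * \<epsilon> t $ k) has_real_derivative D) (at t) \<longrightarrow> D = 0" for k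
      using t(2) unfolding N_def dev_def by blast
    note DZ = fluid_queue_deriv[OF fs t(1) DT]
    have less: "Class1 < Class4" "Class2 < Class5" "Class3 < Class6"
      by (simp_all add: less_dhv_class_def)
    note st = two_class_station_rates[OF fs ratio m_pos _ _ t(1) T' _ _ nsz]
    obtain x' y' z' where
      "station_rates (m $ Class1) (m $ Class4) (m $ Class4 * \<Delta> $ Class4 $ Station1) \<alpha> (T' $ Class3 / m $ Class3)
        (T' $ Class1 / m $ Class1) (T' $ Class4 / m $ Class4) (dev Class4 t) x'" "(dev Class4 has_real_derivative x') (at t)"
      "station_rates (m $ Class2) (m $ Class5) (m $ Class5 * \<Delta> $ Class5 $ Station2) (T' $ Class1 / m $ Class1)
        (T' $ Class4 / m $ Class4) (T' $ Class2 / m $ Class2) (T' $ Class5 / m $ Class5) (dev Class5 t) y'"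
      "(dev Class5 has_real_derivative y') (at t)"
      "station_rates (m $ Class3) (m $ Class6) (m $ Class6 * \<Delta> $ Class6 $ Station3) (T' $ Class2 / m $ Class2)
        (T' $ Class5 / m $ Class5) (T' $ Class3 / m $ Class3) (T' $ Class6 / m $ Class6) (dev Class6 t) z'"
      "(dev Class6 has_real_derivative z') (at t)"
      using st[OF less(1) stations(1) DZ(1,4)] st[OF less(2) stations(2) DZ(2,5)] st[OF less(3) stations(3) DZ(3,6)]
      unfolding dev_def by blast
    then show "\<exists>d1 d2 d3 d4 d5 d6 x' y' z'.
        dhv_balanced.rates (m $ Class1) (m $ Class2) (m $ Class3) (m $ Class4) (m $ Class5) (m $ Class6)
          (m $ Class4 * \<Delta> $ Class4 $ Station1) (m $ Class5 * \<Delta> $ Class5 $ Station2) (m $ Class6 * \<Delta> $ Class6 $ Station3) \<alpha>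
          d1 d2 d3 d4 d5 d6 (dev Class4 t) x' (dev Class5 t) y' (dev Class6 t) z' \<and>
        (dev Class4 has_real_derivative x') (at t) \<and> (dev Class5 has_real_derivative y') (at t) \<and>
        (dev Class6 has_real_derivative z') (at t)"
      unfolding dhv_balanced.rates_def[OF balanced] by blast
  qed
  from dhv_trajectory.collapse[OF this sum]
  obtain t0 where t0: "\<And>t. t0 \<le> t \<Longrightarrow> dev Class4 t = 0 \<and> dev Class5 t = 0 \<and> dev Class6 t = 0"
    unfolding eventually_at_top_linorder by blast
  have "Z t = \<Delta> *v W t" if "max 0 t0 \<le> t" for t
  proof -
    have t: "0 \<le> t"
      using that by simp
    have high: "\<epsilon> t $ Class4 = 0" "\<epsilon> t $ Class5 = 0" "\<epsilon> t $ Class6 = 0"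
      using t0[of t] that m_pos[of Class4] m_pos[of Class5] m_pos[of Class6] by (auto simp: dev_def)
    \<comment> \<open>The high classes have no deviation left; since C M annihilates \<epsilon>,
      neither have the low ones.\<close>
    have "(constituency dhv_server ** diag_mat m) *v \<epsilon> t = W t - (constituency dhv_server ** diag_mat m ** \<Delta>) *v W t"
      unfolding F(9)[OF t] matrix_vector_mult_diff_distrib F(8)[OF t, symmetric] matrix_vector_mul_assoc ..
    then have "(constituency dhv_server ** diag_mat m) *v \<epsilon> t = 0"
      using ratio by (simp add: ratio_matrix_def)
    then have "m $ Class1 * \<epsilon> t $ Class1 = 0" "m $ Class2 * \<epsilon> t $ Class2 = 0" "m $ Class3 * \<epsilon> t $ Class3 = 0"
      unfolding vec_eq_iff all_dhv_station matrix_vector_mult_def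
      by (simp_all add: service_matrix_nth sum_dhv_class high)
    then have "\<epsilon> t = 0"
      using high m_pos[of Class1] m_pos[of Class2] m_pos[of Class3] by (simp add: vec_eq_iff all_dhv_class)
    then show ?thesis
      using F(9)[OF t] by simp
  qed
  then show "\<exists>t0\<ge>0. \<forall>t\<ge>t0. Z t = \<Delta> *v W t"
    by (intro exI[of _ "max 0 t0"]) auto
qed

end

section \<open>Load and threshold\<close>

lemma traffic_intensity_dhv:
  assumes "m $ Class1 + m $ Class4 = 1" "m $ Class2 + m $ Class5 = 1" "m $ Class3 + m $ Class6 = 1"
  shows "traffic_intensity (dhv_arrivals \<alpha>) dhv_routing m dhv_server $ j = \<alpha>"
proof -
  have "traffic_intensity (dhv_arrivals \<alpha>) dhv_routing m dhv_server $ j =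
      (\<Sum>l\<in>UNIV. (\<Sum>k\<in>UNIV. (if dhv_server k = j then m $ k else 0) *
        (if class_number l \<le> class_number k then 1 else 0)) * dhv_arrivals \<alpha> $ l)"
    unfolding traffic_intensity_def visit_matrix_dhv
    by (simp only: matrix_vector_mult_def matrix_mult_nth[of "constituency _ ** _"] service_matrix_nth vec_lambda_beta)
  also have "\<dots> = (\<Sum>k\<in>UNIV. if dhv_server k = j then m $ k else 0) * \<alpha>"
    by (simp add: sum_dhv_class dhv_arrivals_def)
  also have "(\<Sum>k\<in>UNIV. if dhv_server k = j then m $ k else 0) = 1"
    using assms by (cases j) (simp_all add: sum_dhv_class)
  finally show ?thesis
    by simp
qed

text \<open>The lower bound on \<alpha> is the load at which equality would hold; exceeding it
  yields one of the conditions \<open>near_critical\<close>.\<close>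

lemma critical_load_bound:
  fixes \<mu> \<nu> \<kappa> \<alpha> :: real
  assumes "0 < \<mu>" "0 < \<kappa>" "(1 - \<nu> / \<kappa>) / \<mu> < \<alpha>"
  shows "\<kappa> * (1 - \<mu> * \<alpha>) < \<nu>"
  using assms by (simp add: field_simps)

text \<open>At load 1 the condition of \<open>critical_load_bound\<close> reads \<kappa> * \<nu> <
  \<nu>, so equality occurs at a smaller load.\<close>

lemma critical_load_less_1:
  fixes \<mu> \<nu> \<kappa> :: real
  assumes "0 < \<mu>" "0 < \<nu>" "\<mu> + \<nu> = 1" "0 < \<kappa>" "\<kappa> < 1"
  shows "(1 - \<nu> / \<kappa>) / \<mu> < 1"
proof -
  have "\<nu> * \<kappa> < \<nu>"
    using assms by simp
  then have "\<nu> < \<nu> / \<kappa>"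
    using assms by (simp add: field_simps)
  then have "1 - \<nu> / \<kappa> < \<mu>"
    using assms by linarith
  then show ?thesis
    using assms by simp
qed

theorem corollary5:
  fixes m :: "real^dhv_class"
  assumes "\<forall>k. 0 < m $ k"
    and "m $ Class1 + m $ Class4 = 1"
    and "m $ Class2 + m $ Class5 = 1"
    and "m $ Class3 + m $ Class6 = 1"
  shows "\<exists>\<alpha>\<^sub>0. 0 < \<alpha>\<^sub>0 \<and> \<alpha>\<^sub>0 < 1 \<and>
    (\<forall>\<alpha>\<^sub>1 > \<alpha>\<^sub>0.
       (let \<rho> = traffic_intensity (dhv_arrivals \<alpha>\<^sub>1) dhv_routing m dhv_server
        in \<rho> $ Station1 = \<rho> $ Station2 \<and> \<rho> $ Station2 = \<rho> $ Station3 \<and> \<rho> $ Station3 < 1) \<longrightarrow>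
       m $ Class2 + m $ Class4 + m $ Class6 < 2 \<longrightarrow>
       robustly_queue_ratio_stable (dhv_arrivals \<alpha>\<^sub>1) dhv_routing m dhv_server)"
proof -
  define critical where "critical = (\<lambda>\<mu> \<nu> \<kappa>. (1 - \<nu> / \<kappa>) / (\<mu>::real))"
  \<comment> \<open>The entry 1 / 2 keeps the threshold positive, as the critical loads themselves
    may be negative.\<close>
  define A where "A = Max {1 / 2, critical (m $ Class1) (m $ Class4) (m $ Class5),
    critical (m $ Class1) (m $ Class4) (m $ Class6), critical (m $ Class2) (m $ Class5) (m $ Class6)}"
  have m: "0 < m $ k" for k
    using assms(1) by blast
  have lt1: "m $ Class5 < 1" "m $ Class6 < 1"
    using assms(3,4) m[of Class2] m[of Class3] by linarith+
  have "A < 1"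
    unfolding A_def critical_def using critical_load_less_1[OF m m] assms(2-4) m lt1 by simp
  moreover have "1 / 2 \<le> A"
    unfolding A_def by simp
  moreover have "robustly_queue_ratio_stable (dhv_arrivals \<alpha>) dhv_routing m dhv_server"
    if \<alpha>: "A < \<alpha>" "traffic_intensity (dhv_arrivals \<alpha>) dhv_routing m dhv_server $ Station3 < 1"
      and sum: "m $ Class2 + m $ Class4 + m $ Class6 < 2" for \<alpha>
    unfolding robustly_queue_ratio_stable_def
  proof (intro allI impI)
    fix \<Delta> :: "(dhv_class, dhv_station) rmat" assume ratio: "ratio_matrix m dhv_server \<Delta>"
    interpret dhv_ratio m \<Delta>
      using m assms(2-4) ratio by unfold_locales auto
    have "0 < \<alpha>"
      using \<open>1 / 2 \<le> A\<close> \<alpha>(1) by linarith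
    have "\<alpha> < 1"
      using \<alpha>(2) by (simp add: traffic_intensity_dhv[OF assms(2-4)])
    have crit: "critical (m $ Class1) (m $ Class4) (m $ Class5) < \<alpha>" "critical (m $ Class1) (m $ Class4) (m $ Class6) < \<alpha>"
        "critical (m $ Class2) (m $ Class5) (m $ Class6) < \<alpha>" "1 / 2 < \<alpha>"
      using \<alpha>(1) by (auto simp: A_def)
    have low: "0 \<le> m $ Class1 * \<Delta> $ Class1 $ Station1" "0 \<le> m $ Class2 * \<Delta> $ Class2 $ Station2"
        "0 \<le> m $ Class3 * \<Delta> $ Class3 $ Station3"
      using pos \<delta>_nonneg by simp_all
    then have high: "m $ Class4 * \<Delta> $ Class4 $ Station1 \<le> 1" "m $ Class5 * \<Delta> $ Class5 $ Station2 \<le> 1"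
        "m $ Class6 * \<Delta> $ Class6 $ Station3 \<le> 1"
      using \<delta>_unit by linarith+
    have "dhv_balanced (m $ Class1) (m $ Class2) (m $ Class3) (m $ Class4) (m $ Class5) (m $ Class6)
      (m $ Class4 * \<Delta> $ Class4 $ Station1) (m $ Class5 * \<Delta> $ Class5 $ Station2) (m $ Class6 * \<Delta> $ Class6 $ Station3) \<alpha>"
      using pos unit \<delta>_nonneg high \<open>0 < \<alpha>\<close> \<open>\<alpha> < 1\<close>
        critical_load_bound[OF pos(1) pos(5) crit(1)[unfolded critical_def]]
        critical_load_bound[OF pos(1) pos(6) crit(2)[unfolded critical_def]]
        critical_load_bound[OF pos(2) pos(6) crit(3)[unfolded critical_def]]
      by unfold_locales simp_all
    then show "state_space_collapse (dhv_arrivals \<alpha>) dhv_routing m dhv_server \<Delta> \<and>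
        invertible (total_workload_matrix dhv_routing m dhv_server \<Delta>) \<and>
        skorohod_stable (reflection_matrix dhv_routing m dhv_server \<Delta>) (drift_vector (dhv_arrivals \<alpha>) dhv_routing m dhv_server \<Delta>)"
      using state_space_collapse_dhv sum invertible_total_workload
        skorohod_stable_dhv[OF \<open>\<alpha> < 1\<close> traffic_intensity_dhv[OF assms(2-4)]] by blast
  qed
  ultimately show ?thesis
    by (intro exI[of _ A]) (auto simp: Let_def)
qed

end
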